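(* Let $\varphi\in\mathcal S(\mathbb R^d)$ with $\|\varphi\|_{L^2}=1$, and let $\alpha\in(0,1)$. There exists $C=C(\alpha,\varphi)>0$ (depending on the dimension $d$ as well) such that, for every $a\in A^\alpha_\infty(\mathbb R^{2d})$ and every $h>0$, $$C^{-1}\boldsymbol\lambda(a,h)\le\inf\sigma(A_{a,h})\le C\,\boldsymbol\lambda(a,h),$$ where $$\boldsymbol\lambda(a,h):=\inf\Big\{\frac1{|B|}\int_B a(x,\omega)\,dx\,d\omega:\ B\subset\mathbb R^{2d}\text{ is a Euclidean ball of radius }h^{1/2}\Big\}$$ and $\sigma(A_{a,h})$ is the spectrum of the anti-Wick operator $A_{a,h}$ with symbol $a$ and window $\varphi$.
   Context: For $\alpha\in(0,1)$, $A^\alpha_\infty(\mathbb R^{n})$ is the set of $w\in L^1_{\mathrm{loc}}(\mathbb R^n)$, $w>0$ a.e., such that for all Euclidean balls $B\subset\mathbb R^n$ and all measurable $E\subset B$: $|E|\ge(1-\alpha)|B|$ implies $\int_E w\ge\alpha\int_B w$. For $h>0$, the generalized coherent states are $\varphi^h_{(x_0,\omega_0)}(x)=h^{-d/4}e^{\frac ih\omega_0\cdot x}\varphi(h^{-1/2}(x-x_0))$, $x,x_0,\omega_0\in\mathbb R^d$. Let $a\ge0$ be a measurable function on $\mathbb R^{2d}$ with at most polynomial growth, meaning $\int_{B(0,r)}a\,dx\,d\omega\le C(1+r)^N$ for all $r>0$, for some $C,N>0$ (this holds for every $a\in A_\infty^\alpha(\mathbb R^{2d})$). The quadratic form $$Q_{a,h}(f)=(2\pi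 h)^{-d}\int_{\mathbb R^{2d}}a(x,\omega)|\langle f,\varphi^h_{(x,\omega)}\rangle|^2\,dx\,d\omega$$ with domain $\mathcal D_{a,h}=\{f\in L^2(\mathbb R^d):Q_{a,h}(f)<\infty\}$ is densely defined, nonnegative and closed. $A_{a,h}$ denotes the unique self-adjoint operator on $L^2(\mathbb R^d)$ associated with it: $\mathrm{dom}\,A_{a,h}\subset\mathcal D_{a,h}$ and $\langle A_{a,h}f,g\rangle=Q_{a,h}(f,g)$ for $f\in\mathrm{dom}\,A_{a,h}$, $g\in\mathcal D_{a,h}$. *)

theory Defs
  imports "HOL-Analysis.Analysis"
begin

section \<open>The class of weights\<close>

definition locally_integrable :: "('a::euclidean_space \<Rightarrow> real) \<Rightarrow> bool" where
  "locally_integrable w \<longleftrightarrow> (\<forall>K. compact K \<longrightarrow> set_integrable lebesgue K w)"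

definition A_infty :: "real \<Rightarrow> ('a::euclidean_space \<Rightarrow> real) set" where
  "A_infty \<alpha> = {w. locally_integrable w \<and> (AE x in lebesgue. 0 < w x) \<and>
     (\<forall>c r E. 0 < r \<longrightarrow> E \<in> sets lebesgue \<longrightarrow> E \<subseteq> ball c r \<longrightarrow>
        (1 - \<alpha>) * measure lebesgue (ball c r) \<le> measure lebesgue E \<longrightarrow>
        \<alpha> * (LINT x:ball c r|lebesgue. w x) \<le> (LINT x:E|lebesgue. w x))}"


section \<open>Schwartz functions\<close>

fun partial_derivs :: "'n list \<Rightarrow> (real^'n \<Rightarrow> complex) \<Rightarrow> (real^'n \<Rightarrow> complex)" where
  "partial_derivs [] f = f"
| "partial_derivs (i # is) f = (\<lambda>x. frechet_derivative (partial_derivs is f) (at x) (axis i 1))"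

text \<open>A function is smooth iff all its iterated partial derivatives exist and are (Frechet)
  differentiable everywhere. Derivative multi-indices are lists of coordinate directions,
  multi-indices of monomials are functions from coordinates to exponents.\<close>

definition schwartz :: "(real^'n \<Rightarrow> complex) \<Rightarrow> bool" where
  "schwartz f \<longleftrightarrow>
     (\<forall>is x. partial_derivs is f differentiable (at x)) \<and>
     (\<forall>is (m :: 'n \<Rightarrow> nat). \<exists>C. \<forall>x. cmod ((\<Prod>i\<in>UNIV. (x $ i) ^ m i) *\<^sub>R partial_derivs is f x) \<le> C)"


section \<open>Square-integrable functions and unbounded operators\<close>

text \<open>Elements of the Hilbert space are represented by functions; two representatives denote the
  same element iff they agree almost everywhere.\<close>

definition L2 :: "('a::euclidean_space \<Rightarrow> complex) set" where
  "L2 = {f. f \<in> borel_measurable lebesgue \<and> integrable lebesgue (\<lambda>x. (cmod (f x))\<^sup>2)}"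

definition l2_inner :: "('a::euclidean_space \<Rightarrow> complex) \<Rightarrow> ('a \<Rightarrow> complex) \<Rightarrow> complex" where
  "l2_inner f g = (LINT x|lebesgue. f x * cnj (g x))"

definition l2_norm :: "('a::euclidean_space \<Rightarrow> complex) \<Rightarrow> real" where
  "l2_norm f = sqrt (LINT x|lebesgue. (cmod (f x))\<^sup>2)"

text \<open>An unbounded operator is given by its graph, consisting of all pairs of representatives.\<close>

type_synonym 'a l2_graph = "(('a \<Rightarrow> complex) \<times> ('a \<Rightarrow> complex)) set"

definition densely_defined :: "'a::euclidean_space l2_graph \<Rightarrow> bool" where
  "densely_defined T \<longleftrightarrow> (\<forall>f\<in>L2. \<forall>\<epsilon>>0. \<exists>g\<in>Domain T. l2_norm (\<lambda>x. f x - g x) < \<epsilon>)"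

definition adjoint_graph :: "'a::euclidean_space l2_graph \<Rightarrow> 'a l2_graph" where
  "adjoint_graph T = {(u, v). u \<in> L2 \<and> v \<in> L2 \<and> (\<forall>(f, g)\<in>T. l2_inner g u = l2_inner f v)}"

text \<open>An adjoint graph is a complex subspace, closed under changing representatives, and it is
  single-valued (up to null sets) when the operator is densely defined. Hence these properties need
  not be listed in the definition of self-adjointness.\<close>

definition self_adjoint :: "'a::euclidean_space l2_graph \<Rightarrow> bool" where
  "self_adjoint T \<longleftrightarrow> T \<subseteq> L2 \<times> L2 \<and> densely_defined T \<and> adjoint_graph T = T"

text \<open>In the resolvent set, the first condition is surjectivity of \<open>T - z\<close>, the second is
  injectivity together with boundedness of the inverse.\<close>

definition resolvent_set :: "'a::euclidean_space l2_graph \<Rightarrow> complex set" where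
  "resolvent_set T = {z.
     (\<forall>k\<in>L2. \<exists>(f, g)\<in>T. AE x in lebesgue. g x - z * f x = k x) \<and>
     (\<exists>M. \<forall>(f, g)\<in>T. l2_norm f \<le> M * l2_norm (\<lambda>x. g x - z * f x))}"

definition spectrum :: "'a::euclidean_space l2_graph \<Rightarrow> complex set" where
  "spectrum T = - resolvent_set T"


section \<open>Anti-Wick operators\<close>

definition coherent_state ::
  "(real^'n \<Rightarrow> complex) \<Rightarrow> real \<Rightarrow> (real^'n) \<times> (real^'n) \<Rightarrow> (real^'n \<Rightarrow> complex)" where
  "coherent_state \<phi> h = (\<lambda>(x0, \<omega>0) x.
     complex_of_real (h powr (- real CARD('n) / 4)) *
     exp (\<i> / complex_of_real h * complex_of_real (\<omega>0 \<bullet> x)) *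
     \<phi> ((h powr (- 1 / 2)) *\<^sub>R (x - x0)))"

definition antiwick_quadratic_form ::
  "(real^'n \<Rightarrow> complex) \<Rightarrow> ((real^'n) \<times> (real^'n) \<Rightarrow> real) \<Rightarrow> real \<Rightarrow> (real^'n \<Rightarrow> complex) \<Rightarrow> ennreal" where
  "antiwick_quadratic_form \<phi> a h f =
     ennreal ((2 * pi * h) powr (- real CARD('n))) *
     (\<integral>\<^sup>+ z. ennreal (a z * (cmod (l2_inner f (coherent_state \<phi> h z)))\<^sup>2) \<partial>lebesgue)"

definition antiwick_form_domain ::
  "(real^'n \<Rightarrow> complex) \<Rightarrow> ((real^'n) \<times> (real^'n) \<Rightarrow> real) \<Rightarrow> real \<Rightarrow> (real^'n \<Rightarrow> complex) set" where
  "antiwick_form_domain \<phi> a h = {f \<in> L2. antiwick_quadratic_form \<phi> a h f < \<infinity>}"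

text \<open>The sesquilinear form obtained from the quadratic form by polarization.\<close>

definition antiwick_form ::
  "(real^'n \<Rightarrow> complex) \<Rightarrow> ((real^'n) \<times> (real^'n) \<Rightarrow> real) \<Rightarrow> real \<Rightarrow>
   (real^'n \<Rightarrow> complex) \<Rightarrow> (real^'n \<Rightarrow> complex) \<Rightarrow> complex" where
  "antiwick_form \<phi> a h f g =
     complex_of_real ((2 * pi * h) powr (- real CARD('n))) *
     (LINT z|lebesgue. complex_of_real (a z) *
        l2_inner f (coherent_state \<phi> h z) * cnj (l2_inner g (coherent_state \<phi> h z)))"

definition antiwick_operator ::
  "(real^'n \<Rightarrow> complex) \<Rightarrow> ((real^'n) \<times> (real^'n) \<Rightarrow> real) \<Rightarrow> real \<Rightarrow> (real^'n) l2_graph" where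
  "antiwick_operator \<phi> a h = (THE A. self_adjoint A \<and>
     Domain A \<subseteq> antiwick_form_domain \<phi> a h \<and>
     (\<forall>(f, Af)\<in>A. \<forall>g\<in>antiwick_form_domain \<phi> a h. l2_inner Af g = antiwick_form \<phi> a h f g))"

definition min_ball_average :: "('a::euclidean_space \<Rightarrow> real) \<Rightarrow> real \<Rightarrow> real" where
  "min_ball_average a h =
     (INF c. (LINT z:ball c (sqrt h)|lebesgue. a z) / measure lebesgue (ball c (sqrt h)))"

end

theory Submission
  imports Defs "HOL-Library.Function_Algebras" "HOL-Probability.Characteristic_Functions"
begin

text \<open>By the variational characterisation of the bottom of the spectrum of the operator of a closed
  form, one has to compare the infimum of \<open>Q(f) / \<parallel>f\<parallel>\<^sup>2\<close> with the smallest ball average of the weight.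

  Testing with a coherent state centred at \<open>z\<close> bounds the infimum by the average over the ball around \<open>z\<close>: the
  short-time Fourier transform of a Schwartz function with a Schwartz window decays faster than any power,
  which beats the polynomial growth of the mass of balls implied by the \<open>A\<^sub>\<infinity>\<close> condition.

  Conversely, the weight is at least a fixed multiple of the smallest average on a set that fills a
  fixed proportion of every ball of radius a small multiple of \<open>\<surd>h\<close>. By Moyal's identity the transform of any \<open>f\<close>
  varies little, in mean square, at that scale, so this set carries a fixed proportion of \<open>\<parallel>f\<parallel>\<^sup>2\<close>.\<close>

section \<open>Semi-Hilbert spaces\<close>

text \<open>The operator is given by a definite description, so existence and uniqueness of the
  self-adjoint operator of the form must come before any statement about its spectrum. Hilbert space
  elements are functions rather than classes, so the form theory is built on semi-inner products,
  where nonzero null vectors occur. The form domain is dense because it contains every coherent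
  state, by the same decay estimate that serves the upper bound, and coherent states are total by
  Moyal's identity. Three parameters tie the estimates together. With \<theta> to the power of the
  dimension of phase space equal to 1 - \<alpha>, a concentric ball shrunk by \<theta> keeps exactly
  the proportion 1 - \<alpha> of the volume; hence enlarging a ball by 1 / \<theta> multiplies its
  mass by at most 1 / \<alpha>. The decay exponent N makes
  \<open>\<theta> ^ N / \<alpha> \<le> 1 / 2\<close>, so that the sum over shells is geometric. The
  depth k is such that time-frequency shifts smaller than \<open>\<theta> ^ k\<close> move the
  window by less than \<alpha> / 4 in squared norm. None of the three depends on the weight or on h,
  which a unitary dilation removes.\<close>

locale semi_inner = vector_space sc for sc :: "complex \<Rightarrow> 'v::ab_group_add \<Rightarrow> 'v" +
  fixes V :: "'v set" and ip :: "'v \<Rightarrow> 'v \<Rightarrow> complex"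
  assumes sub: "subspace V"
    and ip_add: "\<And>f g k. f \<in> V \<Longrightarrow> g \<in> V \<Longrightarrow> k \<in> V \<Longrightarrow> ip (f + g) k = ip f k + ip g k"
    and ip_scale: "\<And>c f k. f \<in> V \<Longrightarrow> k \<in> V \<Longrightarrow> ip (sc c f) k = c * ip f k"
    and ip_commute: "\<And>f g. f \<in> V \<Longrightarrow> g \<in> V \<Longrightarrow> ip g f = cnj (ip f g)"
    and ip_self_nonneg: "\<And>f. f \<in> V \<Longrightarrow> 0 \<le> Re (ip f f)"
begin

definition sq :: "'v \<Rightarrow> real" where "sq f = Re (ip f f)"
definition nrm :: "'v \<Rightarrow> real" where "nrm f = sqrt (sq f)"

lemma V_closed [simp, intro]:
  "0 \<in> V" "f \<in> V \<Longrightarrow> g \<in> V \<Longrightarrow> f + g \<in> V" "f \<in> V \<Longrightarrow> g \<in> V \<Longrightarrow> f - g \<in> V" "f \<in> V \<Longrightarrow> sc c f \<in> V"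
  using sub by (auto intro: subspace_0 subspace_add subspace_diff subspace_scale)

lemma ip_add_right: "f \<in> V \<Longrightarrow> g \<in> V \<Longrightarrow> k \<in> V \<Longrightarrow> ip k (f + g) = ip k f + ip k g"
  by (metis V_closed(2) complex_cnj_add ip_add ip_commute)

lemma ip_scale_right: "f \<in> V \<Longrightarrow> k \<in> V \<Longrightarrow> ip k (sc c f) = cnj c * ip k f"
  by (metis V_closed(4) complex_cnj_mult ip_commute ip_scale)

lemma ip_diff: "f \<in> V \<Longrightarrow> g \<in> V \<Longrightarrow> k \<in> V \<Longrightarrow> ip (f - g) k = ip f k - ip g k"
  using ip_add[of "f - g" g k] by (simp add: V_closed)

lemma ip_diff_right: "f \<in> V \<Longrightarrow> g \<in> V \<Longrightarrow> k \<in> V \<Longrightarrow> ip k (f - g) = ip k f - ip k g"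
  using ip_add_right[of "f - g" g k] by (simp add: V_closed)

lemmas ip_simps = ip_add ip_add_right ip_scale ip_scale_right ip_diff ip_diff_right

lemma ip_self: "f \<in> V \<Longrightarrow> ip f f = complex_of_real (sq f)"
  using ip_commute[of f f] by (simp add: sq_def complex_eq_iff)

lemma sq_nonneg [simp]: "f \<in> V \<Longrightarrow> 0 \<le> sq f"
  by (simp add: sq_def ip_self_nonneg)

lemma nrm_nonneg [simp]: "f \<in> V \<Longrightarrow> 0 \<le> nrm f"
  by (simp add: nrm_def)

lemma nrm_power2: "f \<in> V \<Longrightarrow> (nrm f)\<^sup>2 = sq f"
  by (simp add: nrm_def)

lemma sq_scale: "f \<in> V \<Longrightarrow> sq (sc c f) = (cmod c)\<^sup>2 * sq f"
proof -
  assume f: "f \<in> V"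
  have "ip (sc c f) (sc c f) = (c * cnj c) * ip f f"
    using f by (simp add: ip_simps)
  also have "\<dots> = complex_of_real ((cmod c)\<^sup>2 * sq f)"
    using f by (simp only: complex_norm_square[symmetric] ip_self of_real_mult)
  finally show ?thesis by (simp add: sq_def[of "sc c f"])
qed

lemma nrm_scale: "f \<in> V \<Longrightarrow> nrm (sc c f) = cmod c * nrm f"
  by (simp add: nrm_def sq_scale real_sqrt_mult)

lemma sq_add: "f \<in> V \<Longrightarrow> g \<in> V \<Longrightarrow> sq (f + g) = sq f + 2 * Re (ip f g) + sq g"
  using ip_commute[of f g] by (simp add: sq_def ip_simps)

lemma sq_diff: "f \<in> V \<Longrightarrow> g \<in> V \<Longrightarrow> sq (f - g) = sq f - 2 * Re (ip f g) + sq g"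
  using ip_commute[of f g] by (simp add: sq_def ip_simps)

lemma nrm_minus_commute: "f \<in> V \<Longrightarrow> g \<in> V \<Longrightarrow> nrm (f - g) = nrm (g - f)"
  using ip_commute[of f g] by (simp add: nrm_def sq_diff)

text \<open>The discriminant argument along f - t c g with t real and c = \<open>ip f g\<close>. A
  null vector g leaves an expression affine in t and gets its own case.\<close>

lemma cauchy_schwarz_sq:
  assumes "f \<in> V" "g \<in> V"
  shows "(cmod (ip f g))\<^sup>2 \<le> sq f * sq g"
proof -
  define c where "c = ip f g"
  have key: "0 \<le> sq f - 2 * t * (cmod c)\<^sup>2 + t\<^sup>2 * (cmod c)\<^sup>2 * sq g" for t :: real
  proof -
    have "0 \<le> sq (f - sc (t * c) g)" using assms by simp
    also have "\<dots> = sq f - 2 * t * (cmod c)\<^sup>2 + t\<^sup>2 * (cmod c)\<^sup>2 * sq g"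
      using assms by (simp add: sq_diff sq_scale ip_simps c_def[symmetric] norm_mult power_mult_distrib
          cmod_power2 mult.assoc) (simp add: power2_eq_square algebra_simps)
    finally show ?thesis .
  qed
  show ?thesis
  proof (cases "sq g = 0")
    case True
    have "c = 0"
    proof (rule ccontr)
      assume "c \<noteq> 0"
      \<comment> \<open>At this value of t the expression in \<open>key\<close> equals - sq f - 2,
        which is negative.\<close>
      then have "2 * ((sq f + 1) / (cmod c)\<^sup>2) * (cmod c)\<^sup>2 = 2 * sq f + 2" by simp
      then show False using key[of "(sq f + 1) / (cmod c)\<^sup>2"] True sq_nonneg[OF assms(1)] by simp
    qed
    then show ?thesis using True by (simp add: c_def)
  next
    case False
    then have pos: "0 < sq g" using sq_nonneg[OF assms(2)] by linarith
    have "0 \<le> sq f - (cmod c)\<^sup>2 / sq g"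
      using key[of "1 / sq g"] pos by (simp add: power2_eq_square field_simps)
    then show ?thesis using pos by (simp add: c_def field_simps)
  qed
qed

lemma cauchy_schwarz:
  assumes "f \<in> V" "g \<in> V"
  shows "cmod (ip f g) \<le> nrm f * nrm g"
  using real_sqrt_le_mono[OF cauchy_schwarz_sq[OF assms]] by (simp add: nrm_def real_sqrt_mult)

lemma nrm_triangle:
  assumes "f \<in> V" "g \<in> V"
  shows "nrm (f + g) \<le> nrm f + nrm g"
proof (rule power2_le_imp_le)
  have "Re (ip f g) \<le> nrm f * nrm g"
    using cauchy_schwarz[OF assms] complex_Re_le_cmod order_trans by blast
  then show "(nrm (f + g))\<^sup>2 \<le> (nrm f + nrm g)\<^sup>2"
    using assms by (simp add: nrm_power2 sq_add power2_sum)
qed (use assms in simp)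

lemma nrm_triangle_sub:
  assumes "f \<in> V" "g \<in> V" "k \<in> V"
  shows "nrm (f - k) \<le> nrm (f - g) + nrm (g - k)"
  using nrm_triangle[of "f - g" "g - k"] assms by (simp add: V_closed)

lemma nrm_zero [simp]: "nrm 0 = 0"
  using nrm_scale[of 0 0] by (simp add: V_closed)

lemma ip_tendsto:
  assumes "\<And>n. s n \<in> V" "u \<in> V" "g \<in> V" "(\<lambda>n::nat. nrm (s n - u)) \<longlonglongrightarrow> 0"
  shows "(\<lambda>n. ip (s n) g) \<longlonglongrightarrow> ip u g"
proof (rule LIM_zero_cancel, rule Lim_null_comparison)
  show "\<forall>\<^sub>F n in sequentially. cmod (ip (s n) g - ip u g) \<le> nrm (s n - u) * nrm g"
    using assms cauchy_schwarz by (auto simp flip: ip_diff intro!: always_eventually)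
  show "(\<lambda>n. nrm (s n - u) * nrm g) \<longlonglongrightarrow> 0"
    using tendsto_mult_right[OF assms(4), of "nrm g"] by simp
qed

lemma ip_tendsto_right:
  assumes "\<And>n. s n \<in> V" "u \<in> V" "g \<in> V" "(\<lambda>n::nat. nrm (s n - u)) \<longlonglongrightarrow> 0"
  shows "(\<lambda>n. ip g (s n)) \<longlonglongrightarrow> ip g u"
  using tendsto_cnj[OF ip_tendsto[OF assms]] assms(1-3) by (simp flip: ip_commute)

text \<open>The first-order condition at a minimum: moving in the direction c = - t cnj d with t q <
  2 makes the expression negative unless d vanishes.\<close>

lemma Re_linear_zero:
  fixes d :: complex and q :: real
  assumes "\<And>c. 0 \<le> 2 * Re (c * d) + (cmod c)\<^sup>2 * q" "0 \<le> q"
  shows "d = 0"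
proof (rule ccontr)
  assume "d \<noteq> 0"
  define t where "t = 1 / (q + 1)"
  have t: "0 < t" "t * q < 2" using assms(2) by (auto simp: t_def field_simps)
  have "0 \<le> 2 * Re (- t * cnj d * d) + (cmod (- t * cnj d))\<^sup>2 * q" by (rule assms)
  also have "Re (- t * cnj d * d) = - t * (cmod d)\<^sup>2"
    unfolding cmod_power2 by (simp add: power2_eq_square algebra_simps)
  also have "(cmod (- t * cnj d))\<^sup>2 = t\<^sup>2 * (cmod d)\<^sup>2"
    using t by (simp add: norm_mult power_mult_distrib)
  finally have "0 \<le> (cmod d)\<^sup>2 * t * (t * q - 2)" by (simp add: power2_eq_square algebra_simps)
  moreover have "(cmod d)\<^sup>2 * t * (t * q - 2) < 0"
    using t \<open>d \<noteq> 0\<close> by (intro mult_pos_neg mult_pos_pos) auto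
  ultimately show False by simp
qed

end

locale semi_hilbert = semi_inner sc V ip for sc :: "complex \<Rightarrow> 'v::ab_group_add \<Rightarrow> 'v" and V ip +
  assumes complete: "\<And>s. (\<And>n::nat. s n \<in> V) \<Longrightarrow>
      (\<And>e. 0 < e \<Longrightarrow> \<exists>N. \<forall>m\<ge>N. \<forall>n\<ge>N. nrm (s m - s n) < e) \<Longrightarrow>
      \<exists>u\<in>V. (\<lambda>n. nrm (s n - u)) \<longlonglongrightarrow> 0"
begin

text \<open>The representing vector minimises \<open>sq g - 2 Re (L g)\<close> over \<open>W\<close>; minimising sequences
  are Cauchy by the parallelogram law.\<close>

lemma riesz_subspace:
  fixes L :: "'v \<Rightarrow> complex"
  assumes W: "subspace W" "W \<subseteq> V"
    and Ladd: "\<And>f g. f \<in> W \<Longrightarrow> g \<in> W \<Longrightarrow> L (f + g) = L f + L g"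
    and Lscale: "\<And>c f. f \<in> W \<Longrightarrow> L (sc c f) = c * L f"
    and Lbound: "\<And>f. f \<in> W \<Longrightarrow> cmod (L f) \<le> M * nrm f"
  shows "\<exists>u\<in>V. \<exists>s. (\<forall>n. s n \<in> W) \<and> (\<lambda>n::nat. nrm (s n - u)) \<longlonglongrightarrow> 0 \<and> (\<forall>g\<in>W. ip g u = L g)"
proof -
  have WV: "g \<in> V" if "g \<in> W" for g using that W by auto
  define J where "J g = sq g - 2 * Re (L g)" for g
  define m where "m = (INF g\<in>W. J g)"
  have Jge: "J g \<ge> - (M\<^sup>2)" if "g \<in> W" for g
  proof -
    have "Re (L g) \<le> M * nrm g" using Lbound[OF that] complex_Re_le_cmod order_trans by blast
    moreover have "0 \<le> (nrm g - M)\<^sup>2" by simp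
    ultimately show ?thesis using nrm_power2[OF WV[OF that]]
      unfolding J_def power2_diff by (simp add: mult.commute)
  qed
  have bdd: "bdd_below (J ` W)" using Jge by (auto intro!: bdd_belowI)
  have W0: "0 \<in> W" using W(1) by (rule subspace_0)
  have mle: "m \<le> J g" if "g \<in> W" for g using that bdd by (auto simp: m_def intro: cINF_lower)
  have "\<exists>g\<in>W. J g < m + 1 / real (Suc n)" for n
  proof -
    have "Inf (J ` W) < m + 1 / real (Suc n)" by (simp add: m_def)
    then obtain y where "y \<in> J ` W" "y < m + 1 / real (Suc n)"
      using cInf_lessD[of "J ` W"] W0 by blast
    then show ?thesis by blast
  qed
  then obtain s where s: "\<And>n. s n \<in> W" "\<And>n. J (s n) < m + 1 / real (Suc n)" by metis
  have sV: "s n \<in> V" for n using s WV by auto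
  have dist: "sq (s i - s j) \<le> 2 * (1 / real (Suc i) + 1 / real (Suc j))" for i j
  proof -
    define p where "p = sc (1/2) (s i + s j)"
    have pW: "p \<in> W" using W(1) s by (auto simp: p_def intro: subspace_add subspace_scale)
    have "Re (L p) = (Re (L (s i)) + Re (L (s j))) / 2"
      using s W(1) by (simp add: p_def Lscale Ladd subspace_add)
    moreover have "sq p = (sq (s i) + 2 * Re (ip (s i) (s j)) + sq (s j)) / 4"
      using sV by (simp add: p_def sq_scale sq_add V_closed norm_divide power2_eq_square)
    ultimately have "sq (s i - s j) = 2 * (J (s i) + J (s j) - 2 * J p)"
      using sV by (simp add: J_def sq_diff field_simps)
    then show ?thesis using s(2)[of i] s(2)[of j] mle[OF pW] by simp
  qed
  have "\<exists>N. \<forall>i\<ge>N. \<forall>j\<ge>N. nrm (s i - s j) < e" if e: "0 < e" for e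
  proof -
    obtain N where N: "4 / e\<^sup>2 < real N" using reals_Archimedean2 by blast
    have "nrm (s i - s j) < e" if "i \<ge> N" "j \<ge> N" for i j
    proof -
      have a: "1 / real (Suc k) < e\<^sup>2 / 4" if "k \<ge> N" for k
      proof -
        have "4 / e\<^sup>2 < real (Suc k)" using N that by linarith
        then show ?thesis using e by (simp add: field_simps)
      qed
      have "q < e\<^sup>2" if "q \<le> 2 * (x + y)" "x < e\<^sup>2 / 4" "y < e\<^sup>2 / 4" for q x y :: real
        using that by simp
      then have "sq (s i - s j) < e\<^sup>2" using dist[of i j] a[OF that(1)] a[OF that(2)] .
      then show ?thesis using e by (simp add: nrm_def real_less_lsqrt)
    qed
    then show ?thesis by blast
  qed
  \<comment> \<open>\<open>W\<close> is not assumed closed, so the limit is only known to lie in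
    \<open>V\<close>; the approximating sequence is therefore part of the conclusion.\<close>
  then obtain u where u: "u \<in> V" "(\<lambda>n. nrm (s n - u)) \<longlonglongrightarrow> 0" using complete sV by blast
  have "ip g u = L g" if g: "g \<in> W" for g
  proof -
    have gV: "g \<in> V" using g WV by auto
    \<comment> \<open>\<open>s n\<close> minimises J up to 1 / (n + 1), so it is compared with its
      perturbation by c g; the slack disappears in the limit.\<close>
    have 1: "0 \<le> 2 * Re (c * (ip g (s n) - L g)) + (cmod c)\<^sup>2 * sq g + 1 / real (Suc n)" for c n
    proof -
      have "m \<le> J (s n + sc c g)" using s g W(1) by (intro mle subspace_add subspace_scale) auto
      also have "\<dots> = J (s n) + 2 * Re (c * (ip g (s n) - L g)) + (cmod c)\<^sup>2 * sq g"
      proof -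
        have "Re (ip (s n) (sc c g)) = Re (c * ip g (s n))"
          using ip_commute[of "s n" g] sV[of n] gV by (simp add: ip_simps)
        moreover have "sc c g \<in> W" "sc c g \<in> V" using gV g W(1) by (auto intro: subspace_scale)
        ultimately show ?thesis
          using s sV[of n] gV g by (simp add: J_def sq_add sq_scale Ladd Lscale right_diff_distrib)
      qed
      finally show ?thesis using s(2)[of n] by linarith
    qed
    have "0 \<le> 2 * Re (c * (ip g u - L g)) + (cmod c)\<^sup>2 * sq g" for c
    proof (rule LIMSEQ_le_const)
      have "(\<lambda>n. 2 * Re (c * (ip g (s n) - L g)) + (cmod c)\<^sup>2 * sq g + 1 / real (Suc n)) \<longlonglongrightarrow>
          2 * Re (c * (ip g u - L g)) + (cmod c)\<^sup>2 * sq g + 0"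
        by (intro tendsto_intros ip_tendsto_right sV u gV LIMSEQ_inverse_real_of_nat[unfolded inverse_eq_divide])
      then show "(\<lambda>n. 2 * Re (c * (ip g (s n) - L g)) + (cmod c)\<^sup>2 * sq g + 1 / real (Suc n)) \<longlonglongrightarrow>
          2 * Re (c * (ip g u - L g)) + (cmod c)\<^sup>2 * sq g" by simp
    qed (use 1 in blast)
    then have "ip g u - L g = 0" using gV by (intro Re_linear_zero[where q="sq g"]) auto
    then show ?thesis by simp
  qed
  with u s show ?thesis by blast
qed

lemma riesz:
  assumes "\<And>f g. f \<in> V \<Longrightarrow> g \<in> V \<Longrightarrow> L (f + g) = L f + L g"
    "\<And>c f. f \<in> V \<Longrightarrow> L (sc c f) = c * L f"
    "\<And>f. f \<in> V \<Longrightarrow> cmod (L f) \<le> M * nrm f"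
  shows "\<exists>u\<in>V. \<forall>g\<in>V. ip g u = L g"
  using riesz_subspace[OF sub order_refl assms] by blast

text \<open>Represent the functional \<open>ip g f\<close> of g in \<open>W\<close> by a limit u of
  elements of \<open>W\<close>. Then u - f is orthogonal to \<open>W\<close>, hence null, and the
  sequence converging to u also converges to f.\<close>

lemma dense_if_orthogonal_null:
  assumes W: "subspace W" "W \<subseteq> V"
    and null: "\<And>v. v \<in> V \<Longrightarrow> (\<And>w. w \<in> W \<Longrightarrow> ip w v = 0) \<Longrightarrow> nrm v = 0"
    and f: "f \<in> V"
  shows "\<exists>s. (\<forall>n. s n \<in> W) \<and> (\<lambda>n::nat. nrm (s n - f)) \<longlonglongrightarrow> 0"
proof -
  have WV: "g \<in> V" if "g \<in> W" for g using that W by auto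
  have "\<exists>u\<in>V. \<exists>s. (\<forall>n. s n \<in> W) \<and> (\<lambda>n::nat. nrm (s n - u)) \<longlonglongrightarrow> 0 \<and> (\<forall>g\<in>W. ip g u = ip g f)"
    using W f WV by (intro riesz_subspace[where M="nrm f"])
      (auto simp: ip_simps mult.commute intro: order_trans[OF cauchy_schwarz])
  then obtain u s where us: "u \<in> V" "\<And>n. s n \<in> W" "(\<lambda>n::nat. nrm (s n - u)) \<longlonglongrightarrow> 0"
    "\<And>g. g \<in> W \<Longrightarrow> ip g u = ip g f" by blast
  have "nrm (u - f) = 0"
    using us f WV by (intro null) (auto simp: ip_simps)
  moreover have "nrm (s n - f) \<le> nrm (s n - u) + nrm (u - f)" for n
    using us f WV by (intro nrm_triangle_sub) auto
  ultimately have "nrm (s n - f) \<le> nrm (s n - u)" for n by simp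
  then have "(\<lambda>n. nrm (s n - f)) \<longlonglongrightarrow> 0"
    using us f WV by (intro tendsto_sandwich[OF _ _ tendsto_const us(3)]) auto
  then show ?thesis using us by blast
qed

end

lemma borel_measurable_cnj [measurable]:
  "f \<in> borel_measurable M \<Longrightarrow> (\<lambda>x. cnj (f x)) \<in> borel_measurable M"
  by (rule measurable_compose[OF _ borel_measurable_continuous_onI[OF continuous_on_cnj[OF continuous_on_id]]])

section \<open>The space \<open>L\<^sup>2\<close>\<close>

definition fscale :: "complex \<Rightarrow> ('a \<Rightarrow> complex) \<Rightarrow> 'a \<Rightarrow> complex" where
  "fscale c f = (\<lambda>x. c * f x)"

lemma vector_space_fscale: "vector_space fscale"
  by unfold_locales (auto simp: fscale_def fun_eq_iff algebra_simps)

lemma L2_measurable: "f \<in> L2 \<Longrightarrow> f \<in> borel_measurable lebesgue"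
  by (simp add: L2_def)

lemma L2_integrable: "f \<in> L2 \<Longrightarrow> integrable lebesgue (\<lambda>x. (cmod (f x))\<^sup>2)"
  by (simp add: L2_def)

lemma norm_add_square_le: "(norm (a + b))\<^sup>2 \<le> 2 * (norm a)\<^sup>2 + 2 * (norm (b::'a::real_normed_vector))\<^sup>2"
proof -
  have "(norm (a + b))\<^sup>2 \<le> (norm a + norm b)\<^sup>2"
    by (intro power_mono norm_triangle_ineq norm_ge_zero)
  also have "\<dots> \<le> 2 * (norm a)\<^sup>2 + 2 * (norm b)\<^sup>2"
    using zero_le_power2[of "norm a - norm b"] by (simp add: power2_eq_square algebra_simps)
  finally show ?thesis .
qed

lemma norm_mult_le_squares: "norm (a * b) \<le> (norm a)\<^sup>2 + (norm (b::'a::real_normed_field))\<^sup>2"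
proof -
  have "2 * (norm a * norm b) \<le> (norm a)\<^sup>2 + (norm b)\<^sup>2"
    using zero_le_power2[of "norm a - norm b"] by (simp add: power2_eq_square algebra_simps)
  moreover have "0 \<le> norm a * norm b" by simp
  ultimately show ?thesis unfolding norm_mult by linarith
qed

lemma L2_add:
  assumes "f \<in> L2" "g \<in> L2"
  shows "f + g \<in> L2"
proof -
  have [measurable]: "f \<in> borel_measurable lebesgue" "g \<in> borel_measurable lebesgue"
    using assms by (auto intro: L2_measurable)
  have "integrable lebesgue (\<lambda>x. (cmod (f x + g x))\<^sup>2)"
  proof (rule Bochner_Integration.integrable_bound)
    show "integrable lebesgue (\<lambda>x. 2 * (cmod (f x))\<^sup>2 + 2 * (cmod (g x))\<^sup>2)"
      using assms by (intro Bochner_Integration.integrable_add integrable_mult_right L2_integrable)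
    show "AE x in lebesgue. norm ((cmod (f x + g x))\<^sup>2) \<le> norm (2 * (cmod (f x))\<^sup>2 + 2 * (cmod (g x))\<^sup>2)"
      using norm_add_square_le[of "f _" "g _"] by (intro AE_I2) simp
  qed measurable
  then show ?thesis by (simp add: L2_def plus_fun_def)
qed

lemma L2_fscale: "f \<in> L2 \<Longrightarrow> fscale c f \<in> L2"
  by (auto simp: L2_def fscale_def norm_mult power_mult_distrib)

lemma L2_zero: "0 \<in> L2"
  by (auto simp: L2_def zero_fun_def)

lemma L2_inner_integrable:
  assumes "f \<in> L2" "g \<in> L2"
  shows "integrable lebesgue (\<lambda>x. f x * cnj (g x))"
proof (rule Bochner_Integration.integrable_bound)
  have [measurable]: "f \<in> borel_measurable lebesgue" "g \<in> borel_measurable lebesgue"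
    using assms by (auto intro: L2_measurable)
  show "integrable lebesgue (\<lambda>x. (cmod (f x))\<^sup>2 + (cmod (g x))\<^sup>2)"
    using assms by (intro Bochner_Integration.integrable_add L2_integrable)
  show "(\<lambda>x. f x * cnj (g x)) \<in> borel_measurable lebesgue" by measurable
  show "AE x in lebesgue. norm (f x * cnj (g x)) \<le> norm ((cmod (f x))\<^sup>2 + (cmod (g x))\<^sup>2)"
    using norm_mult_le_squares[of "f _" "cnj (g _)"] by (intro AE_I2) simp
qed

lemma l2_inner_self: "l2_inner f f = complex_of_real (LINT x|lebesgue. (cmod (f x))\<^sup>2)"
  by (simp add: l2_inner_def complex_norm_square[symmetric] flip: of_real_power)

global_interpretation L2: semi_inner fscale L2 l2_inner
proof (rule semi_inner.intro[OF vector_space_fscale], unfold_locales)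
  interpret vector_space fscale by (rule vector_space_fscale)
  show "module.subspace fscale L2"
    by (auto intro!: subspaceI L2_add L2_fscale L2_zero)
next
  fix f g k :: "'a \<Rightarrow> complex" assume "f \<in> L2" "g \<in> L2" "k \<in> L2"
  then show "l2_inner (f + g) k = l2_inner f k + l2_inner g k"
    by (simp add: l2_inner_def distrib_right Bochner_Integration.integral_add L2_inner_integrable)
next
  fix c and f g k :: "'a \<Rightarrow> complex"
  show "l2_inner (fscale c f) k = c * l2_inner f k"
    by (simp add: l2_inner_def fscale_def mult.assoc)
  show "l2_inner g f = cnj (l2_inner f g)"
    unfolding l2_inner_def by (subst Bochner_Integration.integral_cnj[symmetric]) (simp add: mult.commute)
  show "0 \<le> Re (l2_inner f f)"
    by (simp add: l2_inner_self)
qed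

lemma L2_nrm: "L2.nrm f = l2_norm f"
  by (simp add: L2.nrm_def L2.sq_def l2_norm_def l2_inner_self)

lemma L2_inner_null: "f \<in> L2 \<Longrightarrow> l2_norm f = 0 \<Longrightarrow> g \<in> L2 \<Longrightarrow> l2_inner f g = 0"
  using L2.cauchy_schwarz[of f g] by (simp add: L2_nrm)

lemma l2_norm_eq_0_iff: "f \<in> L2 \<Longrightarrow> l2_norm f = 0 \<longleftrightarrow> (AE x in lebesgue. f x = 0)"
  using integral_nonneg_eq_0_iff_AE[OF L2_integrable, of f] by (simp add: l2_norm_def)

lemma nn_integral_L2: "f \<in> L2 \<Longrightarrow> (\<integral>\<^sup>+x. ennreal ((cmod (f x))\<^sup>2) \<partial>lebesgue) = ennreal ((l2_norm f)\<^sup>2)"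
  by (simp add: nn_integral_eq_integral L2_integrable l2_norm_def)

lemma L2_I_nn_integral:
  assumes "f \<in> borel_measurable lebesgue" "(\<integral>\<^sup>+x. ennreal ((cmod (f x))\<^sup>2) \<partial>lebesgue) < \<infinity>"
  shows "f \<in> L2"
  using assms by (auto simp: L2_def integrable_iff_bounded)

lemma L2_null:
  assumes "f \<in> borel_measurable lebesgue" "AE x in lebesgue. f x = 0"
  shows "f \<in> L2"
proof (rule L2_I_nn_integral[OF assms(1)])
  have "AE x in lebesgue. ennreal ((cmod (f x))\<^sup>2) = 0"
    using assms(2) by eventually_elim simp
  then have "(\<integral>\<^sup>+x. ennreal ((cmod (f x))\<^sup>2) \<partial>lebesgue) = (\<integral>\<^sup>+(x::'a). 0 \<partial>lebesgue)"
    by (rule nn_integral_cong_AE)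
  then show "(\<integral>\<^sup>+x. ennreal ((cmod (f x))\<^sup>2) \<partial>lebesgue) < \<infinity>" by simp
qed

text \<open>A fast Cauchy sequence converges almost everywhere because \<open>\<Sum> 2^k |s (k+1) - s k|\<^sup>2\<close> is integrable.\<close>

lemma L2_fast_cauchy_AE_convergent:
  fixes s :: "nat \<Rightarrow> 'a::euclidean_space \<Rightarrow> complex"
  assumes s: "\<And>k. s k \<in> L2" and fast: "\<And>k. l2_norm (s (Suc k) - s k) \<le> (1/2) ^ k"
  shows "AE x in lebesgue. convergent (\<lambda>k. s k x)"
proof -
  define d where "d k x = s (Suc k) x - s k x" for k x
  have d: "d k = s (Suc k) - s k" "d k \<in> L2" for k
  proof -
    show *: "d k = s (Suc k) - s k" by (simp add: d_def fun_eq_iff)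
    show "d k \<in> L2" unfolding * by (intro L2.V_closed s)
  qed
  have [measurable]: "d k \<in> borel_measurable lebesgue" for k using d by (simp add: L2_measurable del: d(1))
  have "(\<integral>\<^sup>+x. (\<Sum>k. ennreal (2 ^ k * (cmod (d k x))\<^sup>2)) \<partial>lebesgue) =
      (\<Sum>k. \<integral>\<^sup>+x. ennreal (2 ^ k) * ennreal ((cmod (d k x))\<^sup>2) \<partial>lebesgue)"
    by (subst nn_integral_suminf) (auto simp: ennreal_mult')
  also have "\<dots> = (\<Sum>k. ennreal (2 ^ k * (l2_norm (d k))\<^sup>2))"
    by (subst nn_integral_cmult) (auto simp: nn_integral_L2 d(2) ennreal_mult')
  also have "\<dots> \<le> (\<Sum>k. ennreal ((1/2) ^ k))"
  proof (intro suminf_le ennreal_leI)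
    fix k
    have "(l2_norm (d k))\<^sup>2 \<le> ((1/2) ^ k)\<^sup>2"
      using fast[of k] by (intro power_mono) (auto simp: d(1) l2_norm_def)
    then have "2 ^ k * (l2_norm (d k))\<^sup>2 \<le> 2 ^ k * ((1/2) ^ k)\<^sup>2" by simp
    also have "\<dots> = (1/2) ^ k" by (simp add: power2_eq_square power_one_over)
    finally show "2 ^ k * (l2_norm (d k))\<^sup>2 \<le> (1/2) ^ k" .
  qed auto
  also have "\<dots> = ennreal (\<Sum>k. (1/2) ^ k)"
    by (intro suminf_ennreal2) (auto intro: summable_geometric)
  also have "\<dots> < \<infinity>" by simp
  finally have "AE x in lebesgue. (\<Sum>k. ennreal (2 ^ k * (cmod (d k x))\<^sup>2)) \<noteq> \<infinity>"
    by (intro nn_integral_noteq_infinite) auto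
  then show ?thesis
  proof eventually_elim
    case (elim x)
    then have sm: "summable (\<lambda>k. 2 ^ k * (cmod (d k x))\<^sup>2)"
      by (intro summable_suminf_not_top) auto
    have "summable (\<lambda>k. cmod (d k x))"
    proof (rule summable_comparison_test)
      \<comment> \<open>An arithmetic-geometric estimate trades the first power of the increment for
        its weighted square plus a geometric term, so absolute summability follows from that of the
        weighted squares.\<close>
      show "\<exists>N. \<forall>n\<ge>N. norm (cmod (d n x)) \<le> 2 ^ n * (cmod (d n x))\<^sup>2 + (1/2) ^ n"
      proof (intro exI allI impI)
        fix n :: nat
        define a where "a = cmod (d n x)"
        have "0 \<le> (2 ^ n * a - 1)\<^sup>2 + 2 ^ n * a"
          by (simp add: a_def)
        then have "2 ^ n * a \<le> 2 ^ n * (2 ^ n * a\<^sup>2) + 1"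
          by (simp add: power2_eq_square algebra_simps)
        also have "\<dots> = 2 ^ n * (2 ^ n * a\<^sup>2 + (1/2) ^ n)"
          by (simp add: distrib_left power_one_over)
        finally have "a \<le> 2 ^ n * a\<^sup>2 + (1/2) ^ n" by simp
        then show "norm (cmod (d n x)) \<le> 2 ^ n * (cmod (d n x))\<^sup>2 + (1/2) ^ n" by (simp add: a_def)
      qed
      show "summable (\<lambda>n. 2 ^ n * (cmod (d n x))\<^sup>2 + (1/2) ^ n)"
        by (intro summable_add sm summable_geometric) auto
    qed
    then have "summable (\<lambda>k. d k x)" by (rule summable_norm_cancel)
    then have "convergent (\<lambda>n. s 0 x + (\<Sum>k<n. d k x))"
      by (intro convergent_add convergent_const) (simp add: summable_iff_convergent)
    moreover have "s 0 x + (\<Sum>k<n. d k x) = s n x" for n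
      using sum_lessThan_telescope[of "\<lambda>k. s k x" n] by (simp add: d_def)
    ultimately show ?case by simp
  qed
qed

text \<open>Fatou's lemma for the squared differences. Taking g to be a member of the Cauchy
  sequence gives both membership of the limit in \<open>L2\<close> and the rate of
  convergence.\<close>

lemma L2_fatou_diff:
  fixes s :: "nat \<Rightarrow> 'a::euclidean_space \<Rightarrow> complex"
  assumes s: "\<And>k. s k \<in> L2" and g: "g \<in> L2" and u: "u \<in> borel_measurable lebesgue"
    and lim: "AE x in lebesgue. (\<lambda>k. s k x) \<longlonglongrightarrow> u x"
    and bound: "\<And>k. k \<ge> K \<Longrightarrow> l2_norm (s k - g) \<le> e"
  shows "u - g \<in> L2" "l2_norm (u - g) \<le> e"
proof -
  have [measurable]: "s k \<in> borel_measurable lebesgue" "g \<in> borel_measurable lebesgue"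
    "u \<in> borel_measurable lebesgue" for k
    using s g u L2_measurable by auto
  have e: "0 \<le> e" using bound[of K] L2.nrm_nonneg[of "s K - g"] s g by (auto simp: L2_nrm)
  have mm: "(\<lambda>x. u x - g x) \<in> borel_measurable lebesgue" by simp
  have "(\<integral>\<^sup>+x. ennreal ((cmod (u x - g x))\<^sup>2) \<partial>lebesgue)
      = (\<integral>\<^sup>+x. liminf (\<lambda>k. ennreal ((cmod (s k x - g x))\<^sup>2)) \<partial>lebesgue)"
  proof (rule nn_integral_cong_AE, use lim in eventually_elim)
    case (elim x)
    then have "(\<lambda>k. ennreal ((cmod (s k x - g x))\<^sup>2)) \<longlonglongrightarrow> ennreal ((cmod (u x - g x))\<^sup>2)"
      by (intro tendsto_intros)
    then show ?case by (intro lim_imp_Liminf[symmetric]) auto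
  qed
  also have "\<dots> \<le> liminf (\<lambda>k. \<integral>\<^sup>+x. ennreal ((cmod (s k x - g x))\<^sup>2) \<partial>lebesgue)"
    by (intro nn_integral_liminf) auto
  also have "\<dots> \<le> liminf (\<lambda>k. ennreal (e\<^sup>2))"
  proof (intro Liminf_mono eventually_sequentiallyI[of K])
    fix k assume "K \<le> k"
    have "(\<integral>\<^sup>+x. ennreal ((cmod (s k x - g x))\<^sup>2) \<partial>lebesgue) = ennreal ((l2_norm (s k - g))\<^sup>2)"
      using nn_integral_L2[of "s k - g"] s g by auto
    also have "\<dots> \<le> ennreal (e\<^sup>2)"
      using bound[OF \<open>K \<le> k\<close>] by (intro ennreal_leI power_mono) (auto simp: l2_norm_def)
    finally show "(\<integral>\<^sup>+x. ennreal ((cmod (s k x - g x))\<^sup>2) \<partial>lebesgue) \<le> ennreal (e\<^sup>2)" .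
  qed
  also have "\<dots> = ennreal (e\<^sup>2)" by (simp add: Liminf_const)
  finally have le: "(\<integral>\<^sup>+x. ennreal ((cmod ((u - g) x))\<^sup>2) \<partial>lebesgue) \<le> ennreal (e\<^sup>2)" by simp
  show 1: "u - g \<in> L2"
    using le by (intro L2_I_nn_integral) (auto simp: fun_diff_def le_less_trans)
  have "(l2_norm (u - g))\<^sup>2 \<le> e\<^sup>2" using le nn_integral_L2[OF 1] by simp
  then show "l2_norm (u - g) \<le> e" using e by (rule power2_le_imp_le)
qed

text \<open>Riesz-Fischer: a subsequence with geometrically small increments converges almost
  everywhere, and Fatou makes its pointwise limit a limit in norm of the whole sequence.\<close>

global_interpretation L2: semi_hilbert fscale L2 l2_inner
proof (unfold_locales, unfold L2_nrm)
  fix s :: "nat \<Rightarrow> 'a \<Rightarrow> complex"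
  assume s: "\<And>n. s n \<in> L2"
    and cauchy: "\<And>e. 0 < e \<Longrightarrow> \<exists>N. \<forall>m\<ge>N. \<forall>n\<ge>N. l2_norm (s m - s n) < e"
  have "\<exists>N. \<forall>m\<ge>N. \<forall>n\<ge>N. l2_norm (s m - s n) < (1/2) ^ k" for k by (rule cauchy) simp
  then obtain N where N: "\<And>k m n. m \<ge> N k \<Longrightarrow> n \<ge> N k \<Longrightarrow> l2_norm (s m - s n) < (1/2) ^ k" by metis
  \<comment> \<open>Accumulating the N j makes the indices nondecreasing while keeping
    \<open>r k \<ge> N k\<close>.\<close>
  define r where "r k = k + (\<Sum>j\<le>k. N j)" for k
  have r: "r k \<ge> N k" "r k \<ge> k" "r (Suc k) \<ge> r k" for k
    by (auto simp: r_def intro: trans_le_add2 member_le_sum)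
  have rmono: "r i \<le> r j" if "i \<le> j" for i j using r(3) that by (rule lift_Suc_mono_le)
  define t where "t k = s (r k)" for k
  have t: "t k \<in> L2" for k using s by (simp add: t_def)
  have "l2_norm (t (Suc k) - t k) \<le> (1/2) ^ k" for k
    unfolding t_def using r[of k] by (intro less_imp_le[OF N]) (auto intro: order_trans)
  then have conv: "AE x in lebesgue. convergent (\<lambda>k. t k x)"
    using t by (intro L2_fast_cauchy_AE_convergent) auto
  define u where "u x = lim (\<lambda>k. t k x)" for x
  have [measurable]: "t k \<in> borel_measurable lebesgue" for k using t L2_measurable by auto
  have um: "u \<in> borel_measurable lebesgue" unfolding u_def by (rule borel_measurable_lim_metric) simp
  have lim: "AE x in lebesgue. (\<lambda>k. t k x) \<longlonglongrightarrow> u x"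
    using conv by eventually_elim (simp add: u_def convergent_LIMSEQ_iff)
  have ub: "u - s n \<in> L2" "l2_norm (u - s n) \<le> (1/2) ^ k" if "n \<ge> N k" for n k
  proof -
    have "l2_norm (t j - s n) \<le> (1/2) ^ k" if "j \<ge> k" for j
      unfolding t_def using r(1)[of k] rmono[OF that] \<open>n \<ge> N k\<close> by (intro less_imp_le[OF N]) auto
    then show "u - s n \<in> L2" "l2_norm (u - s n) \<le> (1/2) ^ k"
      using L2_fatou_diff[OF t s um lim] by blast+
  qed
  have uL: "u \<in> L2" using L2.V_closed(2)[OF ub(1)[OF order_refl, of 0] s[of "N 0"]] by simp
  show "\<exists>u\<in>L2. (\<lambda>n. l2_norm (s n - u)) \<longlonglongrightarrow> 0"
  proof (intro bexI[OF _ uL] LIMSEQ_I)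
    fix e :: real assume "0 < e"
    then obtain k where k: "(1/2) ^ k < e" using real_arch_pow_inv[of e "1/2"] by auto
    have "norm (l2_norm (s n - u) - 0) < e" if "n \<ge> N k" for n
      using ub(2)[OF that] k L2.nrm_minus_commute[OF s uL, of n] L2.nrm_nonneg[of "s n - u"] s uL
      by (simp add: L2_nrm)
    then show "\<exists>no. \<forall>n\<ge>no. norm (l2_norm (s n - u) - 0) < e" by blast
  qed
qed

section \<open>The operator of a closed form\<close>

text \<open>Completeness for the sum of b and the inner product is closedness of the form. The two
  null conditions make the form compatible with changing a function on a null set.\<close>

locale l2_form = b: semi_inner fscale D b + b1: semi_hilbert fscale D "\<lambda>f g. b f g + l2_inner f g"
  for D :: "('a::euclidean_space \<Rightarrow> complex) set" and b +
  assumes D_L2: "D \<subseteq> L2"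
    and null_D: "\<And>f. f \<in> L2 \<Longrightarrow> l2_norm f = 0 \<Longrightarrow> f \<in> D"
    and null_b: "\<And>f. f \<in> L2 \<Longrightarrow> l2_norm f = 0 \<Longrightarrow> b f f = 0"
    and dense_D: "\<And>f e. f \<in> L2 \<Longrightarrow> 0 < e \<Longrightarrow> \<exists>g\<in>D. l2_norm (f - g) < e"
begin

text \<open>The operator of the first representation theorem for closed forms, with all
  representatives u of the image included.\<close>

definition op_graph :: "'a l2_graph" where
  "op_graph = {(f, u). f \<in> D \<and> u \<in> L2 \<and> (\<forall>g\<in>D. l2_inner u g = b f g)}"

lemma D_L2': "f \<in> D \<Longrightarrow> f \<in> L2" using D_L2 by auto

lemma op_graphD: 
  assumes "(f, u) \<in> op_graph"
  shows "f \<in> D" "f \<in> L2" "u \<in> L2" "\<And>g. g \<in> D \<Longrightarrow> l2_inner u g = b f g"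
  using assms D_L2' by (auto simp: op_graph_def)

lemma op_graphI: "f \<in> D \<Longrightarrow> u \<in> L2 \<Longrightarrow> (\<And>g. g \<in> D \<Longrightarrow> l2_inner u g = b f g) \<Longrightarrow> (f, u) \<in> op_graph"
  by (auto simp: op_graph_def)

lemma op_graph_zero: "(0, 0) \<in> op_graph"
  using b.ip_scale[of 0 _ 0] L2.ip_scale[of 0 _ 0] D_L2' b.scale_zero_left
  by (intro op_graphI) (auto)

lemma op_graph_add: "(f, u) \<in> op_graph \<Longrightarrow> (g, v) \<in> op_graph \<Longrightarrow> (f + g, u + v) \<in> op_graph"
  by (intro op_graphI) (auto simp: L2.ip_simps b.ip_simps D_L2' op_graphD)

lemma op_graph_scale: "(f, u) \<in> op_graph \<Longrightarrow> (fscale c f, fscale c u) \<in> op_graph"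
  by (intro op_graphI) (auto simp: L2.ip_simps b.ip_simps D_L2' op_graphD)

lemma op_graph_diff: "(f, u) \<in> op_graph \<Longrightarrow> (g, v) \<in> op_graph \<Longrightarrow> (f - g, u - v) \<in> op_graph"
  by (intro op_graphI) (auto simp: L2.ip_simps b.ip_simps D_L2' op_graphD)

lemma b_null: "f \<in> D \<Longrightarrow> Re (b f f) = 0 \<Longrightarrow> g \<in> D \<Longrightarrow> b f g = 0"
  using b.cauchy_schwarz[of f g] by (simp add: b.nrm_def b.sq_def)

text \<open>An adjoint graph contains all representatives of its elements, so equality with the
  adjoint requires this invariance. It rests on Cauchy-Schwarz for b, which kills null functions in
  either form.\<close>

lemma op_graph_cong:
  assumes "(f, u) \<in> op_graph" "f' \<in> L2" "u' \<in> L2" "l2_norm (f' - f) = 0" "l2_norm (u' - u) = 0"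
  shows "(f', u') \<in> op_graph"
proof -
  note fu = op_graphD[OF assms(1)]
  have n: "f' - f \<in> L2" "u' - u \<in> L2" using assms fu by auto
  have nD: "f' - f \<in> D" using n assms null_D by auto
  have "f + (f' - f) \<in> D" by (rule b.V_closed(2)[OF fu(1) nD])
  then have f'D: "f' \<in> D" by simp
  show ?thesis
  proof (rule op_graphI[OF f'D assms(3)])
    fix g assume g: "g \<in> D"
    have "b (f' - f) g = 0" using b_null[OF nD _ g] null_b[OF n(1) assms(4)] by simp
    moreover have "l2_inner (u' - u) g = 0" using L2_inner_null[OF n(2) assms(5)] g D_L2' by simp
    ultimately show "l2_inner u' g = b f' g"
      using fu(4)[OF g] assms fu g f'D D_L2' by (simp add: b.ip_simps L2.ip_simps)
  qed
qed

text \<open>If u were not null, some g in D would be closer to u than the norm of u, and the squared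
  norm of u, being the inner product of u with u - g, would be smaller than itself.\<close>

lemma orthogonal_D_null:
  assumes u: "u \<in> L2" and orth: "\<And>g. g \<in> D \<Longrightarrow> l2_inner u g = 0"
  shows "l2_norm u = 0"
proof (rule ccontr)
  assume "l2_norm u \<noteq> 0"
  then have pos: "0 < l2_norm u" using L2.nrm_nonneg[OF u] by (simp add: L2_nrm)
  then obtain g where g: "g \<in> D" "l2_norm (u - g) < l2_norm u" using dense_D[OF u] by blast
  have gL: "g \<in> L2" using g D_L2' by auto
  have "(l2_norm u)\<^sup>2 = Re (l2_inner u u)" using L2.nrm_power2[OF u] by (simp add: L2_nrm L2.sq_def)
  also have "\<dots> = Re (l2_inner u (u - g))" using u gL orth[OF g(1)] by (simp add: L2.ip_simps)
  also have "\<dots> \<le> l2_norm u * l2_norm (u - g)"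
    using order_trans[OF complex_Re_le_cmod L2.cauchy_schwarz[of u "u - g"]] u gL by (simp add: L2_nrm)
  also have "\<dots> < l2_norm u * l2_norm u" using g pos by simp
  finally show False by (simp add: power2_eq_square)
qed

text \<open>The operator plus the identity is onto: this is Riesz representation in the complete
  form norm, applied to the inner product with k. Density of the domain and self-adjointness both
  rest on it.\<close>

lemma op_graph_solve:
  assumes k: "k \<in> L2"
  shows "\<exists>f. (f, k - f) \<in> op_graph"
proof -
  have "\<exists>u\<in>D. \<forall>g\<in>D. b g u + l2_inner g u = l2_inner g k"
  proof (rule b1.riesz[where M="l2_norm k"])
    fix f assume f: "f \<in> D"
    have "cmod (l2_inner f k) \<le> l2_norm f * l2_norm k"
      using L2.cauchy_schwarz[of f k] k f D_L2' by (auto simp: L2_nrm)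
    also have "\<dots> \<le> b1.nrm f * l2_norm k"
    proof (rule mult_right_mono)
      show "l2_norm f \<le> b1.nrm f"
        using f D_L2'[OF f] b.ip_self_nonneg[OF f]
        by (auto simp: L2_nrm[symmetric] L2.nrm_def b1.nrm_def L2.sq_def b1.sq_def)
      show "0 \<le> l2_norm k" using L2.nrm_nonneg[OF k] by (simp add: L2_nrm)
    qed
    finally show "cmod (l2_inner f k) \<le> l2_norm k * b1.nrm f" by (simp add: mult.commute)
  qed (use k D_L2' in \<open>auto simp: L2.ip_simps\<close>)
  then obtain f where f: "f \<in> D" "\<And>g. g \<in> D \<Longrightarrow> b g f + l2_inner g f = l2_inner g k" by blast
  have "l2_inner (k - f) g = b f g" if g: "g \<in> D" for g
  proof -
    have "b f g + l2_inner f g = l2_inner k g"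
      using f(2)[OF g] b.ip_commute[OF f(1) g] L2.ip_commute[of f g] L2.ip_commute[of k g] f g k D_L2'
      by (metis complex_cnj_add complex_cnj_cancel_iff)
    then show ?thesis using k f g D_L2' by (simp add: L2.ip_simps diff_eq_eq)
  qed
  then show ?thesis using f k D_L2' by (auto intro!: op_graphI)
qed

lemma op_graph_symmetric:
  assumes "(f, u) \<in> op_graph" "(g, v) \<in> op_graph"
  shows "l2_inner u g = l2_inner f v"
  using op_graphD[OF assms(1)] op_graphD[OF assms(2)] b.ip_commute L2.ip_commute
  by (metis complex_cnj_cnj)

text \<open>A symmetric operator T with T + 1 onto is self-adjoint. For (u, v) in the adjoint, solve
  (T + 1) f = v + u; then u - f is orthogonal to the range of T + 1, which contains u - f itself, so
  u - f is null.\<close>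

lemma adjoint_op_graph: "adjoint_graph op_graph = op_graph"
proof (intro equalityI subrelI)
  fix u v assume "(u, v) \<in> op_graph"
  then show "(u, v) \<in> adjoint_graph op_graph"
    using op_graph_symmetric by (auto simp: adjoint_graph_def op_graphD)
next
  fix u v assume "(u, v) \<in> adjoint_graph op_graph"
  then have uv: "u \<in> L2" "v \<in> L2" "\<And>f g. (f, g) \<in> op_graph \<Longrightarrow> l2_inner g u = l2_inner f v"
    by (auto simp: adjoint_graph_def)
  define k where "k = v + u"
  have k: "k \<in> L2" using uv by (auto simp: k_def)
  obtain f where f: "(f, k - f) \<in> op_graph" using op_graph_solve[OF k] by blast
  note fD = op_graphD[OF f]
  have w: "u - f \<in> L2" using uv fD by auto
  obtain f' where f': "(f', (u - f) - f') \<in> op_graph" using op_graph_solve[OF w] by blast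
  note f'D = op_graphD[OF f']
  have "l2_inner ((u - f) - f') u = l2_inner f' v" using uv(3)[OF f'] .
  moreover have "l2_inner ((u - f) - f') f = l2_inner f' (k - f)" using op_graph_symmetric[OF f' f] .
  ultimately have "l2_inner ((u - f) - f') (u - f) = l2_inner f' v - l2_inner f' (k - f)"
    using w uv fD(2) f'D(2) by (simp add: L2.ip_diff_right)
  moreover have "l2_inner f' (u - f) = l2_inner f' (k - f) - l2_inner f' v"
    using L2.ip_diff_right[of "k - f" v f'] uv fD(2,3) f'D(2) by (simp add: k_def algebra_simps)
  ultimately have "l2_inner (u - f) (u - f) - l2_inner f' (u - f) = - l2_inner f' (u - f)"
    using L2.ip_diff[OF w f'D(2) w] by simp
  then have "l2_inner (u - f) (u - f) = 0" by simp
  then have null: "l2_norm (u - f) = 0"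
    by (simp add: L2.nrm_def L2.sq_def flip: L2_nrm)
  show "(u, v) \<in> op_graph"
  proof (rule op_graph_cong[OF f uv(1,2) null])
    have eq: "v - (k - f) = f - u" by (simp add: k_def)
    show "l2_norm (v - (k - f)) = 0"
      unfolding eq using null L2.nrm_minus_commute[OF uv(1) fD(2)] by (simp add: L2_nrm)
  qed
qed

lemma subspace_Domain: "b.subspace (Domain op_graph)"
proof (rule b.subspaceI)
  show "0 \<in> Domain op_graph" using op_graph_zero by blast
qed (use op_graph_add op_graph_scale in blast)+

text \<open>Let v be orthogonal to the domain and solve (T + 1) f = v. Testing with f gives b f f +
  (f, f) = 0, so f is null for both forms; hence v is orthogonal to all of D and is null.\<close>

lemma densely_defined_op_graph: "densely_defined op_graph"
  unfolding densely_defined_def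
proof (intro ballI allI impI)
  fix f :: "'a \<Rightarrow> complex" and e :: real assume f: "f \<in> L2" and e: "0 < e"
  have "\<exists>s. (\<forall>n. s n \<in> Domain op_graph) \<and> (\<lambda>n::nat. L2.nrm (s n - f)) \<longlonglongrightarrow> 0"
  proof (rule L2.dense_if_orthogonal_null[OF subspace_Domain _ _ f])
    show "Domain op_graph \<subseteq> L2" using op_graphD by blast
    fix v :: "'a \<Rightarrow> complex" assume v: "v \<in> L2" and orth: "\<And>w. w \<in> Domain op_graph \<Longrightarrow> l2_inner w v = 0"
    obtain f where f: "(f, v - f) \<in> op_graph" using op_graph_solve[OF v] by blast
    note fD = op_graphD[OF f]
    have "l2_inner f v = 0" using orth f by blast
    then have "l2_inner v f = 0" using L2.ip_commute[of f v] v fD by simp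
    then have "b f f = - l2_inner f f"
      using fD(4)[OF fD(1)] v fD(2) by (simp add: L2.ip_simps)
    then have "b f f + l2_inner f f = 0" by simp
    then have s: "Re (b f f) + Re (l2_inner f f) = 0" by (metis plus_complex.simps(1) zero_complex.simps(1))
    have b0: "Re (b f f) = 0" and l0: "Re (l2_inner f f) = 0"
      using s b.ip_self_nonneg[OF fD(1)] L2.ip_self_nonneg[OF fD(2)] by linarith+
    have fn: "l2_norm f = 0" using l0 by (simp add: L2.nrm_def L2.sq_def flip: L2_nrm)
    have "l2_inner v g = 0" if g: "g \<in> D" for g
    proof -
      have "l2_inner (v - f) g = 0" using fD(4)[OF g] b_null[OF fD(1) b0 g] by simp
      then show ?thesis using L2_inner_null[OF fD(2) fn, of g] v g fD D_L2' by (simp add: L2.ip_simps)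
    qed
    then show "L2.nrm v = 0" using orthogonal_D_null[OF v] by (simp add: L2_nrm)
  qed
  then obtain s where s: "\<And>n. s n \<in> Domain op_graph" "(\<lambda>n::nat. L2.nrm (s n - f)) \<longlonglongrightarrow> 0" by blast
  have "\<forall>\<^sub>F n in sequentially. L2.nrm (s n - f) < e" using s(2) e by (rule order_tendstoD)
  then obtain n where n: "L2.nrm (s n - f) < e" by (auto simp: eventually_sequentially)
  have "s n \<in> L2" using s(1)[of n] op_graphD by blast
  then have "l2_norm (f - s n) < e" using n L2.nrm_minus_commute[OF _ f] by (simp add: L2_nrm)
  then show "\<exists>g\<in>Domain op_graph. l2_norm (\<lambda>x. f x - g x) < e" using s(1) by (auto simp: fun_diff_def)
qed

lemma self_adjoint_op_graph: "self_adjoint op_graph"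
  using densely_defined_op_graph adjoint_op_graph op_graphD by (auto simp: self_adjoint_def)

text \<open>Any competitor is contained in \<open>op_graph\<close>, taking adjoints reverses the
  inclusion, and both operators equal their adjoints.\<close>

lemma op_graph_unique:
  "(THE A. self_adjoint A \<and> Domain A \<subseteq> D \<and> (\<forall>(f, Af)\<in>A. \<forall>g\<in>D. l2_inner Af g = b f g)) = op_graph"
proof (rule the_equality)
  show "self_adjoint op_graph \<and> Domain op_graph \<subseteq> D \<and> (\<forall>(f, Af)\<in>op_graph. \<forall>g\<in>D. l2_inner Af g = b f g)"
    using self_adjoint_op_graph op_graphD by blast
next
  fix A :: "'a l2_graph"
  assume A: "self_adjoint A \<and> Domain A \<subseteq> D \<and> (\<forall>(f, Af)\<in>A. \<forall>g\<in>D. l2_inner Af g = b f g)"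
  have sub: "A \<subseteq> op_graph"
  proof (rule subrelI)
    fix f u assume fu: "(f, u) \<in> A"
    then show "(f, u) \<in> op_graph" using A by (intro op_graphI) (auto simp: self_adjoint_def)
  qed
  then have "adjoint_graph op_graph \<subseteq> adjoint_graph A" by (auto simp: adjoint_graph_def)
  then have "op_graph \<subseteq> A" using A adjoint_op_graph by (simp add: self_adjoint_def)
  then show "A = op_graph" using sub by (rule equalityI[rotated])
qed

text \<open>Adjoint graphs are closed by continuity of the inner product, and
  \<open>op_graph\<close> is its own adjoint.\<close>

lemma op_graph_closed:
  assumes fu: "\<And>n::nat. (f n, u n) \<in> op_graph" and "g \<in> L2" "v \<in> L2"
    and lim: "(\<lambda>n. l2_norm (f n - g)) \<longlonglongrightarrow> 0" "(\<lambda>n. l2_norm (u n - v)) \<longlonglongrightarrow> 0"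
  shows "(g, v) \<in> op_graph"
proof -
  have "l2_inner w g = l2_inner k v" if kw: "(k, w) \<in> op_graph" for k w
  proof (rule LIMSEQ_unique)
    show "(\<lambda>n. l2_inner w (f n)) \<longlonglongrightarrow> l2_inner w g"
      using op_graphD(2,3)[OF fu] op_graphD(2,3)[OF kw] assms by (intro L2.ip_tendsto_right) (auto simp: L2_nrm)
    have "(\<lambda>n. l2_inner k (u n)) \<longlonglongrightarrow> l2_inner k v"
      using op_graphD(2,3)[OF fu] op_graphD(2,3)[OF kw] assms by (intro L2.ip_tendsto_right) (auto simp: L2_nrm)
    then show "(\<lambda>n. l2_inner w (f n)) \<longlonglongrightarrow> l2_inner k v"
      using op_graph_symmetric[OF kw fu] by simp
  qed
  then have "(g, v) \<in> adjoint_graph op_graph" using assms by (auto simp: adjoint_graph_def)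
  then show ?thesis by (simp add: adjoint_op_graph)
qed

text \<open>Pair (T - z) f with f: the real part is at least (c - Re z) times the squared norm of f,
  and Cauchy-Schwarz bounds it from above.\<close>

lemma op_graph_bounded_below:
  assumes low: "\<And>f. f \<in> D \<Longrightarrow> c * (l2_norm f)\<^sup>2 \<le> Re (b f f)" and z: "Re z < c"
    and fu: "(f, u) \<in> op_graph"
  shows "l2_norm f \<le> 1 / (c - Re z) * l2_norm (u - fscale z f)"
proof -
  note fD = op_graphD[OF fu]
  have ff: "Re (l2_inner f f) = (l2_norm f)\<^sup>2"
    using L2.nrm_power2[OF fD(2)] by (simp add: L2_nrm L2.sq_def)
  have "(c - Re z) * (l2_norm f)\<^sup>2 \<le> Re (b f f) - Re z * (l2_norm f)\<^sup>2"
    using low[OF fD(1)] by (simp add: algebra_simps)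
  also have "\<dots> = Re (l2_inner (u - fscale z f) f)"
    using fD(4)[OF fD(1)] fD ff L2.ip_self[OF fD(2)] by (simp add: L2.ip_simps)
  also have "\<dots> \<le> l2_norm (u - fscale z f) * l2_norm f"
    using order_trans[OF complex_Re_le_cmod L2.cauchy_schwarz[of "u - fscale z f" f]] fD
    by (simp add: L2_nrm)
  finally have *: "(c - Re z) * (l2_norm f)\<^sup>2 \<le> l2_norm (u - fscale z f) * l2_norm f" .
  show ?thesis
  proof (cases "l2_norm f = 0")
    case True
    then show ?thesis using L2.nrm_nonneg[of "u - fscale z f"] fD z by (simp add: L2_nrm)
  next
    case False
    then have "0 < l2_norm f" using L2.nrm_nonneg[OF fD(2)] by (simp add: L2_nrm)
    then have "(c - Re z) * l2_norm f \<le> l2_norm (u - fscale z f)"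
      using * by (simp add: power2_eq_square flip: mult.assoc)
    then show ?thesis using z by (simp add: field_simps)
  qed
qed

lemma fun_resolvent_eq: "(\<lambda>x. g x - z * f x) = g - fscale z f"
  by (simp add: fun_eq_iff fscale_def)

text \<open>The range of T - z is dense: a vector orthogonal to it is an eigenvector of the adjoint
  T for cnj z, which has the same real part as z, and the lower bound makes it null. The lower bound
  turns convergence of (T - z) f n into convergence of f n, and closedness of T then shows that the
  range is everything.\<close>

lemma below_form_in_resolvent:
  assumes low: "\<And>f. f \<in> D \<Longrightarrow> c * (l2_norm f)\<^sup>2 \<le> Re (b f f)" and z: "Re z < c"
  shows "z \<in> resolvent_set op_graph"
proof -
  let ?W = "{u - fscale z f |f u. (f, u) \<in> op_graph}"
  define M where "M = 1 / (c - Re z)"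
  have M: "M > 0" using z by (simp add: M_def)
  have bb: "l2_norm f \<le> M * l2_norm (u - fscale z f)" if "(f, u) \<in> op_graph" for f u
    unfolding M_def using low z that by (rule op_graph_bounded_below)
  have "\<exists>(f, g)\<in>op_graph. AE x in lebesgue. g x - z * f x = k x" if k: "k \<in> L2" for k
  proof -
    have "\<exists>s. (\<forall>n. s n \<in> ?W) \<and> (\<lambda>n::nat. L2.nrm (s n - k)) \<longlonglongrightarrow> 0"
    proof (rule L2.dense_if_orthogonal_null[OF _ _ _ k])
      show "b.subspace ?W"
      proof (rule b.subspaceI)
        show "0 \<in> ?W" using op_graph_zero by (auto intro!: exI[of _ 0])
        fix x y assume "x \<in> ?W" "y \<in> ?W"
        then obtain f u g v where x: "(f, u) \<in> op_graph" "x = u - fscale z f"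
          and y: "(g, v) \<in> op_graph" "y = v - fscale z g" by blast
        have "x + y = (u + v) - fscale z (f + g)" by (simp add: x y b.scale_right_distrib)
        then show "x + y \<in> ?W" using op_graph_add[OF x(1) y(1)] by blast
        fix d
        have "fscale d x = fscale d u - fscale z (fscale d f)"
          by (simp add: x b.scale_right_diff_distrib mult.commute)
        then show "fscale d x \<in> ?W" using op_graph_scale[OF x(1)] by blast
      qed
      show "?W \<subseteq> L2" using op_graphD by fastforce
      fix v :: "'a \<Rightarrow> complex" assume v: "v \<in> L2" and orth: "\<And>w. w \<in> ?W \<Longrightarrow> l2_inner w v = 0"
      have "l2_inner u v = l2_inner f (fscale (cnj z) v)" if fu: "(f, u) \<in> op_graph" for f u
      proof -
        have "l2_inner (u - fscale z f) v = 0" using orth fu by blast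
        then show ?thesis using v op_graphD[OF fu] by (simp add: L2.ip_simps)
      qed
      then have "(v, fscale (cnj z) v) \<in> adjoint_graph op_graph"
        using v by (auto simp: adjoint_graph_def)
      then have "(v, fscale (cnj z) v) \<in> op_graph" by (simp add: adjoint_op_graph)
      then have "l2_norm v \<le> 1 / (c - Re (cnj z)) * l2_norm (fscale (cnj z) v - fscale (cnj z) v)"
        using low z by (intro op_graph_bounded_below) auto
      then show "L2.nrm v = 0"
        using L2.nrm_zero[where ?'a='a] L2.nrm_nonneg[OF v] by (simp add: L2_nrm)
    qed
    then obtain s where s: "\<And>n. s n \<in> ?W" "(\<lambda>n::nat. L2.nrm (s n - k)) \<longlonglongrightarrow> 0" by blast
    have "\<exists>f u. s n = u - fscale z f \<and> (f, u) \<in> op_graph" for n using s(1)[of n] by blast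
    then obtain f u where fu: "\<And>n. s n = u n - fscale z (f n)" "\<And>n. (f n, u n) \<in> op_graph" by metis
    note fuD = op_graphD[OF fu(2)]
    have sL: "s n \<in> L2" for n using fu fuD by auto
    have fdiff: "l2_norm (f i - f j) \<le> M * l2_norm (s i - s j)" for i j
    proof -
      have "s i - s j = (u i - u j) - fscale z (f i - f j)"
        by (simp add: fu b.scale_right_diff_distrib)
      then show ?thesis using bb[OF op_graph_diff[OF fu(2)[of i] fu(2)[of j]]] by simp
    qed
    have "\<exists>N. \<forall>i\<ge>N. \<forall>j\<ge>N. L2.nrm (f i - f j) < e" if e: "0 < e" for e
    proof -
      have "\<forall>\<^sub>F n in sequentially. L2.nrm (s n - k) < e / (2 * M)" using s(2) e M by (intro order_tendstoD) auto
      then obtain N where N: "\<And>n. n \<ge> N \<Longrightarrow> L2.nrm (s n - k) < e / (2 * M)"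
        by (auto simp: eventually_sequentially)
      have "L2.nrm (f i - f j) < e" if "i \<ge> N" "j \<ge> N" for i j
      proof -
        have "L2.nrm (s i - s j) \<le> L2.nrm (s i - k) + L2.nrm (k - s j)"
          using sL k by (intro L2.nrm_triangle_sub)
        also have "\<dots> < e / (2 * M) + e / (2 * M)"
          using N[OF that(1)] N[OF that(2)] L2.nrm_minus_commute[OF k sL[of j]] by (intro add_strict_mono) auto
        also have "\<dots> = e / M" using M by (simp add: field_simps)
        finally have "M * L2.nrm (s i - s j) < e" using M by (simp add: field_simps)
        then show ?thesis using fdiff[of i j] by (simp add: L2_nrm)
      qed
      then show ?thesis by blast
    qed
    then obtain g where g: "g \<in> L2" "(\<lambda>n. L2.nrm (f n - g)) \<longlonglongrightarrow> 0"
      using L2.complete[of f] fuD by blast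
    have "(g, k + fscale z g) \<in> op_graph"
    proof (rule op_graph_closed[OF fu(2) g(1)])
      show "k + fscale z g \<in> L2" using k g by auto
      show "(\<lambda>n. l2_norm (f n - g)) \<longlonglongrightarrow> 0" using g by (simp add: L2_nrm)
      show "(\<lambda>n. l2_norm (u n - (k + fscale z g))) \<longlonglongrightarrow> 0"
      proof (rule Lim_null_comparison)
        have "l2_norm (u n - (k + fscale z g)) \<le> L2.nrm (s n - k) + cmod z * L2.nrm (f n - g)" for n
        proof -
          have "u n - (k + fscale z g) = (s n - k) + fscale z (f n - g)"
            by (simp add: fu b.scale_right_diff_distrib)
          moreover have "L2.nrm ((s n - k) + fscale z (f n - g)) \<le> L2.nrm (s n - k) + L2.nrm (fscale z (f n - g))"
            using sL k g fuD by (intro L2.nrm_triangle) auto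
          moreover have "L2.nrm (fscale z (f n - g)) = cmod z * L2.nrm (f n - g)"
            using g fuD by (intro L2.nrm_scale) auto
          ultimately show ?thesis by (simp only: L2_nrm)
        qed
        then show "\<forall>\<^sub>F n in sequentially. norm (l2_norm (u n - (k + fscale z g))) \<le> L2.nrm (s n - k) + cmod z * L2.nrm (f n - g)"
          using L2.nrm_nonneg[of "u _ - (k + fscale z g)"] k g fuD by (auto simp: L2_nrm)
        have "(\<lambda>n. L2.nrm (s n - k) + cmod z * L2.nrm (f n - g)) \<longlonglongrightarrow> 0 + cmod z * 0"
          by (intro tendsto_intros s g)
        then show "(\<lambda>n. L2.nrm (s n - k) + cmod z * L2.nrm (f n - g)) \<longlonglongrightarrow> 0" by simp
      qed
    qed
    then show ?thesis by (intro bexI[of _ "(g, k + fscale z g)"]) (auto simp: fscale_def)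
  qed
  moreover have "\<forall>(f, g)\<in>op_graph. l2_norm f \<le> M * l2_norm (\<lambda>x. g x - z * f x)"
    using bb by (auto simp: fun_resolvent_eq)
  ultimately show ?thesis unfolding resolvent_set_def by blast
qed

lemma spectrum_above:
  assumes "\<And>f. f \<in> D \<Longrightarrow> c * (l2_norm f)\<^sup>2 \<le> Re (b f f)" "z \<in> spectrum op_graph"
  shows "c \<le> Re z"
  using below_form_in_resolvent[OF assms(1), of z] assms(2) by (force simp: spectrum_def)

text \<open>The infimum \<open>m\<close> of the Rayleigh quotient lies in the spectrum: a bounded inverse \<open>R\<close>
  of \<open>T - m\<close> would give \<open>\<parallel>g\<parallel>\<^sup>2 = (b - m)(R g, g)\<close>, and Cauchy-Schwarz for the nonnegative
  form \<open>b - m\<close> would push the infimum above \<open>m\<close>.\<close>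

lemma spectrum_below_rayleigh:
  assumes f0: "f0 \<in> D" "l2_norm f0 \<noteq> 0"
  shows "\<exists>z\<in>spectrum op_graph. Re z \<le> Re (b f0 f0) / (l2_norm f0)\<^sup>2"
proof -
  define D0 where "D0 = {f\<in>D. l2_norm f \<noteq> 0}"
  define r where "r f = Re (b f f) / (l2_norm f)\<^sup>2" for f
  define m where "m = (INF f\<in>D0. r f)"
  have bdd: "bdd_below (r ` D0)"
    by (intro bdd_belowI[of _ 0]) (auto simp: r_def D0_def b.ip_self_nonneg)
  have mle: "m \<le> r f" if "f \<in> D0" for f unfolding m_def using bdd that by (rule cINF_lower)
  have sqL: "Re (l2_inner f f) = (l2_norm f)\<^sup>2" for f :: "'a \<Rightarrow> complex"
    by (simp add: l2_inner_self l2_norm_def)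
  have low: "m * (l2_norm f)\<^sup>2 \<le> Re (b f f)" if "f \<in> D" for f
  proof (cases "l2_norm f = 0")
    case True
    then show ?thesis using b.ip_self_nonneg[OF that] by simp
  next
    case False
    then show ?thesis using mle[of f] that by (auto simp: r_def D0_def field_simps)
  qed
  have "complex_of_real m \<notin> resolvent_set op_graph"
  proof
    assume res: "complex_of_real m \<in> resolvent_set op_graph"
    then obtain M0 where M0: "\<And>f g. (f, g) \<in> op_graph \<Longrightarrow> l2_norm f \<le> M0 * l2_norm (g - fscale m f)"
      unfolding resolvent_set_def fun_resolvent_eq by blast
    \<comment> \<open>The maximum with 1 guarantees a positive bound, so that 1 / M is a genuine
      gap.\<close>
    define M where "M = max M0 1"
    define q where "q f g = b f g - m * l2_inner f g" for f g
    interpret q: semi_inner fscale D q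
    proof unfold_locales
      show "b.subspace D" by (rule b.sub)
    qed (use low sqL in \<open>auto simp: q_def b.ip_simps L2.ip_simps D_L2' algebra_simps b.ip_commute[symmetric] L2.ip_commute[symmetric]\<close>)
    have up: "m + 1 / M \<le> r g" if g: "g \<in> D0" for g
    proof -
      have gD: "g \<in> D" "g \<in> L2" and g0: "l2_norm g > 0"
        using g D_L2' L2.nrm_nonneg[of g] by (auto simp: D0_def L2_nrm less_le)
      obtain f u where fu: "(f, u) \<in> op_graph" and ae: "AE x in lebesgue. u x - complex_of_real m * f x = g x"
        using res gD by (auto simp: resolvent_set_def)
      note fD = op_graphD[OF fu]
      define w where "w = u - fscale m f"
      have w: "w \<in> L2" using fD by (auto simp: w_def)
      have ae': "AE x in lebesgue. w x = g x" using ae by (simp add: w_def fscale_def)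
      \<comment> \<open>The resolvent equation holds only almost everywhere, so inner products and
        norms have to be transferred from w to g.\<close>
      have "l2_norm (w - g) = 0"
        using w gD ae' by (subst l2_norm_eq_0_iff) auto
      then have wg: "l2_inner w k = l2_inner g k" if "k \<in> L2" for k
        using L2_inner_null[of "w - g" k] w gD that by (simp add: L2.ip_simps)
      have "l2_norm w = l2_norm g"
      proof -
        have "l2_inner w w = l2_inner g g" 
          using wg[OF w] wg[OF gD(2)] L2.ip_commute[OF w gD(2)] L2.ip_commute[OF gD(2) gD(2)] by simp
        then show ?thesis by (simp add: L2.nrm_def L2.sq_def flip: L2_nrm)
      qed
      then have fM: "l2_norm f \<le> M * l2_norm g"
        using order_trans[OF M0[OF fu] mult_right_mono[of M0 M]] L2.nrm_nonneg[OF gD(2)]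
        by (simp add: w_def M_def L2_nrm)
      have qf: "q f k = l2_inner g k" if k: "k \<in> D" for k
        using fD(4)[OF k] fD k wg[of k] D_L2' by (simp add: q_def w_def L2.ip_simps)
      have "Re (q f f) \<le> M * (l2_norm g)\<^sup>2"
      proof -
        have "Re (q f f) \<le> l2_norm g * l2_norm f"
          using order_trans[OF complex_Re_le_cmod L2.cauchy_schwarz[OF gD(2) fD(2)]]
          by (simp only: qf[OF fD(1)] L2_nrm)
        also have "\<dots> \<le> l2_norm g * (M * l2_norm g)" using fM g0 by simp
        finally show ?thesis by (simp add: power2_eq_square algebra_simps)
      qed
      moreover have "((l2_norm g)\<^sup>2)\<^sup>2 \<le> Re (q f f) * Re (q g g)"
      proof -
        have "cmod (q f g) = (l2_norm g)\<^sup>2"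
          unfolding qf[OF gD(1)] L2.ip_self[OF gD(2)] using sqL[of g] by (simp add: L2.sq_def norm_power) (simp flip: of_real_power add: norm_power)?
        then show ?thesis using q.cauchy_schwarz_sq[OF fD(1) gD(1)] by (simp only: q.sq_def)
      qed
      moreover have "0 \<le> Re (q g g)" using gD(1) by (rule q.ip_self_nonneg)
      ultimately have "((l2_norm g)\<^sup>2)\<^sup>2 \<le> M * (l2_norm g)\<^sup>2 * Re (q g g)"
        by (meson mult_right_mono order_trans)
      then have "(l2_norm g)\<^sup>2 \<le> M * Re (q g g)"
        using g0 by (simp add: power2_eq_square mult.assoc mult.left_commute)
      then have "(l2_norm g)\<^sup>2 / M \<le> Re (b g g) - m * (l2_norm g)\<^sup>2"
        by (simp add: q_def sqL M_def field_simps)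
      then show ?thesis using g0 by (simp add: r_def field_simps)
    qed
    have "m + 1 / M \<le> m"
      unfolding m_def[of] using f0 by (intro cINF_greatest up[unfolded m_def]) (auto simp: D0_def)
    then show False by (simp add: M_def)
  qed
  then show ?thesis
    using mle[of f0] f0 by (intro bexI[of _ "complex_of_real m"]) (auto simp: spectrum_def r_def D0_def)
qed

end

section \<open>Affine substitutions and product integrability for Lebesgue measure\<close>

lemma borel_measurable_cis [measurable]:
  "f \<in> borel_measurable M \<Longrightarrow> (\<lambda>x. cis (f x)) \<in> borel_measurable M"
  by (rule measurable_compose[OF _ borel_measurable_continuous_onI[OF continuous_on_cis[OF continuous_on_id]]])

lemma nn_integral_lborel_affine:
  fixes t :: "'a::euclidean_space"
  assumes [measurable]: "f \<in> borel_measurable borel" and c: "c \<noteq> 0"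
  shows "(\<integral>\<^sup>+x. f x \<partial>lborel) = ennreal (\<bar>c\<bar> ^ DIM('a)) * (\<integral>\<^sup>+x. f (t + c *\<^sub>R x) \<partial>lborel)"
  by (subst lborel_affine[OF c, of t])
     (simp add: nn_integral_density nn_integral_distr nn_integral_cmult)

lemma integrable_lborel_affine:
  fixes f :: "'a::euclidean_space \<Rightarrow> 'b::{banach, second_countable_topology}"
  assumes f: "integrable lborel f" and c: "c \<noteq> 0"
  shows "integrable lborel (\<lambda>x. f (t + c *\<^sub>R x))"
  using f f[THEN borel_measurable_integrable] c unfolding integrable_iff_bounded
  by (subst (asm) nn_integral_lborel_affine[where c=c and t=t])
     (auto simp: ennreal_mult_less_top measurable_lborel1)

lemma integral_lborel_affine:
  fixes f :: "'a::euclidean_space \<Rightarrow> 'b::{banach, second_countable_topology}"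
  assumes [measurable]: "f \<in> borel_measurable borel" and c: "c \<noteq> 0"
  shows "(\<integral>x. f x \<partial>lborel) = (\<bar>c\<bar> ^ DIM('a)) *\<^sub>R (\<integral>x. f (t + c *\<^sub>R x) \<partial>lborel)"
  by (subst lborel_affine[OF c, of t]) (simp add: integral_density integral_distr)

text \<open>A majorant in product form has a factoring integral. This supplies the integrability
  conditions for exchanging integrals by Fubini.\<close>

lemma integrable_lborel_pair_bound:
  fixes F :: "'a::euclidean_space \<times> 'b::euclidean_space \<Rightarrow> 'c::{banach, second_countable_topology}"
  assumes [measurable]: "F \<in> borel_measurable (lborel \<Otimes>\<^sub>M lborel)"
    and a: "integrable lborel a" and b: "integrable lborel b" "\<And>y. 0 \<le> b y"
    and le: "\<And>x y. norm (F (x, y)) \<le> a x * b y"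
  shows "integrable (lborel \<Otimes>\<^sub>M lborel) F"
proof (rule integrableI_bounded)
  have [measurable]: "a \<in> borel_measurable borel" "b \<in> borel_measurable borel"
    using a b by (auto dest: borel_measurable_integrable)
  have "(\<integral>\<^sup>+z. norm (F z) \<partial>(lborel \<Otimes>\<^sub>M lborel)) = (\<integral>\<^sup>+x. \<integral>\<^sup>+y. norm (F (x, y)) \<partial>lborel \<partial>lborel)"
    by (subst lborel.nn_integral_fst[symmetric]) auto
  also have "\<dots> \<le> (\<integral>\<^sup>+x. \<integral>\<^sup>+y. ennreal (norm (a x)) * ennreal (norm (b y)) \<partial>lborel \<partial>lborel)"
  proof (intro nn_integral_mono)
    fix x y
    have "norm (F (x, y)) \<le> norm (a x) * norm (b y)"
      using le[of x y] b(2)[of y] by (intro order_trans[OF le] mult_mono) auto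
    then show "ennreal (norm (F (x, y))) \<le> ennreal (norm (a x)) * ennreal (norm (b y))"
      by (simp add: ennreal_leI flip: ennreal_mult)
  qed
  also have "\<dots> = (\<integral>\<^sup>+x. ennreal (norm (a x)) \<partial>lborel) * (\<integral>\<^sup>+y. ennreal (norm (b y)) \<partial>lborel)"
    by (simp add: nn_integral_cmult nn_integral_multc)
  also have "\<dots> < \<infinity>"
    using a b by (auto simp: integrable_iff_bounded ennreal_mult_less_top)
  finally show "(\<integral>\<^sup>+z. norm (F z) \<partial>(lborel \<Otimes>\<^sub>M lborel)) < \<infinity>" .
qed simp

lemma Re_integral: "Re (integral\<^sup>L M f) = (LINT x|M. Re (f x))" if "integrable M f"
  using integral_Re[OF that] by simp

section \<open>The Gaussian and its Fourier transform\<close>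

text \<open>The standard normal density, written as a product over coordinates so that its Fourier
  integral splits into one-dimensional characteristic functions.\<close>

definition gauss :: "'a::euclidean_space \<Rightarrow> real" where
  "gauss v = (\<Prod>b\<in>Basis. std_normal_density (v \<bullet> b))"

lemma gauss_measurable [measurable]: "gauss \<in> borel_measurable borel"
  unfolding gauss_def[abs_def] by measurable

lemma gauss_eq: "gauss (v::'a::euclidean_space) = (2 * pi) powr (- real DIM('a) / 2) * exp (- (norm v)\<^sup>2 / 2)"
proof -
  have "gauss v = (\<Prod>b\<in>(Basis::'a set). 1 / sqrt (2 * pi)) * (\<Prod>b\<in>Basis. exp (- (v \<bullet> b)\<^sup>2 / 2))"
    unfolding gauss_def prod.distrib[symmetric] by (simp add: normal_density_def)
  also have "(\<Prod>b\<in>Basis. exp (- (v \<bullet> b)\<^sup>2 / 2)) = exp (- (norm v)\<^sup>2 / 2)"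
    by (simp add: exp_sum[symmetric] sum_negf sum_divide_distrib[symmetric] norm_eq_sqrt_inner
        euclidean_inner[of v v] power2_eq_square sum_nonneg)
  also have "(\<Prod>b\<in>(Basis::'a set). 1 / sqrt (2 * pi)) = (2 * pi) powr (- real DIM('a) / 2)"
  proof -
    have "1 / sqrt (2 * pi) = (2 * pi) powr (- 1 / 2)"
      by (simp add: powr_minus_divide powr_half_sqrt)
    then show ?thesis by (simp add: powr_power)
  qed
  finally show ?thesis .
qed

lemma gauss_pos: "0 < gauss v" by (simp add: gauss_eq)

lemma gauss_fourier:
  fixes u :: "'a::euclidean_space"
  shows "integrable lborel (\<lambda>v. gauss v * cis (u \<bullet> v))"
    and "(CLINT v|lborel. gauss v * cis (u \<bullet> v)) = exp (- (norm u)\<^sup>2 / 2)"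
proof -
  interpret product_sigma_finite "\<lambda>_. lborel :: real measure" by standard
  define f where "f b x = complex_of_real (std_normal_density x) * cis ((u \<bullet> b) * x)" for b x
  have [measurable]: "f b \<in> borel_measurable borel" for b unfolding f_def[abs_def] by measurable
  have fi: "integrable lborel (f b)" for b
  proof (rule Bochner_Integration.integrable_bound[of lborel std_normal_density])
    show "integrable lborel std_normal_density" using integrable_normal_moment[of 1 0 0] by simp
  qed (auto simp: f_def norm_mult)
  have fint: "integral\<^sup>L lborel (f b) = exp (- (u \<bullet> b)\<^sup>2 / 2)" for b
  proof -
    have "integral\<^sup>L lborel (f b) = char std_normal_distribution (u \<bullet> b)"
      unfolding char_def f_def
      by (subst integral_density) (auto simp: cis_conv_exp scaleR_conv_of_real)
    then show ?thesis by (simp add: char_std_normal_distribution)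
  qed
  have prod_eq: "complex_of_real (gauss v) * cis (u \<bullet> v) = (\<Prod>b\<in>Basis. f b (v \<bullet> b))" for v
  proof -
    have "cis (\<Sum>b\<in>A. g b) = (\<Prod>b\<in>A. cis (g b))" if "finite A" for A and g :: "'a \<Rightarrow> real"
      using that by induction (auto simp flip: cis_mult)
    then have "cis (u \<bullet> v) = (\<Prod>b\<in>Basis. cis ((u \<bullet> b) * (v \<bullet> b)))"
      by (subst euclidean_inner) simp
    then show ?thesis by (simp add: gauss_def f_def prod.distrib)
  qed
  have bas: "((\<Sum>b\<in>Basis. g b *\<^sub>R b) \<bullet> c) = g c" if "c \<in> Basis" for g and c :: 'a
    using that by (simp add: inner_sum_left inner_Basis if_distrib sum.delta cong: if_cong)
  have [measurable]: "(\<lambda>f. \<Sum>b\<in>Basis. f b *\<^sub>R b) \<in> (\<Pi>\<^sub>M b\<in>(Basis::'a set). lborel) \<rightarrow>\<^sub>M borel" by simp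
  have cong: "(\<Prod>b\<in>Basis. f b ((\<Sum>c\<in>Basis. g c *\<^sub>R c) \<bullet> b)) = (\<Prod>b\<in>Basis. f b (g b))" for g
    by (intro prod.cong refl) (simp add: bas)
  show "integrable lborel (\<lambda>v. gauss v * cis (u \<bullet> v))"
    unfolding prod_eq
    by (subst lborel_eq, subst integrable_distr_eq) (auto simp: cong intro!: product_integrable_prod fi)
  have "(CLINT v|lborel. gauss v * cis (u \<bullet> v)) = (\<Prod>b\<in>Basis. integral\<^sup>L lborel (f b))"
    unfolding prod_eq
    by (subst lborel_eq, subst integral_distr) (auto simp: cong intro!: product_integral_prod fi)
  also have "\<dots> = exp (- (norm u)\<^sup>2 / 2)"
    by (simp add: fint exp_sum[symmetric] sum_negf sum_divide_distrib[symmetric] norm_eq_sqrt_inner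
        euclidean_inner[of u u] power2_eq_square sum_nonneg flip: of_real_prod)
  finally show "(CLINT v|lborel. gauss v * cis (u \<bullet> v)) = exp (- (norm u)\<^sup>2 / 2)" .
qed

lemma integrable_gauss: "integrable lborel (gauss :: 'a::euclidean_space \<Rightarrow> real)"
  using integrable_norm[OF gauss_fourier(1)[of "0::'a"]] by (simp add: norm_mult gauss_pos[THEN abs_of_pos])

lemma integral_gauss: "(LINT v|lborel. gauss (v::'a::euclidean_space)) = 1"
  using gauss_fourier(2)[of "0::'a"] by simp

section \<open>Translations in \<open>L\<^sup>2\<close>\<close>

text \<open>Measurability gives continuous functions converging to g almost everywhere, but without
  a majorant. Truncating values and support provides one: first a level j is chosen for g itself,
  then, with j fixed, the truncated approximants are compared with the truncated g.\<close>

lemma continuous_approx_L2: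
  fixes g :: "'a::euclidean_space \<Rightarrow> complex"
  assumes [measurable]: "g \<in> borel_measurable borel" and g2: "integrable lborel (\<lambda>x. (cmod (g x))\<^sup>2)"
    and e: "0 < e"
  shows "\<exists>k R. continuous_on UNIV k \<and> (\<forall>x. R < norm x \<longrightarrow> k x = 0) \<and>
    integrable lborel (\<lambda>x. (cmod (k x - g x))\<^sup>2) \<and> (LINT x|lborel. (cmod (k x - g x))\<^sup>2) < e"
proof -
  have "g measurable_on UNIV"
    by (rule lebesgue_measurable_imp_measurable_on) (simp_all add: measurable_completion)
  then obtain N h where N: "negligible N" and h: "\<And>n. continuous_on UNIV (h n)"
    and lim: "\<And>x. x \<notin> N \<Longrightarrow> (\<lambda>n. h n x) \<longlonglongrightarrow> g x"
    by (auto simp: measurable_on_def)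
  \<comment> \<open>\<open>cl j\<close> is the radial retraction onto the disc of radius j + 1;
    \<open>ct j\<close> is 1 on the ball of radius j + 1 and vanishes beyond radius j + 2. Both are
    continuous.\<close>
  define cl where "cl j z = (real (Suc j) / max (real (Suc j)) (cmod z)) *\<^sub>R z" for j z
  define ct where "ct j x = max 0 (min 1 (real (Suc j) + 1 - norm x))" for j and x :: 'a
  have cl_le: "cmod (cl j z) \<le> cmod z" "cmod (cl j z) \<le> real (Suc j)" for j z
  proof -
    have "cmod (cl j z) = (if cmod z \<le> real (Suc j) then cmod z else real (Suc j))"
      by (auto simp: cl_def max_def norm_mult)
    then show "cmod (cl j z) \<le> cmod z" "cmod (cl j z) \<le> real (Suc j)" by auto
  qed
  have cl_id: "cl j z = z" if "cmod z \<le> real (Suc j)" for j z using that by (simp add: cl_def max_absorb1)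
  have ct: "0 \<le> ct j x" "ct j x \<le> 1" "norm x \<le> real (Suc j) \<Longrightarrow> ct j x = 1"
    "real (Suc j) + 1 < norm x \<Longrightarrow> ct j x = 0" for j x
    by (auto simp: ct_def)
  have cl_cont: "continuous_on UNIV (cl j)" for j
    unfolding cl_def by (intro continuous_intros) (auto simp: max_def)
  have ct_cont: "continuous_on UNIV (ct j)" for j unfolding ct_def by (intro continuous_intros)
  have [measurable]: "cl j \<in> borel_measurable borel" "ct j \<in> borel_measurable borel"
    "h n \<in> borel_measurable borel" for j n
    using cl_cont ct_cont h borel_measurable_continuous_onI by blast+
  define G where "G j x = ct j x *\<^sub>R cl j (g x)" for j x
  have [measurable]: "G j \<in> borel_measurable borel" for j unfolding G_def by measurable
  have G_le: "cmod (G j x) \<le> cmod (g x)" "cmod (G j x) \<le> real (Suc j)" for j x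
    using mult_mono[OF ct(2)[of j x] cl_le(1)[of j "g x"]] mult_mono[OF ct(2)[of j x] cl_le(2)[of j "g x"]]
    by (auto simp: G_def abs_of_nonneg ct(1))
  have diff_le: "(cmod (G j x - g x))\<^sup>2 \<le> 4 * (cmod (g x))\<^sup>2" for j x
  proof -
    have "(cmod (G j x + - g x))\<^sup>2 \<le> 2 * (cmod (G j x))\<^sup>2 + 2 * (cmod (- g x))\<^sup>2" by (rule norm_add_square_le)
    moreover have "(cmod (G j x))\<^sup>2 \<le> (cmod (g x))\<^sup>2" using G_le by (intro power_mono) auto
    ultimately show ?thesis by (simp only: norm_minus_cancel add_uminus_conv_diff)
  qed
  have "(\<lambda>j. LINT x|lborel. (cmod (G j x - g x))\<^sup>2) \<longlonglongrightarrow> (LINT (x::'a)|lborel. 0)"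
  proof (rule integral_dominated_convergence[where w="\<lambda>x. 4 * (cmod (g x))\<^sup>2"])
    show "integrable lborel (\<lambda>x. 4 * (cmod (g x))\<^sup>2)" using g2 by simp
    show "AE x in lborel. (\<lambda>j. (cmod (G j x - g x))\<^sup>2) \<longlonglongrightarrow> 0"
    proof (rule AE_I2)
      fix x
      obtain n where n: "norm x \<le> real n" "cmod (g x) \<le> real n"
        using real_arch_simple[of "max (norm x) (cmod (g x))"] by auto
      have "G j x = g x" if "j \<ge> n" for j
        using n that ct(3)[of x j] cl_id[of "g x" j] by (simp add: G_def)
      then have "\<forall>\<^sub>F j in sequentially. (cmod (G j x - g x))\<^sup>2 = 0"
        by (intro eventually_sequentiallyI[of n]) simp
      then show "(\<lambda>j. (cmod (G j x - g x))\<^sup>2) \<longlonglongrightarrow> 0" by (rule tendsto_eventually)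
    qed
  qed (use diff_le in auto)
  \<comment> \<open>The squared triangle inequality doubles each of the two errors, so e / 4 for
    each suffices.\<close>
  then have "\<forall>\<^sub>F j in sequentially. (LINT x|lborel. (cmod (G j x - g x))\<^sup>2) < e / 4"
    using e by (intro order_tendstoD(2)) auto
  then obtain j where j: "(LINT x|lborel. (cmod (G j x - g x))\<^sup>2) < e / 4"
    by (auto simp: eventually_sequentially)
  have Gi: "integrable lborel (\<lambda>x. (cmod (G j x - g x))\<^sup>2)"
  proof (rule Bochner_Integration.integrable_bound)
    show "integrable lborel (\<lambda>x. 4 * (cmod (g x))\<^sup>2)" using g2 by simp
    show "AE x in lborel. norm ((cmod (G j x - g x))\<^sup>2) \<le> norm (4 * (cmod (g x))\<^sup>2)"
      using diff_le by (intro AE_I2) simp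
  qed measurable
  define k where "k n x = ct j x *\<^sub>R cl j (h n x)" for n x
  have [measurable]: "k n \<in> borel_measurable borel" for n unfolding k_def by measurable
  \<comment> \<open>Both truncated functions are bounded by j + 1 and vanish outside the ball of
    radius j + 2, whatever n is.\<close>
  define w where "w x = 4 * (real (Suc j))\<^sup>2 * indicator (cball (0::'a) (real (Suc j) + 1)) x" for x
  have wi: "integrable lborel w"
    unfolding w_def by (intro integrable_mult_right integrable_real_indicator emeasure_bounded_finite) auto
  have kG: "(cmod (k n x - G j x))\<^sup>2 \<le> w x" for n x
  proof (cases "real (Suc j) + 1 < norm x")
    case True
    then show ?thesis by (simp add: k_def G_def ct(4) w_def)
  next
    case False
    have "cmod (k n x) \<le> 1 * real (Suc j)"
      unfolding k_def using mult_mono[OF ct(2)[of j x] cl_le(2)[of j "h n x"]] by (simp add: abs_of_nonneg ct(1))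
    then have "cmod (k n x - G j x) \<le> 2 * real (Suc j)"
      using G_le(2)[of j x] norm_triangle_ineq4[of "k n x" "G j x"] by argo
    then have "(cmod (k n x - G j x))\<^sup>2 \<le> (2 * real (Suc j))\<^sup>2" by (intro power_mono) auto
    moreover have "w x = (2 * real (Suc j))\<^sup>2"
      using False by (simp add: w_def power_mult_distrib del: of_nat_Suc)
    ultimately show ?thesis by simp
  qed
  have "(\<lambda>n. LINT x|lborel. (cmod (k n x - G j x))\<^sup>2) \<longlonglongrightarrow> (LINT (x::'a)|lborel. 0)"
  proof (rule integral_dominated_convergence[where w=w])
    have "N \<in> null_sets lebesgue" using N by (simp add: negligible_iff_null_sets)
    then have "AE x in lebesgue. x \<notin> N" by (rule AE_not_in)
    then have "AE x in lebesgue. (\<lambda>n. (cmod (k n x - G j x))\<^sup>2) \<longlonglongrightarrow> 0"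
    proof eventually_elim
      case (elim x)
      have "(\<lambda>n. cl j (h n x)) \<longlonglongrightarrow> cl j (g x)"
        by (rule continuous_on_tendsto_compose[OF cl_cont lim[OF elim]]) auto
      then have "(\<lambda>n. (cmod (k n x - G j x))\<^sup>2) \<longlonglongrightarrow> (cmod (G j x - G j x))\<^sup>2"
        unfolding k_def G_def by (intro tendsto_intros)
      then show ?case by simp
    qed
    then show "AE x in lborel. (\<lambda>n. (cmod (k n x - G j x))\<^sup>2) \<longlonglongrightarrow> 0"
      by (simp add: AE_completion_iff)
  qed (use kG wi in auto)
  then have "\<forall>\<^sub>F n in sequentially. (LINT x|lborel. (cmod (k n x - G j x))\<^sup>2) < e / 4"
    using e by (intro order_tendstoD(2)) auto
  then obtain n where n: "(LINT x|lborel. (cmod (k n x - G j x))\<^sup>2) < e / 4"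
    by (auto simp: eventually_sequentially)
  have ki: "integrable lborel (\<lambda>x. (cmod (k n x - G j x))\<^sup>2)"
  proof (rule Bochner_Integration.integrable_bound[OF wi])
    show "AE x in lborel. norm ((cmod (k n x - G j x))\<^sup>2) \<le> norm (w x)"
      using order_trans[OF kG abs_ge_self] by (intro AE_I2) simp
  qed measurable
  have le: "(cmod (k n x - g x))\<^sup>2 \<le> 2 * (cmod (k n x - G j x))\<^sup>2 + 2 * (cmod (G j x - g x))\<^sup>2" for x
    using norm_add_square_le[of "k n x - G j x" "G j x - g x"] by simp
  have int: "integrable lborel (\<lambda>x. 2 * (cmod (k n x - G j x))\<^sup>2 + 2 * (cmod (G j x - g x))\<^sup>2)"
    using ki Gi by simp
  have kgi: "integrable lborel (\<lambda>x. (cmod (k n x - g x))\<^sup>2)"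
  proof (rule Bochner_Integration.integrable_bound[OF int])
    show "AE x in lborel. norm ((cmod (k n x - g x))\<^sup>2) \<le>
        norm (2 * (cmod (k n x - G j x))\<^sup>2 + 2 * (cmod (G j x - g x))\<^sup>2)"
      using le by (intro AE_I2) simp
  qed measurable
  have "(LINT x|lborel. (cmod (k n x - g x))\<^sup>2) \<le> 
      (LINT x|lborel. 2 * (cmod (k n x - G j x))\<^sup>2 + 2 * (cmod (G j x - g x))\<^sup>2)"
    by (intro integral_mono le kgi int)
  also have "\<dots> = 2 * (LINT x|lborel. (cmod (k n x - G j x))\<^sup>2) + 2 * (LINT x|lborel. (cmod (G j x - g x))\<^sup>2)"
    using ki Gi by simp
  also have "\<dots> < e" using n j by simp
  finally have "(LINT x|lborel. (cmod (k n x - g x))\<^sup>2) < e" .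
  moreover have "continuous_on UNIV (k n)"
    unfolding k_def by (intro continuous_intros ct_cont continuous_on_compose2[OF cl_cont h]) auto
  moreover have "\<forall>x. real (Suc j) + 1 < norm x \<longrightarrow> k n x = 0" by (simp add: k_def ct(4))
  ultimately show ?thesis using kgi by blast
qed

text \<open>Density reduces the claim to a continuous k of compact support. There dominated
  convergence applies, because translations of length below 1 keep all the supports in one
  ball.\<close>

lemma L2_translation_continuous:
  fixes g :: "'a::euclidean_space \<Rightarrow> complex"
  assumes [measurable]: "g \<in> borel_measurable borel" and g2: "integrable lborel (\<lambda>x. (cmod (g x))\<^sup>2)"
    and w: "w \<longlonglongrightarrow> (0::'a)"
  shows "(\<lambda>n. LINT x|lborel. (cmod (g (x + w n) - g x))\<^sup>2) \<longlonglongrightarrow> 0"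
proof (rule LIMSEQ_I)
  fix e :: real assume e: "0 < e"
  \<comment> \<open>The error of k enters with factor 8 in total (4 translated and 4 untranslated)
    and the translation difference of k with factor 2, giving 8 e / 16 + 2 e / 8 < e.\<close>
  obtain k R where k: "continuous_on UNIV k" "\<And>x. R < norm x \<Longrightarrow> k x = 0"
    and kg: "integrable lborel (\<lambda>x. (cmod (k x - g x))\<^sup>2)" "(LINT x|lborel. (cmod (k x - g x))\<^sup>2) < e / 16"
    using continuous_approx_L2[OF assms(1) g2, of "e / 16"] e by auto
  have [measurable]: "k \<in> borel_measurable borel" using k(1) by (rule borel_measurable_continuous_onI)
  obtain M where M: "\<And>x. cmod (k x) \<le> M"
  proof -
    have "compact (k ` cball 0 R)"
      using k(1) by (intro compact_continuous_image continuous_on_subset[OF k(1)]) auto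
    then obtain M where M: "\<And>x. x \<in> cball 0 R \<Longrightarrow> cmod (k x) \<le> M"
      by (metis bounded_iff compact_imp_bounded imageI)
    have "cmod (k x) \<le> max M 0" for x
      using M[of x] k(2)[of x] by (cases "R < norm x") auto
    then show ?thesis using that by blast
  qed
  obtain n0 where n0: "\<And>n. n \<ge> n0 \<Longrightarrow> norm (w n) < 1"
    using w[THEN LIMSEQ_D, of 1] by auto
  define W where "W x = 4 * M\<^sup>2 * indicator (cball (0::'a) (\<bar>R\<bar> + 1)) x" for x
  have Wi: "integrable lborel W"
    unfolding W_def by (intro integrable_mult_right integrable_real_indicator emeasure_bounded_finite) auto
  have kW: "(cmod (k (x + w n) - k x))\<^sup>2 \<le> W x" if "n \<ge> n0" for n x
  proof (cases "\<bar>R\<bar> + 1 < norm x")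
    case True
    have "R < norm x" "R < norm (x + w n)"
      using True n0[OF that] norm_diff_ineq[of x "w n"] by linarith+
    then show ?thesis by (simp add: k(2) W_def)
  next
    case False
    have "cmod (k (x + w n) - k x) \<le> 2 * M"
      using M[of "x + w n"] M[of x] norm_triangle_ineq4[of "k (x + w n)" "k x"] by argo
    then have "(cmod (k (x + w n) - k x))\<^sup>2 \<le> (2 * M)\<^sup>2" by (intro power_mono) auto
    then show ?thesis using False by (simp add: W_def power_mult_distrib)
  qed
  have ktr: "(\<lambda>n. LINT x|lborel. (cmod (k (x + w (n + n0)) - k x))\<^sup>2) \<longlonglongrightarrow> (LINT (x::'a)|lborel. 0)"
  proof (rule integral_dominated_convergence[where w=W])
    show "AE x in lborel. (\<lambda>n. (cmod (k (x + w (n + n0)) - k x))\<^sup>2) \<longlonglongrightarrow> 0"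
    proof (rule AE_I2)
      fix x
      have w': "(\<lambda>n. w (n + n0)) \<longlonglongrightarrow> 0" using w by (rule LIMSEQ_ignore_initial_segment)
      have "(\<lambda>n. x + w (n + n0)) \<longlonglongrightarrow> x" using tendsto_add[OF tendsto_const w', of x] by simp
      then have "(\<lambda>n. k (x + w (n + n0))) \<longlonglongrightarrow> k x"
        by (intro continuous_on_tendsto_compose[OF k(1)]) auto
      then have "(\<lambda>n. (cmod (k (x + w (n + n0)) - k x))\<^sup>2) \<longlonglongrightarrow> (cmod (k x - k x))\<^sup>2"
        by (intro tendsto_intros)
      then show "(\<lambda>n. (cmod (k (x + w (n + n0)) - k x))\<^sup>2) \<longlonglongrightarrow> 0" by simp
    qed
  qed (use kW Wi in auto)
  then have "\<forall>\<^sub>F n in sequentially. (LINT x|lborel. (cmod (k (x + w (n + n0)) - k x))\<^sup>2) < e / 8"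
    using e by (intro order_tendstoD(2)) auto
  then obtain n1 where n1: "\<And>n. n \<ge> n1 \<Longrightarrow> (LINT x|lborel. (cmod (k (x + w (n + n0)) - k x))\<^sup>2) < e / 8"
    by (auto simp: eventually_sequentially)
  have "norm ((LINT x|lborel. (cmod (g (x + w n) - g x))\<^sup>2) - 0) < e" if n: "n \<ge> n0 + n1" for n
  proof -
    define A where "A x = (cmod (k x - g x))\<^sup>2" for x
    define B where "B x = (cmod (k (x + w n) - k x))\<^sup>2" for x
    have [measurable]: "A \<in> borel_measurable borel" "B \<in> borel_measurable borel"
      unfolding A_def B_def by measurable
    have Ai: "integrable lborel A" using kg(1) by (simp add: A_def[abs_def])
    have Ati: "integrable lborel (\<lambda>x. A (x + w n))"
      using integrable_lborel_affine[OF Ai, of 1 "w n"] by (simp add: add.commute)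
    have At: "(LINT x|lborel. A (x + w n)) = (LINT x|lborel. A x)"
      using integral_lborel_affine[of A 1 "w n"] by (simp add: add.commute)
    have Bi: "integrable lborel B"
      using order_trans[OF kW[of n] abs_ge_self] n
      by (intro Bochner_Integration.integrable_bound[OF Wi]) (auto simp: B_def)
    have le: "(cmod (g (x + w n) - g x))\<^sup>2 \<le> 4 * A (x + w n) + 2 * B x + 4 * A x" for x
    proof -
      have "(cmod ((k (x + w n) - k x) + ((g (x + w n) - k (x + w n)) + (k x - g x))))\<^sup>2 \<le>
        2 * (cmod (k (x + w n) - k x))\<^sup>2 + 2 * (cmod ((g (x + w n) - k (x + w n)) + (k x - g x)))\<^sup>2"
        by (rule norm_add_square_le)
      also have "(cmod ((g (x + w n) - k (x + w n)) + (k x - g x)))\<^sup>2 \<le>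
        2 * (cmod (g (x + w n) - k (x + w n)))\<^sup>2 + 2 * (cmod (k x - g x))\<^sup>2"
        by (rule norm_add_square_le)
      finally show ?thesis by (simp add: A_def B_def norm_minus_commute algebra_simps)
    qed
    have int: "integrable lborel (\<lambda>x. 4 * A (x + w n) + 2 * B x + 4 * A x)"
      using Ai Ati Bi by simp
    have gi: "integrable lborel (\<lambda>x. (cmod (g (x + w n) - g x))\<^sup>2)"
      using le by (intro Bochner_Integration.integrable_bound[OF int]) (auto intro: order_trans[OF _ abs_ge_self])
    have "(LINT x|lborel. (cmod (g (x + w n) - g x))\<^sup>2) \<le> (LINT x|lborel. 4 * A (x + w n) + 2 * B x + 4 * A x)"
      by (intro integral_mono gi int le)
    also have "\<dots> = 8 * (LINT x|lborel. A x) + 2 * (LINT x|lborel. B x)"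
      using Ai Ati Bi At by simp
    also have "\<dots> < 8 * (e / 16) + 2 * (e / 8)"
    proof (intro add_strict_mono mult_strict_left_mono)
      show "(LINT x|lborel. A x) < e / 16" using kg(2) by (simp add: A_def)
      show "(LINT x|lborel. B x) < e / 8" using n1[of "n - n0"] n by (simp add: B_def)
    qed auto
    also have "\<dots> < e" using e by simp
    finally show ?thesis by simp
  qed
  then show "\<exists>no. \<forall>n\<ge>no. norm ((LINT x|lborel. (cmod (g (x + w n) - g x))\<^sup>2) - 0) < e" by blast
qed

section \<open>Plancherel's theorem\<close>

text \<open>The unnormalised convention; this is why Plancherel's identity carries a power of 2
  \<pi>.\<close>

definition fourier :: "('a::euclidean_space \<Rightarrow> complex) \<Rightarrow> 'a \<Rightarrow> complex" where
  "fourier g \<omega> = (CLINT s|lborel. g s * cis (- (\<omega> \<bullet> s)))"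

lemma gauss_nonneg [simp]: "0 \<le> gauss v"
  using gauss_pos[of v] by simp

lemma fourier_measurable [measurable]:
  assumes [measurable]: "g \<in> borel_measurable borel"
  shows "fourier g \<in> borel_measurable borel"
  unfolding fourier_def[abs_def] by measurable

lemma integrable_mult_cis:
  assumes "integrable lborel g"
  shows "integrable lborel (\<lambda>s::'a::euclidean_space. g s * cis (- (\<omega> \<bullet> s)))"
proof (rule Bochner_Integration.integrable_bound[OF assms])
  have [measurable]: "g \<in> borel_measurable borel" using assms by (auto dest: borel_measurable_integrable)
  show "(\<lambda>s. g s * cis (- (\<omega> \<bullet> s))) \<in> borel_measurable lborel" by measurable
qed (simp add: norm_mult)

lemma fourier_norm_le:
  assumes "integrable lborel g"
  shows "cmod (fourier g \<omega>) \<le> (LINT s|lborel. cmod (g s))"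
  unfolding fourier_def by (rule order_trans[OF integral_norm_bound]) (simp add: norm_mult)

lemma gauss_fourier':
  fixes u :: "'a::euclidean_space"
  shows "(CLINT v|lborel. gauss v * cis (u \<bullet> v)) = (2 * pi) powr (real DIM('a) / 2) * gauss u"
proof -
  have "exp (- (norm u)\<^sup>2 / 2) = (2 * pi) powr (real DIM('a) / 2) * gauss u"
    by (simp add: gauss_eq powr_minus)
  then show ?thesis unfolding gauss_fourier(2) by simp
qed

text \<open>Testing \<open>\<bar>fourier g\<bar>\<^sup>2\<close> against a wide Gaussian averages the autocorrelation of \<open>g\<close> over small
  translations.\<close>

lemma gauss_fourier_square:
  fixes g :: "'a::euclidean_space \<Rightarrow> complex"
  assumes g: "integrable lborel g" and g2: "integrable lborel (\<lambda>x. (cmod (g x))\<^sup>2)" and \<epsilon>: "0 < \<epsilon>"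
  shows "(\<integral>\<^sup>+\<omega>. ennreal (gauss (\<epsilon> *\<^sub>R \<omega>) * (cmod (fourier g \<omega>))\<^sup>2) \<partial>lborel) =
    ennreal ((2 * pi) powr (real DIM('a) / 2) * (LINT u|lborel. gauss u *
      ((LINT x|lborel. (cmod (g x))\<^sup>2) - (LINT x|lborel. (cmod (g (x + - \<epsilon> *\<^sub>R u) - g x))\<^sup>2) / 2)))"
proof -
  have [measurable]: "g \<in> borel_measurable borel" using g by (auto dest: borel_measurable_integrable)
  define n where "n = DIM('a)"
  define c where "c = (2 * pi) powr (real DIM('a) / 2)"
  \<comment> \<open>The scale is moved from the Gaussian to the transform, so that the Gaussian
    integrals below are unscaled; a substitution undoes this at the end.\<close>
  define F where "F v = fourier g ((1 / \<epsilon>) *\<^sub>R v)" for v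
  have [measurable]: "F \<in> borel_measurable borel" unfolding F_def by measurable
  define I where "I = (LINT s|lborel. cmod (g s))"
  have F_le: "cmod (F v) \<le> I" for v unfolding F_def I_def by (rule fourier_norm_le[OF g])
  have I0: "0 \<le> I" by (simp add: I_def)
  have inner: "(CLINT v|lborel. gauss v * cnj (F v) * cis (- ((1/\<epsilon>) *\<^sub>R v \<bullet> s))) =
      (CLINT t|lborel. cnj (g t) * (c * gauss ((1/\<epsilon>) *\<^sub>R (t - s))))" for s
  proof -
    let ?G = "\<lambda>v t. gauss v * cnj (g t) * cis ((1/\<epsilon>) *\<^sub>R (t - s) \<bullet> v)"
    have "(CLINT v|lborel. gauss v * cnj (F v) * cis (- ((1/\<epsilon>) *\<^sub>R v \<bullet> s))) =
        (CLINT v|lborel. CLINT t|lborel. ?G v t)"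
    proof (intro Bochner_Integration.integral_cong refl)
      fix v
      have "cnj (F v) = (CLINT t|lborel. cnj (g t) * cis ((1/\<epsilon>) *\<^sub>R v \<bullet> t))"
        unfolding F_def fourier_def by (subst Bochner_Integration.integral_cnj[symmetric]) (simp add: cis_cnj)
      then have "gauss v * cnj (F v) * cis (- ((1/\<epsilon>) *\<^sub>R v \<bullet> s)) =
          (CLINT t|lborel. gauss v * (cnj (g t) * cis ((1/\<epsilon>) *\<^sub>R v \<bullet> t)) * cis (- ((1/\<epsilon>) *\<^sub>R v \<bullet> s)))"
        by simp
      also have "\<dots> = (CLINT t|lborel. ?G v t)"
      proof (intro Bochner_Integration.integral_cong refl)
        fix t
        have "cis ((1/\<epsilon>) *\<^sub>R (t - s) \<bullet> v) = cis ((1/\<epsilon>) *\<^sub>R v \<bullet> t) * cis (- ((1/\<epsilon>) *\<^sub>R v \<bullet> s))"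
          unfolding cis_mult by (simp add: inner_diff_right inner_commute[of _ v] diff_divide_distrib)
        then show "gauss v * (cnj (g t) * cis ((1/\<epsilon>) *\<^sub>R v \<bullet> t)) * cis (- ((1/\<epsilon>) *\<^sub>R v \<bullet> s)) = ?G v t"
          by (simp only: mult.assoc)
      qed
      finally show "gauss v * cnj (F v) * cis (- ((1/\<epsilon>) *\<^sub>R v \<bullet> s)) = (CLINT t|lborel. ?G v t)" .
    qed
    also have "\<dots> = (CLINT t|lborel. CLINT v|lborel. ?G v t)"
    proof (rule lborel_pair.Fubini_integral[symmetric],
        rule integrable_lborel_pair_bound[where a=gauss and b="\<lambda>t. cmod (g t)"])
      show "(\<lambda>(v, t). ?G v t) \<in> borel_measurable (lborel \<Otimes>\<^sub>M lborel)" by measurable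
      show "norm (case (v, t) of (v, t) \<Rightarrow> ?G v t) \<le> gauss v * cmod (g t)" for v t
        using gauss_pos[of v] by (simp add: norm_mult)
    qed (use g in \<open>auto simp: integrable_gauss\<close>)
    also have "\<dots> = (CLINT t|lborel. cnj (g t) * (c * gauss ((1/\<epsilon>) *\<^sub>R (t - s))))"
    proof (intro Bochner_Integration.integral_cong refl)
      fix t
      have "(CLINT v|lborel. ?G v t) = cnj (g t) * (CLINT v|lborel. gauss v * cis ((1/\<epsilon>) *\<^sub>R (t - s) \<bullet> v))"
        unfolding Bochner_Integration.integral_mult_right_zero[symmetric]
        by (intro Bochner_Integration.integral_cong refl) (simp add: mult_ac)
      then show "(CLINT v|lborel. ?G v t) = cnj (g t) * (c * gauss ((1/\<epsilon>) *\<^sub>R (t - s)))"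
        by (simp only: gauss_fourier' c_def of_real_mult)
    qed
    finally show ?thesis .
  qed
  have subst: "(CLINT t|lborel. cnj (g t) * (c * gauss ((1/\<epsilon>) *\<^sub>R (t - s)))) =
      \<epsilon> ^ n * c * (CLINT u|lborel. cnj (g (s + - \<epsilon> *\<^sub>R u)) * gauss u)" for s
  proof -
    have eq: "gauss ((1/\<epsilon>) *\<^sub>R (s + (- \<epsilon>) *\<^sub>R u - s)) = gauss u" for u
      using \<epsilon> by (simp add: gauss_eq)
    have "(CLINT t|lborel. cnj (g t) * (c * gauss ((1/\<epsilon>) *\<^sub>R (t - s)))) =
      (\<bar>- \<epsilon>\<bar> ^ n) *\<^sub>R (CLINT u|lborel. cnj (g (s + (- \<epsilon>) *\<^sub>R u)) * (c * gauss ((1/\<epsilon>) *\<^sub>R (s + (- \<epsilon>) *\<^sub>R u - s))))"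
      unfolding n_def using \<epsilon> by (intro integral_lborel_affine) auto
    also have "\<dots> = (\<bar>- \<epsilon>\<bar> ^ n) *\<^sub>R (CLINT u|lborel. c * (cnj (g (s + (- \<epsilon>) *\<^sub>R u)) * gauss u))"
      unfolding eq by (simp add: mult_ac)
    also have "\<dots> = \<epsilon> ^ n * c * (CLINT u|lborel. cnj (g (s + - \<epsilon> *\<^sub>R u)) * gauss u)"
      using \<epsilon> by (simp add: scaleR_conv_of_real)
    finally show ?thesis .
  qed
  \<comment> \<open>Expanding the squared modulus of g (x + w) - g x expresses the real part of the
    autocorrelation by how far the translation moves g in mean square.\<close>
  have corr_int: "integrable lborel (\<lambda>s. g s * cnj (g (s + w)))"
    and corr_Re: "(LINT s|lborel. Re (g s * cnj (g (s + w)))) =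
      (LINT x|lborel. (cmod (g x))\<^sup>2) - (LINT x|lborel. (cmod (g (x + w) - g x))\<^sup>2) / 2" for w
  proof -
    have t2: "integrable lborel (\<lambda>x. (cmod (g (x + w)))\<^sup>2)"
      using integrable_lborel_affine[OF g2, of 1 w] by (simp add: add.commute)
    have t2': "(LINT x|lborel. (cmod (g (x + w)))\<^sup>2) = (LINT x|lborel. (cmod (g x))\<^sup>2)"
      using integral_lborel_affine[of "\<lambda>x. (cmod (g x))\<^sup>2" 1 w] by (simp add: add.commute)
    show i: "integrable lborel (\<lambda>s. g s * cnj (g (s + w)))"
    proof (rule Bochner_Integration.integrable_bound)
      show "integrable lborel (\<lambda>s. (cmod (g s))\<^sup>2 + (cmod (g (s + w)))\<^sup>2)" using g2 t2 by simp
      show "AE x in lborel. norm (g x * cnj (g (x + w))) \<le> norm ((cmod (g x))\<^sup>2 + (cmod (g (x + w)))\<^sup>2)"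
        using norm_mult_le_squares[of "g _" "cnj (g _)"] by (intro AE_I2) simp
    qed measurable
    have pt: "(cmod (b - a))\<^sup>2 = (cmod a)\<^sup>2 + (cmod b)\<^sup>2 - 2 * Re (a * cnj b)" for a b :: complex
      unfolding cmod_power2 by (simp add: power2_eq_square algebra_simps)
    have "(LINT x|lborel. (cmod (g (x + w) - g x))\<^sup>2) =
        (LINT x|lborel. (cmod (g x))\<^sup>2 + (cmod (g (x + w)))\<^sup>2 - 2 * Re (g x * cnj (g (x + w))))"
      by (simp only: pt)
    also have "\<dots> = (LINT x|lborel. (cmod (g x))\<^sup>2) + (LINT x|lborel. (cmod (g (x + w)))\<^sup>2) -
        2 * (LINT x|lborel. Re (g x * cnj (g (x + w))))"
      using g2 t2 integrable_Re[OF i]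
      by (simp only: Bochner_Integration.integral_diff Bochner_Integration.integral_add
          Bochner_Integration.integrable_add integrable_mult_right Bochner_Integration.integral_mult_right_zero)
    finally show "(LINT s|lborel. Re (g s * cnj (g (s + w)))) =
      (LINT x|lborel. (cmod (g x))\<^sup>2) - (LINT x|lborel. (cmod (g (x + w) - g x))\<^sup>2) / 2"
      using t2' by argo
  qed
  have whole: "(CLINT v|lborel. gauss v * (F v * cnj (F v))) =
      \<epsilon> ^ n * c * (CLINT u|lborel. gauss u * (CLINT s|lborel. g s * cnj (g (s + - \<epsilon> *\<^sub>R u))))"
  proof -
    let ?H = "\<lambda>v s. g s * (gauss v * cnj (F v) * cis (- ((1/\<epsilon>) *\<^sub>R v \<bullet> s)))"
    have "(CLINT v|lborel. gauss v * (F v * cnj (F v))) = (CLINT v|lborel. CLINT s|lborel. ?H v s)"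
    proof (intro Bochner_Integration.integral_cong refl)
      fix v
      have "gauss v * (F v * cnj (F v)) = (gauss v * cnj (F v)) * F v" by simp
      also have "\<dots> = (CLINT s|lborel. (gauss v * cnj (F v)) * (g s * cis (- ((1/\<epsilon>) *\<^sub>R v \<bullet> s))))"
        by (simp add: F_def fourier_def)
      also have "\<dots> = (CLINT s|lborel. ?H v s)" by (simp add: mult_ac)
      finally show "gauss v * (F v * cnj (F v)) = (CLINT s|lborel. ?H v s)" .
    qed
    also have "\<dots> = (CLINT s|lborel. CLINT v|lborel. ?H v s)"
    proof (rule lborel_pair.Fubini_integral[symmetric],
        rule integrable_lborel_pair_bound[where a="\<lambda>v. gauss v * I" and b="\<lambda>t. cmod (g t)"])
      show "(\<lambda>(v, s). ?H v s) \<in> borel_measurable (lborel \<Otimes>\<^sub>M lborel)" by measurable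
      show "norm (case (v, s) of (v, s) \<Rightarrow> ?H v s) \<le> gauss v * I * cmod (g s)" for v s
        using gauss_pos[of v] F_le[of v] by (simp add: norm_mult mult_left_mono mult.commute[of "cmod (g s)"] mult_right_mono)
    qed (use g in \<open>auto simp: integrable_gauss\<close>)
    also have "\<dots> = (CLINT s|lborel. g s * (CLINT v|lborel. gauss v * cnj (F v) * cis (- ((1/\<epsilon>) *\<^sub>R v \<bullet> s))))"
      by simp
    also have "\<dots> = (CLINT s|lborel. g s * (\<epsilon> ^ n * c * (CLINT u|lborel. cnj (g (s + - \<epsilon> *\<^sub>R u)) * gauss u)))"
      unfolding inner subst ..
    also have "\<dots> = (CLINT s|lborel. \<epsilon> ^ n * c * (CLINT u|lborel. g s * (cnj (g (s + - \<epsilon> *\<^sub>R u)) * gauss u)))"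
      by (simp add: mult_ac)
    also have "\<dots> = \<epsilon> ^ n * c * (CLINT s|lborel. CLINT u|lborel. g s * (cnj (g (s + - \<epsilon> *\<^sub>R u)) * gauss u))"
      by simp
    also have "(CLINT s|lborel. CLINT u|lborel. g s * (cnj (g (s + - \<epsilon> *\<^sub>R u)) * gauss u)) =
        (CLINT u|lborel. CLINT s|lborel. g s * (cnj (g (s + - \<epsilon> *\<^sub>R u)) * gauss u))"
    proof (rule lborel_pair.Fubini_integral[symmetric])
      \<comment> \<open>No bound in product form is at hand, since g (s - \<epsilon> u) involves
        both variables. The product is split into two squares, and the translated one is integrated
        in s first.\<close>
      let ?K = "\<lambda>s u. g s * (cnj (g (s + - \<epsilon> *\<^sub>R u)) * gauss u)"
      have m1: "integrable (lborel \<Otimes>\<^sub>M lborel) (\<lambda>(s, u). (cmod (g s))\<^sup>2 * gauss u)"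
        using g2 integrable_gauss gauss_pos
        by (intro integrable_lborel_pair_bound[where a="\<lambda>s. (cmod (g s))\<^sup>2" and b=gauss])
           (auto simp: less_imp_le)
      have m2: "integrable (lborel \<Otimes>\<^sub>M lborel) (\<lambda>(s, u). (cmod (g (s + - \<epsilon> *\<^sub>R u)))\<^sup>2 * gauss u)"
      proof (rule integrableI_bounded)
        show "(\<lambda>(s, u). (cmod (g (s + - \<epsilon> *\<^sub>R u)))\<^sup>2 * gauss u) \<in> borel_measurable (lborel \<Otimes>\<^sub>M lborel)" by measurable
        have "(\<integral>\<^sup>+z. ennreal (norm (case z of (s, u) \<Rightarrow> (cmod (g (s + - \<epsilon> *\<^sub>R u)))\<^sup>2 * gauss u)) \<partial>(lborel \<Otimes>\<^sub>M lborel)) =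
          (\<integral>\<^sup>+u. \<integral>\<^sup>+s. ennreal ((cmod (g (s + - \<epsilon> *\<^sub>R u)))\<^sup>2) * ennreal (gauss u) \<partial>lborel \<partial>lborel)"
          using gauss_pos
          by (subst lborel_pair.nn_integral_snd[symmetric])
             (auto simp: abs_mult abs_of_pos ennreal_mult' intro!: nn_integral_cong)
        also have "\<dots> = (\<integral>\<^sup>+(u::'a). (\<integral>\<^sup>+s. ennreal ((cmod (g s))\<^sup>2) \<partial>lborel) * ennreal (gauss u) \<partial>lborel)"
        proof (intro nn_integral_cong)
          fix u
          have "(\<integral>\<^sup>+s. ennreal ((cmod (g s))\<^sup>2) \<partial>lborel) = (\<integral>\<^sup>+s. ennreal ((cmod (g (s + - \<epsilon> *\<^sub>R u)))\<^sup>2) \<partial>lborel)"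
            using nn_integral_lborel_affine[of "\<lambda>s. ennreal ((cmod (g s))\<^sup>2)" 1 "- \<epsilon> *\<^sub>R u"]
            by (simp add: add.commute)
          then show "(\<integral>\<^sup>+s. ennreal ((cmod (g (s + - \<epsilon> *\<^sub>R u)))\<^sup>2) * ennreal (gauss u) \<partial>lborel) =
              (\<integral>\<^sup>+s. ennreal ((cmod (g s))\<^sup>2) \<partial>lborel) * ennreal (gauss u)"
            by (subst nn_integral_multc) auto
        qed
        also have "\<dots> = (\<integral>\<^sup>+s. ennreal ((cmod (g s))\<^sup>2) \<partial>lborel) * (\<integral>\<^sup>+(u::'a). ennreal (gauss u) \<partial>lborel)"
          by (subst nn_integral_cmult) auto
        also have "\<dots> < \<infinity>"
          using g2 integrable_gauss[where 'a='a] gauss_pos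
          by (auto simp: integrable_iff_bounded ennreal_mult_less_top abs_of_pos)
        finally show "(\<integral>\<^sup>+z. ennreal (norm (case z of (s, u) \<Rightarrow> (cmod (g (s + - \<epsilon> *\<^sub>R u)))\<^sup>2 * gauss u)) \<partial>(lborel \<Otimes>\<^sub>M lborel)) < \<infinity>" .
      qed
      show "integrable (lborel \<Otimes>\<^sub>M lborel) (\<lambda>(s, u). ?K s u)"
      proof (rule Bochner_Integration.integrable_bound[OF Bochner_Integration.integrable_add[OF m1 m2]])
        show "(\<lambda>(s, u). ?K s u) \<in> borel_measurable (lborel \<Otimes>\<^sub>M lborel)" by measurable
        have "norm (?K s u) \<le> (cmod (g s))\<^sup>2 * gauss u + (cmod (g (s + - \<epsilon> *\<^sub>R u)))\<^sup>2 * gauss u" for s u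
        proof -
          have "norm (?K s u) = norm (g s * cnj (g (s + - \<epsilon> *\<^sub>R u))) * gauss u"
            using gauss_pos[of u] by (simp add: norm_mult)
          also have "\<dots> \<le> ((norm (g s))\<^sup>2 + (norm (cnj (g (s + - \<epsilon> *\<^sub>R u))))\<^sup>2) * gauss u"
            using gauss_pos[of u] by (intro mult_right_mono norm_mult_le_squares) auto
          finally show ?thesis by (simp add: distrib_right)
        qed
        then show "AE z in lborel \<Otimes>\<^sub>M lborel. norm (case z of (s, u) \<Rightarrow> ?K s u) \<le>
           norm ((case z of (s, u) \<Rightarrow> (cmod (g s))\<^sup>2 * gauss u) + (case z of (s, u) \<Rightarrow> (cmod (g (s + - \<epsilon> *\<^sub>R u)))\<^sup>2 * gauss u))"
          by (intro AE_I2) (auto intro: order_trans[OF _ abs_ge_self] split: prod.split)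
      qed
    qed
    also have "(CLINT u|lborel. CLINT s|lborel. g s * (cnj (g (s + - \<epsilon> *\<^sub>R u)) * gauss u)) =
      (CLINT u|lborel. gauss u * (CLINT s|lborel. g s * cnj (g (s + - \<epsilon> *\<^sub>R u))))"
      unfolding Bochner_Integration.integral_mult_right_zero[symmetric]
      by (intro Bochner_Integration.integral_cong refl) (simp add: mult_ac)
    finally show ?thesis .
  qed
  define R where "R u = (LINT x|lborel. (cmod (g x))\<^sup>2) - (LINT x|lborel. (cmod (g (x + - \<epsilon> *\<^sub>R u) - g x))\<^sup>2) / 2" for u
  have corr_le: "cmod (CLINT s|lborel. g s * cnj (g (s + w))) \<le> 2 * (LINT x|lborel. (cmod (g x))\<^sup>2)" for w
  proof -
    have t2: "integrable lborel (\<lambda>x. (cmod (g (x + w)))\<^sup>2)"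
      using integrable_lborel_affine[OF g2, of 1 w] by (simp add: add.commute)
    have t2': "(LINT x|lborel. (cmod (g (x + w)))\<^sup>2) = (LINT x|lborel. (cmod (g x))\<^sup>2)"
      using integral_lborel_affine[of "\<lambda>x. (cmod (g x))\<^sup>2" 1 w] by (simp add: add.commute)
    have "cmod (CLINT s|lborel. g s * cnj (g (s + w))) \<le> (LINT s|lborel. cmod (g s * cnj (g (s + w))))"
      by (rule integral_norm_bound)
    also have "\<dots> \<le> (LINT s|lborel. (cmod (g s))\<^sup>2 + (cmod (g (s + w)))\<^sup>2)"
      using g2 t2 integrable_norm[OF corr_int[of w]] norm_mult_le_squares[of "g _" "cnj (g _)"]
      by (intro integral_mono) auto
    also have "\<dots> = 2 * (LINT x|lborel. (cmod (g x))\<^sup>2)" using g2 t2 t2' by simp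
    finally show ?thesis .
  qed
  \<comment> \<open>The integral of the weighted squared transform is real, so only the real part of
    the autocorrelation matters, and \<open>corr_Re\<close> evaluates it.\<close>
  have Re_eq: "Re (CLINT u|lborel. gauss u * (CLINT s|lborel. g s * cnj (g (s + - \<epsilon> *\<^sub>R u)))) = (LINT u|lborel. gauss u * R u)"
  proof -
    have "integrable lborel (\<lambda>u. gauss u * (CLINT s|lborel. g s * cnj (g (s + - \<epsilon> *\<^sub>R u))))"
    proof (rule Bochner_Integration.integrable_bound)
      show "integrable lborel (\<lambda>u::'a. gauss u * (2 * (LINT x|lborel. (cmod (g x))\<^sup>2)))"
        by (simp add: integrable_gauss)
      show "AE u in lborel. norm (gauss u * (CLINT s|lborel. g s * cnj (g (s + - \<epsilon> *\<^sub>R u)))) \<le>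
          norm (gauss u * (2 * (LINT x|lborel. (cmod (g x))\<^sup>2)))"
        using corr_le[of "- \<epsilon> *\<^sub>R _"] by (intro AE_I2) (simp add: gauss_pos norm_mult abs_of_pos mult_left_mono)
    qed measurable
    then have "Re (CLINT u|lborel. gauss u * (CLINT s|lborel. g s * cnj (g (s + - \<epsilon> *\<^sub>R u)))) =
        (LINT u|lborel. Re (gauss u * (CLINT s|lborel. g s * cnj (g (s + - \<epsilon> *\<^sub>R u)))))"
      by (rule Re_integral)
    also have "\<dots> = (LINT u|lborel. gauss u * R u)"
    proof (intro Bochner_Integration.integral_cong refl)
      fix u
      have "Re (CLINT s|lborel. g s * cnj (g (s + - \<epsilon> *\<^sub>R u))) = R u"
        unfolding R_def corr_Re[symmetric] by (rule Re_integral[OF corr_int])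
      then show "Re (gauss u * (CLINT s|lborel. g s * cnj (g (s + - \<epsilon> *\<^sub>R u)))) = gauss u * R u"
        by simp
    qed
    finally show ?thesis .
  qed
  have FF: "complex_of_real (gauss v) * (F v * cnj (F v)) = complex_of_real (gauss v * (cmod (F v))\<^sup>2)" for v
    by (simp only: of_real_mult complex_norm_square)
  have LR: "(LINT v|lborel. gauss v * (cmod (F v))\<^sup>2) = \<epsilon> ^ n * c * (LINT u|lborel. gauss u * R u)"
  proof -
    have "(LINT v|lborel. gauss v * (cmod (F v))\<^sup>2) = Re (CLINT v|lborel. gauss v * (F v * cnj (F v)))"
      unfolding FF integral_complex_of_real by simp
    also have "\<dots> = \<epsilon> ^ n * c * (LINT u|lborel. gauss u * R u)"
      unfolding whole Re_eq[symmetric] by (simp flip: of_real_power of_real_mult)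
    finally show ?thesis .
  qed
  have "(\<integral>\<^sup>+v. ennreal (gauss v * (cmod (F v))\<^sup>2) \<partial>lborel) = ennreal (LINT v|lborel. gauss v * (cmod (F v))\<^sup>2)"
  proof (rule nn_integral_eq_integral)
    show "integrable lborel (\<lambda>v. gauss v * (cmod (F v))\<^sup>2)"
    proof (rule Bochner_Integration.integrable_bound)
      show "integrable lborel (\<lambda>v::'a. gauss v * I\<^sup>2)" by (simp add: integrable_gauss)
      show "AE v in lborel. norm (gauss v * (cmod (F v))\<^sup>2) \<le> norm (gauss v * I\<^sup>2)"
        using F_le by (intro AE_I2) (simp add: gauss_pos abs_mult abs_of_pos mult_left_mono power_mono)
    qed measurable
  qed (use gauss_pos in \<open>auto simp: less_imp_le\<close>)
  also have "\<dots> = ennreal (\<epsilon> ^ n) * ennreal (c * (LINT u|lborel. gauss u * R u))"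
    unfolding LR using \<epsilon> by (simp add: mult.assoc ennreal_mult')
  finally have 1: "(\<integral>\<^sup>+v. ennreal (gauss v * (cmod (F v))\<^sup>2) \<partial>lborel) =
      ennreal (\<epsilon> ^ n) * ennreal (c * (LINT u|lborel. gauss u * R u))" .
  have "(\<integral>\<^sup>+v. ennreal (gauss v * (cmod (F v))\<^sup>2) \<partial>lborel) =
      ennreal (\<epsilon> ^ n) * (\<integral>\<^sup>+\<omega>. ennreal (gauss (\<epsilon> *\<^sub>R \<omega>) * (cmod (fourier g \<omega>))\<^sup>2) \<partial>lborel)"
    using nn_integral_lborel_affine[of "\<lambda>v. ennreal (gauss v * (cmod (F v))\<^sup>2)" \<epsilon> 0] \<epsilon>
    by (simp add: F_def n_def)
  with 1 have "ennreal (\<epsilon> ^ n) * (\<integral>\<^sup>+\<omega>. ennreal (gauss (\<epsilon> *\<^sub>R \<omega>) * (cmod (fourier g \<omega>))\<^sup>2) \<partial>lborel) =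
      ennreal (\<epsilon> ^ n) * ennreal (c * (LINT u|lborel. gauss u * R u))" by simp
  then show ?thesis
    using \<epsilon> by (simp add: ennreal_mult_cancel_left c_def R_def)
qed

text \<open>Let \<epsilon> tend to 0 in \<open>gauss_fourier_square\<close>. On the left the
  Gaussian increases to its value 1 / c at the origin, so monotone convergence applies; on the right
  the translation differences vanish, so dominated convergence gives c N. The two factors c multiply
  to the power of 2 \<pi>.\<close>

theorem plancherel:
  fixes g :: "'a::euclidean_space \<Rightarrow> complex"
  assumes g: "integrable lborel g" and g2: "integrable lborel (\<lambda>x. (cmod (g x))\<^sup>2)"
  shows "(\<integral>\<^sup>+\<omega>. ennreal ((cmod (fourier g \<omega>))\<^sup>2) \<partial>lborel) =
    ennreal ((2 * pi) ^ DIM('a) * (LINT x|lborel. (cmod (g x))\<^sup>2))"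
proof -
  have [measurable]: "g \<in> borel_measurable borel" using g by (auto dest: borel_measurable_integrable)
  define c where "c = (2 * pi) powr (real DIM('a) / 2)"
  have c: "c > 0" by (simp add: c_def)
  have g0: "gauss (0::'a) = 1 / c" by (simp add: gauss_eq c_def powr_minus_divide)
  define N where "N = (LINT x|lborel. (cmod (g x))\<^sup>2)"
  define D where "D w = (LINT x|lborel. (cmod (g (x + w) - g x))\<^sup>2)" for w
  define \<epsilon> where "\<epsilon> k = 1 / real (Suc k)" for k
  have \<epsilon>: "\<epsilon> k > 0" for k by (simp add: \<epsilon>_def)
  have \<epsilon>lim: "\<epsilon> \<longlonglongrightarrow> 0" unfolding \<epsilon>_def using LIMSEQ_inverse_real_of_nat by (simp add: inverse_eq_divide)
  have Dmeas [measurable]: "D \<in> borel_measurable borel" unfolding D_def by measurable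
  have D_le: "0 \<le> D w" "D w \<le> 4 * N" for w
  proof -
    have t2: "integrable lborel (\<lambda>x. (cmod (g (x + w)))\<^sup>2)"
      using integrable_lborel_affine[OF g2, of 1 w] by (simp add: add.commute)
    have t2': "(LINT x|lborel. (cmod (g (x + w)))\<^sup>2) = N"
      using integral_lborel_affine[of "\<lambda>x. (cmod (g x))\<^sup>2" 1 w] by (simp add: add.commute N_def)
    show "0 \<le> D w" by (simp add: D_def)
    have le: "(cmod (g (x + w) - g x))\<^sup>2 \<le> 2 * (cmod (g (x + w)))\<^sup>2 + 2 * (cmod (g x))\<^sup>2" for x
      using norm_add_square_le[of "g (x + w)" "- g x"] by simp
    have int: "integrable lborel (\<lambda>x. 2 * (cmod (g (x + w)))\<^sup>2 + 2 * (cmod (g x))\<^sup>2)" using g2 t2 by simp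
    have "integrable lborel (\<lambda>x. (cmod (g (x + w) - g x))\<^sup>2)"
      using le by (intro Bochner_Integration.integrable_bound[OF int]) auto
    then have "D w \<le> (LINT x|lborel. 2 * (cmod (g (x + w)))\<^sup>2 + 2 * (cmod (g x))\<^sup>2)"
      unfolding D_def by (intro integral_mono le int)
    also have "\<dots> = 4 * N" using g2 t2 t2' by (simp add: N_def)
    finally show "D w \<le> 4 * N" .
  qed
  have N0: "0 \<le> N" by (simp add: N_def)
  have "(\<lambda>k. LINT u|lborel. gauss u * (N - D (- \<epsilon> k *\<^sub>R u) / 2)) \<longlonglongrightarrow> (LINT u|lborel. gauss (u::'a) * N)"
  proof (rule integral_dominated_convergence[where w="\<lambda>u. gauss u * (3 * N)"])
    show "AE u in lborel. (\<lambda>k. gauss u * (N - D (- \<epsilon> k *\<^sub>R u) / 2)) \<longlonglongrightarrow> gauss u * N"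
    proof (rule AE_I2)
      fix u :: 'a
      have "(\<lambda>k. - \<epsilon> k *\<^sub>R u) \<longlonglongrightarrow> - 0 *\<^sub>R u" by (intro tendsto_intros \<epsilon>lim)
      then have "(\<lambda>k. D (- \<epsilon> k *\<^sub>R u)) \<longlonglongrightarrow> 0"
        unfolding D_def by (intro L2_translation_continuous g2) auto
      then have "(\<lambda>k. gauss u * (N - D (- \<epsilon> k *\<^sub>R u) / 2)) \<longlonglongrightarrow> gauss u * (N - 0 / 2)"
        by (intro tendsto_intros) auto
      then show "(\<lambda>k. gauss u * (N - D (- \<epsilon> k *\<^sub>R u) / 2)) \<longlonglongrightarrow> gauss u * N" by simp
    qed
    show "AE u in lborel. norm (gauss u * (N - D (- \<epsilon> k *\<^sub>R u) / 2)) \<le> gauss u * (3 * N)" for k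
    proof (rule AE_I2)
      fix u :: 'a
      have "\<bar>N - D (- \<epsilon> k *\<^sub>R u) / 2\<bar> \<le> 3 * N" using D_le[of "- \<epsilon> k *\<^sub>R u"] N0 by linarith
      then show "norm (gauss u * (N - D (- \<epsilon> k *\<^sub>R u) / 2)) \<le> gauss u * (3 * N)"
        using gauss_pos[of u] by (simp add: abs_mult abs_of_pos mult_left_mono)
    qed
  qed (auto simp: integrable_gauss)
  then have "(\<lambda>k. ennreal (c * (LINT u|lborel. gauss u * (N - D (- \<epsilon> k *\<^sub>R u) / 2)))) \<longlonglongrightarrow>
      ennreal (c * (LINT u|lborel. gauss (u::'a) * N))"
    by (intro tendsto_intros)
  then have R: "(\<lambda>k. ennreal (c * (LINT u|lborel. gauss u * (N - D (- \<epsilon> k *\<^sub>R u) / 2)))) \<longlonglongrightarrow> ennreal (c * N)"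
    by (simp add: integral_gauss)
  have L: "(\<lambda>k. \<integral>\<^sup>+\<omega>. ennreal (gauss (\<epsilon> k *\<^sub>R \<omega>) * (cmod (fourier g \<omega>))\<^sup>2) \<partial>lborel) \<longlonglongrightarrow>
      (\<integral>\<^sup>+\<omega>. ennreal (gauss (0::'a) * (cmod (fourier g \<omega>))\<^sup>2) \<partial>lborel)"
  proof (rule nn_integral_LIMSEQ)
    show "incseq (\<lambda>k \<omega>. ennreal (gauss (\<epsilon> k *\<^sub>R \<omega>) * (cmod (fourier g \<omega>))\<^sup>2))"
    proof (intro incseq_SucI le_funI ennreal_leI mult_right_mono)
      fix k and \<omega> :: 'a
      have "norm (\<epsilon> (Suc k) *\<^sub>R \<omega>) \<le> norm (\<epsilon> k *\<^sub>R \<omega>)"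
        by (auto simp: \<epsilon>_def intro!: divide_left_mono)
      then have "(norm (\<epsilon> (Suc k) *\<^sub>R \<omega>))\<^sup>2 \<le> (norm (\<epsilon> k *\<^sub>R \<omega>))\<^sup>2" by (intro power_mono) auto
      then show "gauss (\<epsilon> k *\<^sub>R \<omega>) \<le> gauss (\<epsilon> (Suc k) *\<^sub>R \<omega>)"
        unfolding gauss_eq by (intro mult_left_mono) auto
    qed auto
    show "(\<lambda>k. ennreal (gauss (\<epsilon> k *\<^sub>R \<omega>) * (cmod (fourier g \<omega>))\<^sup>2)) \<longlonglongrightarrow>
        ennreal (gauss (0::'a) * (cmod (fourier g \<omega>))\<^sup>2)" for \<omega>
    proof -
      have "(\<lambda>k. \<epsilon> k *\<^sub>R \<omega>) \<longlonglongrightarrow> 0 *\<^sub>R \<omega>" by (intro tendsto_intros \<epsilon>lim)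
      then have "(\<lambda>k. gauss (\<epsilon> k *\<^sub>R \<omega>)) \<longlonglongrightarrow> gauss (0 *\<^sub>R \<omega>)"
        unfolding gauss_eq by (intro tendsto_intros \<epsilon>lim) auto
      then show ?thesis by (intro tendsto_intros) auto
    qed
  qed measurable
  have eq: "(\<integral>\<^sup>+\<omega>. ennreal (gauss (\<epsilon> k *\<^sub>R \<omega>) * (cmod (fourier g \<omega>))\<^sup>2) \<partial>lborel) =
    ennreal (c * (LINT u|lborel. gauss u * (N - D (- \<epsilon> k *\<^sub>R u) / 2)))" for k
    using gauss_fourier_square[OF g g2 \<epsilon>[of k]] by (simp add: c_def N_def D_def)
  have "(\<integral>\<^sup>+\<omega>. ennreal (gauss (0::'a) * (cmod (fourier g \<omega>))\<^sup>2) \<partial>lborel) = ennreal (c * N)"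
    using LIMSEQ_unique[OF L[unfolded eq] R] .
  then have "ennreal (1 / c) * (\<integral>\<^sup>+\<omega>. ennreal ((cmod (fourier g \<omega>))\<^sup>2) \<partial>lborel) = ennreal (c * N)"
    unfolding g0 using c
    by (subst nn_integral_cmult[symmetric]) (simp_all flip: ennreal_mult')
  then have "ennreal c * (ennreal (1 / c) * (\<integral>\<^sup>+\<omega>. ennreal ((cmod (fourier g \<omega>))\<^sup>2) \<partial>lborel)) = ennreal c * ennreal (c * N)"
    by simp
  then have "(\<integral>\<^sup>+\<omega>. ennreal ((cmod (fourier g \<omega>))\<^sup>2) \<partial>lborel) = ennreal (c * (c * N))"
    using c by (simp add: mult.assoc[symmetric] N0 flip: ennreal_mult' ennreal_mult)
  also have "c * (c * N) = (2 * pi) ^ DIM('a) * N"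
    by (simp add: c_def mult.assoc[symmetric] powr_add[symmetric] powr_realpow)
  finally show ?thesis by (simp add: N_def)
qed

section \<open>The short-time Fourier transform\<close>

definition stft :: "('a::euclidean_space \<Rightarrow> complex) \<Rightarrow> ('a \<Rightarrow> complex) \<Rightarrow> 'a \<times> 'a \<Rightarrow> complex" where
  "stft f \<psi> z = (CLINT t|lborel. f t * cnj (\<psi> (t - fst z)) * cis (- (snd z \<bullet> t)))"

definition time_frequency_shift :: "'a::euclidean_space \<times> 'a \<Rightarrow> ('a \<Rightarrow> complex) \<Rightarrow> 'a \<Rightarrow> complex" where
  "time_frequency_shift w \<psi> = (\<lambda>s. \<psi> (s - fst w) * cis (snd w \<bullet> s))"

lemma stft_measurable [measurable]:
  assumes [measurable]: "f \<in> borel_measurable borel" "\<psi> \<in> borel_measurable borel"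
  shows "stft f \<psi> \<in> borel_measurable borel"
proof -
  have "stft f \<psi> \<in> borel_measurable (borel \<Otimes>\<^sub>M borel)"
    unfolding stft_def[abs_def] by measurable
  then show ?thesis by (simp add: borel_prod)
qed

lemma time_frequency_shift_measurable [measurable]:
  assumes [measurable]: "\<psi> \<in> borel_measurable borel"
  shows "time_frequency_shift w \<psi> \<in> borel_measurable borel"
  unfolding time_frequency_shift_def by measurable

lemma stft_integrable:
  fixes f \<psi> :: "'a::euclidean_space \<Rightarrow> complex"
  assumes [measurable]: "f \<in> borel_measurable borel" "\<psi> \<in> borel_measurable borel"
    and f2: "integrable lborel (\<lambda>x. (cmod (f x))\<^sup>2)" and p2: "integrable lborel (\<lambda>x. (cmod (\<psi> x))\<^sup>2)"
  shows "integrable lborel (\<lambda>t. f t * cnj (\<psi> (t - x)))"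
proof (rule Bochner_Integration.integrable_bound)
  have "integrable lborel (\<lambda>t. (cmod (\<psi> (t - x)))\<^sup>2)"
    using integrable_lborel_affine[OF p2, of 1 "- x"] by simp
  then show "integrable lborel (\<lambda>t. (cmod (f t))\<^sup>2 + (cmod (\<psi> (t - x)))\<^sup>2)" using f2 by simp
  show "AE t in lborel. norm (f t * cnj (\<psi> (t - x))) \<le> norm ((cmod (f t))\<^sup>2 + (cmod (\<psi> (t - x)))\<^sup>2)"
    using norm_mult_le_squares[of "f _" "cnj (\<psi> _)"] by (intro AE_I2) simp
qed measurable

text \<open>Plancherel in the frequency variable for each fixed position, then Tonelli in position
  and time. The bounded window makes the product of f with a translated window square integrable as
  well as integrable, which is what \<open>plancherel\<close> asks for.\<close>

theorem moyal:
  fixes f \<psi> :: "'a::euclidean_space \<Rightarrow> complex"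
  assumes f [measurable]: "f \<in> borel_measurable borel" and psi [measurable]: "\<psi> \<in> borel_measurable borel"
    and f2: "integrable lborel (\<lambda>x. (cmod (f x))\<^sup>2)" and p2: "integrable lborel (\<lambda>x. (cmod (\<psi> x))\<^sup>2)"
    and bd: "\<And>x. cmod (\<psi> x) \<le> M"
  shows "(\<integral>\<^sup>+z. ennreal ((cmod (stft f \<psi> z))\<^sup>2) \<partial>lborel) =
    ennreal ((2 * pi) ^ DIM('a) * (LINT x|lborel. (cmod (\<psi> x))\<^sup>2) * (LINT x|lborel. (cmod (f x))\<^sup>2))"
proof -
  define c where "c = (2 * pi) ^ DIM('a)"
  have c: "c \<ge> 0" by (simp add: c_def)
  define P where "P = (LINT x|lborel. (cmod (\<psi> x))\<^sup>2)"
  have inner: "(\<integral>\<^sup>+\<omega>. ennreal ((cmod (stft f \<psi> (x, \<omega>)))\<^sup>2) \<partial>lborel) =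
      ennreal c * (\<integral>\<^sup>+t. ennreal ((cmod (f t))\<^sup>2) * ennreal ((cmod (\<psi> (t - x)))\<^sup>2) \<partial>lborel)" for x
  proof -
    let ?g = "\<lambda>t. f t * cnj (\<psi> (t - x))"
    have g: "integrable lborel ?g" by (rule stft_integrable[OF f psi f2 p2])
    have g2: "integrable lborel (\<lambda>t. (cmod (?g t))\<^sup>2)"
    proof (rule Bochner_Integration.integrable_bound)
      show "integrable lborel (\<lambda>t. (cmod (f t))\<^sup>2 * M\<^sup>2)" using f2 by simp
      show "AE t in lborel. norm ((cmod (?g t))\<^sup>2) \<le> norm ((cmod (f t))\<^sup>2 * M\<^sup>2)"
        using bd by (intro AE_I2) (simp add: norm_mult power_mult_distrib mult_left_mono power_mono)
    qed measurable
    have "(\<integral>\<^sup>+\<omega>. ennreal ((cmod (stft f \<psi> (x, \<omega>)))\<^sup>2) \<partial>lborel) =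
        (\<integral>\<^sup>+\<omega>. ennreal ((cmod (fourier ?g \<omega>))\<^sup>2) \<partial>lborel)"
      by (simp add: stft_def fourier_def)
    also have "\<dots> = ennreal (c * (LINT t|lborel. (cmod (?g t))\<^sup>2))"
      unfolding c_def by (rule plancherel[OF g g2])
    also have "\<dots> = ennreal c * (\<integral>\<^sup>+t. ennreal ((cmod (?g t))\<^sup>2) \<partial>lborel)"
      using c by (subst nn_integral_eq_integral[OF g2]) (auto simp: ennreal_mult')
    finally show ?thesis by (simp add: norm_mult power_mult_distrib ennreal_mult')
  qed
  have "(\<integral>\<^sup>+z. ennreal ((cmod (stft f \<psi> z))\<^sup>2) \<partial>lborel) =
      (\<integral>\<^sup>+x. \<integral>\<^sup>+\<omega>. ennreal ((cmod (stft f \<psi> (x, \<omega>)))\<^sup>2) \<partial>lborel \<partial>lborel)"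
    unfolding lborel_prod[symmetric]
  proof (rule lborel.nn_integral_fst[symmetric])
    have "stft f \<psi> \<in> borel_measurable (borel \<Otimes>\<^sub>M borel)" by (simp add: borel_prod)
    then have "stft f \<psi> \<in> borel_measurable (lborel \<Otimes>\<^sub>M lborel)" 
      by (simp cong: measurable_cong_sets sets_pair_measure_cong)
    then show "(\<lambda>z. ennreal ((cmod (stft f \<psi> z))\<^sup>2)) \<in> borel_measurable (lborel \<Otimes>\<^sub>M lborel)"
      by measurable
  qed
  also have "\<dots> = (\<integral>\<^sup>+x. ennreal c * (\<integral>\<^sup>+t. ennreal ((cmod (f t))\<^sup>2) * ennreal ((cmod (\<psi> (t - x)))\<^sup>2) \<partial>lborel) \<partial>lborel)"
    by (simp only: inner)
  also have "\<dots> = ennreal c * (\<integral>\<^sup>+x. (\<integral>\<^sup>+t. ennreal ((cmod (f t))\<^sup>2) * ennreal ((cmod (\<psi> (t - x)))\<^sup>2) \<partial>lborel) \<partial>lborel)"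
    by (rule nn_integral_cmult) measurable
  also have "(\<integral>\<^sup>+x. (\<integral>\<^sup>+t. ennreal ((cmod (f t))\<^sup>2) * ennreal ((cmod (\<psi> (t - x)))\<^sup>2) \<partial>lborel) \<partial>lborel) =
      (\<integral>\<^sup>+t. (\<integral>\<^sup>+x. ennreal ((cmod (f t))\<^sup>2) * ennreal ((cmod (\<psi> (t - x)))\<^sup>2) \<partial>lborel) \<partial>lborel)"
    by (rule lborel_pair.Fubini') measurable
  also have "\<dots> = (\<integral>\<^sup>+t. ennreal ((cmod (f t))\<^sup>2) * ennreal P \<partial>lborel)"
  proof (intro nn_integral_cong)
    fix t
    have "ennreal P = (\<integral>\<^sup>+x. ennreal ((cmod (\<psi> x))\<^sup>2) \<partial>lborel)"
      unfolding P_def by (rule nn_integral_eq_integral[symmetric, OF p2]) simp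
    also have "\<dots> = (\<integral>\<^sup>+x. ennreal ((cmod (\<psi> (t - x)))\<^sup>2) \<partial>lborel)"
      using nn_integral_lborel_affine[of "\<lambda>x. ennreal ((cmod (\<psi> x))\<^sup>2)" "-1" t] by simp
    finally show "(\<integral>\<^sup>+x. ennreal ((cmod (f t))\<^sup>2) * ennreal ((cmod (\<psi> (t - x)))\<^sup>2) \<partial>lborel) =
        ennreal ((cmod (f t))\<^sup>2) * ennreal P"
      by (subst nn_integral_cmult) auto
  qed
  also have "\<dots> = ennreal (LINT x|lborel. (cmod (f x))\<^sup>2) * ennreal P"
    by (subst nn_integral_multc) (auto simp: nn_integral_eq_integral[OF f2])
  finally show ?thesis
    unfolding c_def[symmetric] P_def[symmetric]
    using c by (simp add: P_def ennreal_mult' mult_ac)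
qed

lemma stft_add:
  "stft f \<psi> (z + w) = cis (- (snd w \<bullet> fst z)) * stft f (time_frequency_shift w \<psi>) z"
proof -
  have eq: "f t * cnj (\<psi> (t - fst (z + w))) * cis (- (snd (z + w) \<bullet> t)) =
     cis (- (snd w \<bullet> fst z)) * (f t * cnj (time_frequency_shift w \<psi> (t - fst z)) * cis (- (snd z \<bullet> t)))" for t
  proof -
    have "cis (- (snd (z + w) \<bullet> t)) = cis (- (snd w \<bullet> fst z)) * cis (- (snd w \<bullet> (t - fst z))) * cis (- (snd z \<bullet> t))"
      unfolding cis_mult by (intro arg_cong[where f=cis]) (simp add: inner_add_left inner_diff_right)
    moreover have "t - fst (z + w) = t - fst z - fst w" by simp
    ultimately show ?thesis by (simp add: time_frequency_shift_def cis_cnj diff_diff_eq)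
  qed
  show ?thesis unfolding stft_def eq by (rule Bochner_Integration.integral_mult_right_zero)
qed

text \<open>The shift is split into a translation, controlled by
  \<open>L2_translation_continuous\<close>, and a modulation, controlled by dominated convergence.
  Both facts concern sequences, hence the argument by contradiction along shifts tending to
  0.\<close>

lemma time_frequency_shift_continuous:
  fixes \<psi> :: "'a::euclidean_space \<Rightarrow> complex"
  assumes [measurable]: "\<psi> \<in> borel_measurable borel" and p2: "integrable lborel (\<lambda>x. (cmod (\<psi> x))\<^sup>2)"
    and e: "0 < e"
  shows "\<exists>\<delta>>0. \<forall>w. norm w < \<delta> \<longrightarrow>
    integrable lborel (\<lambda>s. (cmod (time_frequency_shift w \<psi> s - \<psi> s))\<^sup>2) \<and>
    (LINT s|lborel. (cmod (time_frequency_shift w \<psi> s - \<psi> s))\<^sup>2) < e"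
proof -
  define U where "U w s = 2 * (cmod (\<psi> (s - fst w) - \<psi> s))\<^sup>2" for w :: "'a \<times> 'a" and s
  define B where "B w s = 2 * ((cmod (\<psi> s))\<^sup>2 * (cmod (cis (snd w \<bullet> s) - 1))\<^sup>2)" for w :: "'a \<times> 'a" and s
  have [measurable]: "U w \<in> borel_measurable borel" "B w \<in> borel_measurable borel" for w
    unfolding U_def B_def by measurable
  have le: "(cmod (time_frequency_shift w \<psi> s - \<psi> s))\<^sup>2 \<le> U w s + B w s" for w s
  proof -
    have "time_frequency_shift w \<psi> s - \<psi> s =
        (\<psi> (s - fst w) - \<psi> s) * cis (snd w \<bullet> s) + \<psi> s * (cis (snd w \<bullet> s) - 1)"
      by (simp add: time_frequency_shift_def algebra_simps)
    then show ?thesis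
      using norm_add_square_le[of "(\<psi> (s - fst w) - \<psi> s) * cis (snd w \<bullet> s)" "\<psi> s * (cis (snd w \<bullet> s) - 1)"]
      by (simp add: U_def B_def norm_mult power_mult_distrib)
  qed
  have Ui: "integrable lborel (U w)" for w
  proof (rule Bochner_Integration.integrable_bound)
    have "integrable lborel (\<lambda>t. (cmod (\<psi> (t - fst w)))\<^sup>2)"
      using integrable_lborel_affine[OF p2, of 1 "- fst w"] by simp
    then show "integrable lborel (\<lambda>s. 2 * (2 * (cmod (\<psi> (s - fst w)))\<^sup>2 + 2 * (cmod (\<psi> s))\<^sup>2))" using p2 by simp
    show "AE s in lborel. norm (U w s) \<le> norm (2 * (2 * (cmod (\<psi> (s - fst w)))\<^sup>2 + 2 * (cmod (\<psi> s))\<^sup>2))"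
    proof (rule AE_I2)
      fix s
      show "norm (U w s) \<le> norm (2 * (2 * (cmod (\<psi> (s - fst w)))\<^sup>2 + 2 * (cmod (\<psi> s))\<^sup>2))"
        using norm_add_square_le[of "\<psi> (s - fst w)" "- \<psi> s"] by (simp add: U_def)
    qed
  qed measurable
  have B_le: "B w s \<le> 8 * (cmod (\<psi> s))\<^sup>2" "0 \<le> B w s" for w s
  proof -
    have "cmod (cis (snd w \<bullet> s) - 1) \<le> 2"
      using norm_triangle_ineq4[of "cis (snd w \<bullet> s)" 1] by simp
    then have "(cmod (cis (snd w \<bullet> s) - 1))\<^sup>2 \<le> 2\<^sup>2" by (intro power_mono) auto
    then have "(cmod (\<psi> s))\<^sup>2 * (cmod (cis (snd w \<bullet> s) - 1))\<^sup>2 \<le> (cmod (\<psi> s))\<^sup>2 * 4"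
      by (intro mult_left_mono) auto
    then show "B w s \<le> 8 * (cmod (\<psi> s))\<^sup>2" by (simp add: B_def)
    show "0 \<le> B w s" by (simp add: B_def)
  qed
  have Bi: "integrable lborel (B w)" for w
  proof (rule Bochner_Integration.integrable_bound)
    show "integrable lborel (\<lambda>s. 8 * (cmod (\<psi> s))\<^sup>2)" using p2 by simp
    show "AE s in lborel. norm (B w s) \<le> norm (8 * (cmod (\<psi> s))\<^sup>2)"
      using B_le by (intro AE_I2) simp
  qed measurable
  have ti: "integrable lborel (\<lambda>s. (cmod (time_frequency_shift w \<psi> s - \<psi> s))\<^sup>2)" for w
  proof (rule Bochner_Integration.integrable_bound[OF Bochner_Integration.integrable_add[OF Ui Bi]])
    show "AE s in lborel. norm ((cmod (time_frequency_shift w \<psi> s - \<psi> s))\<^sup>2) \<le> norm (U w s + B w s)"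
      using order_trans[OF le abs_ge_self] by (intro AE_I2) simp
  qed measurable
  have bound: "(LINT s|lborel. (cmod (time_frequency_shift w \<psi> s - \<psi> s))\<^sup>2) \<le>
      (LINT s|lborel. U w s) + (LINT s|lborel. B w s)" for w
    unfolding Bochner_Integration.integral_add[OF Ui Bi, symmetric]
    by (intro integral_mono ti Bochner_Integration.integrable_add Ui Bi le)
  have "\<exists>\<delta>>0. \<forall>w. norm w < \<delta> \<longrightarrow> (LINT s|lborel. (cmod (time_frequency_shift w \<psi> s - \<psi> s))\<^sup>2) < e"
  proof (rule ccontr)
    assume neg: "\<not> ?thesis"
    have "\<exists>w. norm w < 1 / real (Suc n) \<and> \<not> (LINT s|lborel. (cmod (time_frequency_shift w \<psi> s - \<psi> s))\<^sup>2) < e" for n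
      using neg by (metis of_nat_0_less_iff zero_less_Suc zero_less_divide_1_iff)
    then obtain w where w: "\<And>n. norm (w n) < 1 / real (Suc n)"
      "\<And>n. \<not> (LINT s|lborel. (cmod (time_frequency_shift (w n) \<psi> s - \<psi> s))\<^sup>2) < e" by metis
    have wlim: "w \<longlonglongrightarrow> 0"
      using w(1) LIMSEQ_inverse_real_of_nat
      by (intro Lim_null_comparison[of w "\<lambda>n. 1 / real (Suc n)"])
         (auto simp: inverse_eq_divide intro!: always_eventually less_imp_le)
    have flim: "(\<lambda>n. - fst (w n)) \<longlonglongrightarrow> 0" and slim: "(\<lambda>n. snd (w n)) \<longlonglongrightarrow> 0"
      using tendsto_minus[OF tendsto_fst[OF wlim]] tendsto_snd[OF wlim] by simp_all
    have "(\<lambda>n. 2 * (LINT s|lborel. (cmod (\<psi> (s + - fst (w n)) - \<psi> s))\<^sup>2)) \<longlonglongrightarrow> 2 * 0"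
      by (intro tendsto_mult tendsto_const L2_translation_continuous p2 flim) simp
    then have U: "(\<lambda>n. LINT s|lborel. U (w n) s) \<longlonglongrightarrow> 0" by (simp add: U_def)
    have B: "(\<lambda>n. LINT s|lborel. B (w n) s) \<longlonglongrightarrow> (LINT (s::'a)|lborel. 0)"
    proof (rule integral_dominated_convergence[where w="\<lambda>s. 8 * (cmod (\<psi> s))\<^sup>2"])
      show "AE s in lborel. (\<lambda>n. B (w n) s) \<longlonglongrightarrow> 0"
      proof (rule AE_I2)
        fix s
        have "(\<lambda>n. snd (w n) \<bullet> s) \<longlonglongrightarrow> 0 \<bullet> s" by (intro tendsto_inner slim tendsto_const)
        then have "(\<lambda>n. cis (snd (w n) \<bullet> s)) \<longlonglongrightarrow> cis (0 \<bullet> s)"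
          by (intro continuous_on_tendsto_compose[OF continuous_on_cis[OF continuous_on_id, of UNIV]]) auto
        then have "(\<lambda>n. B (w n) s) \<longlonglongrightarrow> 2 * ((cmod (\<psi> s))\<^sup>2 * (cmod (cis (0 \<bullet> s) - 1))\<^sup>2)"
          unfolding B_def by (intro tendsto_intros slim)
        then show "(\<lambda>n. B (w n) s) \<longlonglongrightarrow> 0" by simp
      qed
    qed (use p2 B_le in auto)
    have "(\<lambda>n. (LINT s|lborel. U (w n) s) + (LINT s|lborel. B (w n) s)) \<longlonglongrightarrow> 0"
      using tendsto_add[OF U B] by simp
    then have "\<forall>\<^sub>F n in sequentially. (LINT s|lborel. U (w n) s) + (LINT s|lborel. B (w n) s) < e"
      using e by (intro order_tendstoD(2)) auto
    then obtain n where "(LINT s|lborel. U (w n) s) + (LINT s|lborel. B (w n) s) < e"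
      by (auto simp: eventually_sequentially)
    then show False using bound[of "w n"] w(2)[of n] by simp
  qed
  then show ?thesis using ti by blast
qed

text \<open>Moving a point of phase space by \<open>w\<close> amounts to shifting the window, so on average over
  phase space \<open>stft f \<psi>\<close> hardly varies over small balls, and a set that meets every such
  ball in a fixed proportion captures a fixed proportion of the energy.\<close>

lemma stft_thick_set:
  fixes f \<psi> :: "'a::euclidean_space \<Rightarrow> complex"
  assumes f [measurable]: "f \<in> borel_measurable borel" and psi [measurable]: "\<psi> \<in> borel_measurable borel"
    and f2: "integrable lborel (\<lambda>x. (cmod (f x))\<^sup>2)" and p2: "integrable lborel (\<lambda>x. (cmod (\<psi> x))\<^sup>2)"
    and norm1: "(LINT x|lborel. (cmod (\<psi> x))\<^sup>2) = 1"
    and bd: "\<And>x. cmod (\<psi> x) \<le> M"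
    and S [measurable]: "S \<in> sets borel"
    and \<alpha>: "0 < \<alpha>" and \<delta>: "0 < \<delta>"
    and shift: "\<And>w. norm w < \<delta> \<Longrightarrow> integrable lborel (\<lambda>s. (cmod (time_frequency_shift w \<psi> s - \<psi> s))\<^sup>2) \<and>
        (LINT s|lborel. (cmod (time_frequency_shift w \<psi> s - \<psi> s))\<^sup>2) < \<alpha> / 4"
    and thick: "\<And>z. ennreal \<alpha> * emeasure lborel (ball (0::'a \<times> 'a) \<delta>) \<le> emeasure lborel (S \<inter> ball z \<delta>)"
  shows "ennreal (\<alpha> / 4 * (2 * pi) ^ DIM('a) * (LINT x|lborel. (cmod (f x))\<^sup>2)) \<le>
    (\<integral>\<^sup>+z. indicator S z * ennreal ((cmod (stft f \<psi> z))\<^sup>2) \<partial>lborel)"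
proof -
  define F where "F z = ennreal ((cmod (stft f \<psi> z))\<^sup>2)" for z
  have [measurable]: "F \<in> borel_measurable borel" unfolding F_def by measurable
  have iS [measurable]: "(indicator S :: 'a \<times> 'a \<Rightarrow> ennreal) \<in> borel_measurable borel"
    and iB [measurable]: "(indicator (ball 0 \<delta>) :: 'a \<times> 'a \<Rightarrow> ennreal) \<in> borel_measurable borel"
    by (auto intro: borel_measurable_indicator)
  have iSt [measurable]: "(\<lambda>w. indicator S (z + w) :: ennreal) \<in> borel_measurable borel" for z
    by (rule measurable_compose[OF _ iS]) measurable
  define N where "N = (2 * pi) ^ DIM('a) * (LINT x|lborel. (cmod (f x))\<^sup>2)"
  have N0: "0 \<le> N" by (simp add: N_def)
  define IS where "IS = (\<integral>\<^sup>+z. indicator S z * F z \<partial>lborel)"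
  define b where "b = measure lborel (ball (0::'a \<times> 'a) \<delta>)"
  have b: "emeasure lborel (ball (0::'a \<times> 'a) \<delta>) = ennreal b"
    unfolding b_def by (intro emeasure_eq_ennreal_measure) (use emeasure_bounded_finite[of "ball (0::'a \<times> 'a) \<delta>"] in auto)
  have b0: "0 < b"
  proof -
    have "emeasure lborel (ball (0::'a \<times> 'a) \<delta>) \<noteq> 0"
      using \<delta> open_not_negligible[of "ball (0::'a \<times> 'a) \<delta>"]
      by (auto simp: negligible_iff_null_sets null_sets_def)
    then show ?thesis unfolding b by (auto simp: ennreal_eq_0_iff)
  qed
  have total: "(\<integral>\<^sup>+z. F z \<partial>lborel) = ennreal N"
    unfolding F_def N_def using moyal[OF f psi f2 p2 bd] by (simp add: norm1)
  \<comment> \<open>Up to a phase, the transform at z + w is the transform at z with shifted window;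
    its difference \<rho> from the original window has energy below \<alpha> / 4, so Moyal bounds
    the replacement error by \<alpha> / 2 times the total.\<close>
  have single: "(\<integral>\<^sup>+z. indicator S (z + w) * F z \<partial>lborel) \<le> 2 * IS + ennreal (\<alpha> / 2 * N)"
    if w: "norm w < \<delta>" for w
  proof -
    define \<rho> where "\<rho> s = time_frequency_shift w \<psi> s - \<psi> s" for s
    have [measurable]: "\<rho> \<in> borel_measurable borel" unfolding \<rho>_def by measurable
    have r2: "integrable lborel (\<lambda>s. (cmod (\<rho> s))\<^sup>2)" "(LINT s|lborel. (cmod (\<rho> s))\<^sup>2) < \<alpha> / 4"
      using shift[OF w] by (simp_all add: \<rho>_def)
    have tfs2: "integrable lborel (\<lambda>s. (cmod (time_frequency_shift w \<psi> s))\<^sup>2)"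
      using integrable_lborel_affine[OF p2, of 1 "- fst w"]
      by (simp add: time_frequency_shift_def norm_mult)
    have rbd: "cmod (\<rho> s) \<le> 2 * M" for s
    proof -
      have "cmod (\<rho> s) \<le> cmod (time_frequency_shift w \<psi> s) + cmod (\<psi> s)"
        unfolding \<rho>_def by (rule norm_triangle_ineq4)
      also have "\<dots> \<le> M + M"
        using bd[of s] bd[of "s - fst w"] by (intro add_mono) (auto simp: time_frequency_shift_def norm_mult)
      finally show ?thesis by simp
    qed
    have split: "stft f (time_frequency_shift w \<psi>) z = stft f \<rho> z + stft f \<psi> z" for z
    proof -
      have "integrable lborel (\<lambda>t. f t * cnj (\<rho> (t - fst z)) * cis (- (snd z \<bullet> t)))"
        "integrable lborel (\<lambda>t. f t * cnj (\<psi> (t - fst z)) * cis (- (snd z \<bullet> t)))"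
        using stft_integrable[OF f _ f2 r2(1)] stft_integrable[OF f _ f2 p2]
        by (auto intro!: integrable_mult_cis)
      from Bochner_Integration.integral_add[OF this] show ?thesis
        by (simp add: stft_def \<rho>_def algebra_simps)
    qed
    have pt: "F z \<le> 2 * F (z + w) + 2 * ennreal ((cmod (stft f \<rho> z))\<^sup>2)" for z
    proof -
      have "stft f \<psi> z = stft f (time_frequency_shift w \<psi>) z + - stft f \<rho> z" by (simp add: split)
      then have "(cmod (stft f \<psi> z))\<^sup>2 \<le> 2 * (cmod (stft f (time_frequency_shift w \<psi>) z))\<^sup>2 + 2 * (cmod (stft f \<rho> z))\<^sup>2"
        using norm_add_square_le[of "stft f (time_frequency_shift w \<psi>) z" "- stft f \<rho> z"] by simp
      also have "cmod (stft f (time_frequency_shift w \<psi>) z) = cmod (stft f \<psi> (z + w))"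
        by (simp add: stft_add norm_mult)
      finally have "F z \<le> ennreal (2 * (cmod (stft f \<psi> (z + w)))\<^sup>2 + 2 * (cmod (stft f \<rho> z))\<^sup>2)"
        unfolding F_def by (rule ennreal_leI)
      then show ?thesis by (simp add: F_def ennreal_mult')
    qed
    have "(\<integral>\<^sup>+z. indicator S (z + w) * F z \<partial>lborel) \<le>
        (\<integral>\<^sup>+z. 2 * (indicator S (z + w) * F (z + w)) + 2 * ennreal ((cmod (stft f \<rho> z))\<^sup>2) \<partial>lborel)"
      using pt by (intro nn_integral_mono) (auto simp: indicator_def)
    also have "\<dots> = 2 * (\<integral>\<^sup>+z. indicator S (z + w) * F (z + w) \<partial>lborel) +
        2 * (\<integral>\<^sup>+z. ennreal ((cmod (stft f \<rho> z))\<^sup>2) \<partial>lborel)"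
      by (subst nn_integral_add) (auto simp: nn_integral_cmult)
    also have "(\<integral>\<^sup>+z. indicator S (z + w) * F (z + w) \<partial>lborel) = IS"
      unfolding IS_def
      using nn_integral_lborel_affine[of "\<lambda>z. indicator S z * F z" 1 w] by (simp add: add.commute)
    also have "(\<integral>\<^sup>+z. ennreal ((cmod (stft f \<rho> z))\<^sup>2) \<partial>lborel) = ennreal ((LINT s|lborel. (cmod (\<rho> s))\<^sup>2) * N)"
      using moyal[OF f _ f2 r2(1) rbd] by (simp add: N_def mult_ac)
    also have "2 * ennreal ((LINT s|lborel. (cmod (\<rho> s))\<^sup>2) * N) \<le> ennreal (\<alpha> / 2 * N)"
    proof -
      have "2 * ((LINT s|lborel. (cmod (\<rho> s))\<^sup>2) * N) \<le> 2 * (\<alpha> / 4 * N)"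
        using r2(2) N0 by (intro mult_left_mono mult_right_mono) auto
      then have "ennreal (2 * ((LINT s|lborel. (cmod (\<rho> s))\<^sup>2) * N)) \<le> ennreal (\<alpha> / 2 * N)"
        by (intro ennreal_leI) (simp add: mult.commute)
      then show ?thesis by (simp add: ennreal_mult')
    qed
    finally show ?thesis by (simp add: add_left_mono)
  qed
  have "ennreal \<alpha> * ennreal b * ennreal N = (\<integral>\<^sup>+z. F z * (ennreal \<alpha> * ennreal b) \<partial>lborel)"
    by (subst nn_integral_multc) (auto simp: total mult_ac)
  \<comment> \<open>Thickness says that for each z the offsets w in the ball with z + w in S have
    measure at least \<alpha> b. Tonelli turns this into an average over w of the integrals bounded
    in \<open>single\<close>.\<close>
  also have "\<dots> \<le> (\<integral>\<^sup>+z. F z * (\<integral>\<^sup>+w. indicator (ball 0 \<delta>) w * indicator S (z + w) \<partial>lborel) \<partial>lborel)"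
  proof (intro nn_integral_mono mult_left_mono)
    fix z
    have "ennreal \<alpha> * ennreal b \<le> emeasure lborel (S \<inter> ball z \<delta>)" using thick by (simp add: b)
    also have "\<dots> = (\<integral>\<^sup>+v. indicator (S \<inter> ball z \<delta>) v \<partial>lborel)"
      by (rule nn_integral_indicator[symmetric]) simp
    also have "\<dots> = (\<integral>\<^sup>+v. indicator (ball z \<delta>) v * indicator S v \<partial>lborel)"
      by (intro nn_integral_cong) (auto simp: indicator_def)
    also have "\<dots> = (\<integral>\<^sup>+w. indicator (ball z \<delta>) (z + w) * indicator S (z + w) \<partial>lborel)"
    proof -
      have m: "(\<lambda>v. indicator (ball z \<delta>) v * indicator S v :: ennreal) \<in> borel_measurable borel"
        by (intro borel_measurable_times_ennreal borel_measurable_indicator) auto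
      show ?thesis using nn_integral_lborel_affine[OF m, of 1 z] by simp
    qed
    also have "\<dots> = (\<integral>\<^sup>+w. indicator (ball 0 \<delta>) w * indicator S (z + w) \<partial>lborel)"
      by (intro nn_integral_cong) (auto simp: indicator_def dist_norm)
    finally show "ennreal \<alpha> * ennreal b \<le> (\<integral>\<^sup>+w. indicator (ball 0 \<delta>) w * indicator S (z + w) \<partial>lborel)" .
  qed simp
  also have "\<dots> = (\<integral>\<^sup>+z. \<integral>\<^sup>+w. indicator (ball 0 \<delta>) w * (indicator S (z + w) * F z) \<partial>lborel \<partial>lborel)"
    by (intro nn_integral_cong, subst nn_integral_cmult[symmetric]) (auto simp: mult_ac)
  also have "\<dots> = (\<integral>\<^sup>+w. \<integral>\<^sup>+z. indicator (ball 0 \<delta>) w * (indicator S (z + w) * F z) \<partial>lborel \<partial>lborel)"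
    by (rule lborel_pair.Fubini') measurable
  also have "\<dots> = (\<integral>\<^sup>+w. indicator (ball 0 \<delta>) w * (\<integral>\<^sup>+z. indicator S (z + w) * F z \<partial>lborel) \<partial>lborel)"
    by (intro nn_integral_cong nn_integral_cmult) auto
  also have "\<dots> \<le> (\<integral>\<^sup>+w. (2 * IS + ennreal (\<alpha> / 2 * N)) * indicator (ball (0::'a \<times> 'a) \<delta>) w \<partial>lborel)"
    using single by (intro nn_integral_mono) (auto simp: indicator_def)
  also have "\<dots> = (2 * IS + ennreal (\<alpha> / 2 * N)) * ennreal b"
    by (subst nn_integral_cmult_indicator) (auto simp: b)
  finally have "ennreal b * ennreal (\<alpha> * N) \<le> ennreal b * (2 * IS + ennreal (\<alpha> / 2 * N))"
    using \<alpha> N0 by (simp add: ennreal_mult' mult_ac)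
  then have main: "ennreal (\<alpha> * N) \<le> 2 * IS + ennreal (\<alpha> / 2 * N)"
    using b0 by (subst (asm) ennreal_mult_le_mult_iff) auto
  show ?thesis
  \<comment> \<open>The error term, half of the left-hand side, can be subtracted only when
    \<open>IS\<close> is finite; what remains is \<alpha> / 4 times N.\<close>
  proof (cases "IS = \<infinity>")
    case True
    then show ?thesis by (simp add: IS_def F_def)
  next
    case False
    then obtain r where r: "IS = ennreal r" "0 \<le> r" by (cases IS) auto
    have "ennreal (\<alpha> * N) \<le> ennreal (2 * r + \<alpha> / 2 * N)"
      using main \<alpha> N0 r by (simp add: ennreal_mult')
    then have "\<alpha> * N \<le> 2 * r + \<alpha> / 2 * N"
      using \<alpha> N0 r by (subst (asm) ennreal_le_iff) auto
    then have "ennreal (\<alpha> / 4 * N) \<le> IS" unfolding r by (intro ennreal_leI) simp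
    then show ?thesis by (simp add: IS_def F_def N_def mult.assoc)
  qed
qed

section \<open>Decay of the short-time Fourier transform of a Schwartz function\<close>

lemma ball_measurable [measurable, simp]:
  "ball (c::'a::euclidean_space) r \<in> sets borel"
  "(indicator (ball c r) :: 'a \<Rightarrow> ennreal) \<in> borel_measurable borel"
  by (auto intro: borel_measurable_indicator)

text \<open>Replace 1 and every summand by their maximum, whose power occurs among the terms on the
  right. This turns bounds against single coordinate powers into bounds against powers of 1 +
  norm.\<close>

lemma power_one_plus_sum_le:
  fixes a :: "'i \<Rightarrow> real"
  assumes A: "finite A" and a: "\<And>i. i \<in> A \<Longrightarrow> 0 \<le> a i"
  shows "(1 + (\<Sum>i\<in>A. a i)) ^ k \<le> (real (card A) + 1) ^ k * (1 + (\<Sum>i\<in>A. a i ^ k))"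
proof -
  define M where "M = Max (insert 1 (a ` A))"
  have M: "1 \<le> M" "\<And>i. i \<in> A \<Longrightarrow> a i \<le> M" using A by (auto simp: M_def)
  have "1 + (\<Sum>i\<in>A. a i) \<le> (real (card A) + 1) * M"
    using M sum_bounded_above[of A a M] by (simp add: distrib_right)
  then have "(1 + (\<Sum>i\<in>A. a i)) ^ k \<le> ((real (card A) + 1) * M) ^ k"
    using a by (intro power_mono) (auto intro!: sum_nonneg add_nonneg_nonneg)
  moreover have "M ^ k \<le> 1 + (\<Sum>i\<in>A. a i ^ k)"
  proof -
    have "M \<in> insert 1 (a ` A)" unfolding M_def using A by (intro Max_in) auto
    then consider "M = 1" | i where "i \<in> A" "M = a i" by auto
    then show ?thesis
    proof cases
      case 1
      then show ?thesis using a by (simp add: sum_nonneg)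
    next
      case 2
      then have "a i ^ k \<le> (\<Sum>i\<in>A. a i ^ k)" using A a by (intro member_le_sum) auto
      then show ?thesis using 2 by simp
    qed
  qed
  ultimately show ?thesis
    by (smt (verit) mult_left_mono of_nat_0_le_iff power_mult_distrib zero_le_power)
qed

text \<open>The balls of radii \<open>s / \<theta>^k\<close> exhaust the space, and on the \<open>k\<close>-th shell the decaying factor
  is at most \<open>\<theta>^((k - 1) N)\<close>.\<close>

lemma nn_integral_decay_le:
  fixes w :: "'a::euclidean_space \<Rightarrow> ennreal"
  assumes [measurable]: "w \<in> borel_measurable borel"
    and \<theta>: "0 < \<theta>" "\<theta> < 1" and s: "0 < s" and A: "0 \<le> A" "\<theta> ^ N * A \<le> 1 / 2"
    and growth: "\<And>k. (\<integral>\<^sup>+z. w z * indicator (ball c (s / \<theta> ^ k)) z \<partial>lborel) \<le> ennreal (A ^ k) * W"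
  shows "(\<integral>\<^sup>+z. w z * ennreal (1 / (1 + norm (z - c) / s) ^ N) \<partial>lborel) \<le> ennreal (2 / \<theta> ^ N) * W"
proof -
  define q where "q k = (\<theta> ^ N) ^ k / \<theta> ^ N" for k :: nat
  have q0: "0 \<le> q k" for k using \<theta> by (simp add: q_def)
  have pt: "ennreal (1 / (1 + norm (z - c) / s) ^ N) \<le> (\<Sum>k. ennreal (q k) * indicator (ball c (s / \<theta> ^ k)) z)" for z
  proof -
    define r where "r = norm (z - c) / s"
    have r0: "0 \<le> r" using s by (simp add: r_def)
    have in_ball: "z \<in> ball c (s / \<theta> ^ k) \<longleftrightarrow> r < 1 / \<theta> ^ k" for k
      using s \<theta> by (simp add: r_def dist_norm norm_minus_commute field_simps)
    obtain m where "r < (1 / \<theta>) ^ m" using real_arch_pow[of "1 / \<theta>" r] \<theta> by auto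
    then have ex: "r < 1 / \<theta> ^ m" by (simp add: power_divide)
    \<comment> \<open>The first ball containing z. If k > 0, lying outside the preceding ball gives
      the decay \<open>q k\<close>; if k = 0, the bound q 0 \<ge> 1 covers the innermost
      ball.\<close>
    define k where "k = (LEAST k. r < 1 / \<theta> ^ k)"
    have k: "r < 1 / \<theta> ^ k" unfolding k_def using ex by (rule LeastI)
    have "1 / (1 + r) ^ N \<le> q k"
    proof (cases k)
      case 0
      have "1 / (1 + r) ^ N \<le> 1" using r0 by (simp add: divide_le_eq)
      also have "1 \<le> q 0" using \<theta> by (simp add: q_def power_le_one)
      finally show ?thesis using 0 by simp
    next
      case (Suc j)
      have "\<not> r < 1 / \<theta> ^ j" using not_less_Least[of j "\<lambda>k. r < 1 / \<theta> ^ k"] Suc by (simp add: k_def)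
      then have "1 / \<theta> ^ j \<le> 1 + r" by simp
      then have "(1 / \<theta> ^ j) ^ N \<le> (1 + r) ^ N" using \<theta> by (intro power_mono) auto
      then have "1 / (1 + r) ^ N \<le> 1 / (1 / \<theta> ^ j) ^ N" using \<theta> r0 by (intro divide_left_mono) auto
      also have "\<dots> = q k" using \<theta> Suc by (simp add: q_def power_divide power_mult[symmetric] mult.commute)
      finally show ?thesis .
    qed
    then have "ennreal (1 / (1 + r) ^ N) \<le> ennreal (q k) * indicator (ball c (s / \<theta> ^ k)) z"
      using in_ball k by (simp add: ennreal_leI)
    moreover define b where "b j = ennreal (q j) * indicator (ball c (s / \<theta> ^ j)) z" for j
    ultimately have "ennreal (1 / (1 + r) ^ N) \<le> b k" by simp
    also have "b k \<le> (\<Sum>j. b j)" using sum_le_suminf[of b "{k}"] by simp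
    finally show ?thesis by (simp add: r_def b_def)
  qed
  have "(\<integral>\<^sup>+z. w z * ennreal (1 / (1 + norm (z - c) / s) ^ N) \<partial>lborel) \<le>
      (\<integral>\<^sup>+z. (\<Sum>k. ennreal (q k) * (w z * indicator (ball c (s / \<theta> ^ k)) z)) \<partial>lborel)"
  proof (rule nn_integral_mono)
    fix z
    have "w z * ennreal (1 / (1 + norm (z - c) / s) ^ N) \<le> w z * (\<Sum>k. ennreal (q k) * indicator (ball c (s / \<theta> ^ k)) z)"
      using pt by (rule mult_left_mono) simp
    also have "\<dots> = (\<Sum>k. w z * (ennreal (q k) * indicator (ball c (s / \<theta> ^ k)) z))"
      by (rule ennreal_suminf_cmult[symmetric])
    finally show "w z * ennreal (1 / (1 + norm (z - c) / s) ^ N) \<le>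
        (\<Sum>k. ennreal (q k) * (w z * indicator (ball c (s / \<theta> ^ k)) z))"
      by (simp only: mult.left_commute)
  qed
  also have "\<dots> = (\<Sum>k. \<integral>\<^sup>+z. ennreal (q k) * (w z * indicator (ball c (s / \<theta> ^ k)) z) \<partial>lborel)"
    by (rule nn_integral_suminf) measurable
  also have "\<dots> = (\<Sum>k. ennreal (q k) * (\<integral>\<^sup>+z. w z * indicator (ball c (s / \<theta> ^ k)) z \<partial>lborel))"
    by (intro suminf_cong nn_integral_cmult) measurable
  also have "\<dots> \<le> (\<Sum>k. ennreal ((1/2) ^ k) * (ennreal (1 / \<theta> ^ N) * W))"
  proof (intro suminf_le)
    fix k
    have "ennreal (q k) * (\<integral>\<^sup>+z. w z * indicator (ball c (s / \<theta> ^ k)) z \<partial>lborel) \<le> ennreal (q k) * (ennreal (A ^ k) * W)"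
      using growth by (rule mult_left_mono) simp
    also have "\<dots> = ennreal (q k * A ^ k) * W" using q0 A by (simp add: ennreal_mult' mult.assoc)
    also have "q k * A ^ k = (\<theta> ^ N * A) ^ k / \<theta> ^ N" by (simp add: q_def power_mult_distrib)
    also have "ennreal ((\<theta> ^ N * A) ^ k / \<theta> ^ N) * W \<le> ennreal ((1/2) ^ k * (1 / \<theta> ^ N)) * W"
    proof (intro mult_right_mono ennreal_leI)
      have "(\<theta> ^ N * A) ^ k \<le> (1 / 2) ^ k" using A \<theta> by (intro power_mono) auto
      then have "(\<theta> ^ N * A) ^ k / \<theta> ^ N \<le> (1 / 2) ^ k / \<theta> ^ N"
        using \<theta> by (intro divide_right_mono) auto
      then show "(\<theta> ^ N * A) ^ k / \<theta> ^ N \<le> (1 / 2) ^ k * (1 / \<theta> ^ N)" by simp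
    qed simp
    also have "\<dots> = ennreal ((1/2) ^ k) * (ennreal (1 / \<theta> ^ N) * W)"
      by (subst ennreal_mult') (auto simp: mult.assoc)
    finally show "ennreal (q k) * (\<integral>\<^sup>+z. w z * indicator (ball c (s / \<theta> ^ k)) z \<partial>lborel) \<le>
      ennreal ((1/2) ^ k) * (ennreal (1 / \<theta> ^ N) * W)" .
  qed auto
  also have "\<dots> = (\<Sum>k. ennreal ((1/2) ^ k)) * (ennreal (1 / \<theta> ^ N) * W)"
    by (rule ennreal_suminf_multc)
  also have "(\<Sum>k. ennreal ((1/2) ^ k)) = ennreal (\<Sum>k. (1/2) ^ k)"
    by (intro suminf_ennreal2) (auto intro: summable_geometric)
  also have "(\<Sum>k. (1/2::real) ^ k) = 2" by (subst suminf_geometric) auto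
  also have "ennreal 2 * (ennreal (1 / \<theta> ^ N) * W) = ennreal (2 / \<theta> ^ N) * W"
  proof -
    have "ennreal (2 / \<theta> ^ N) = ennreal 2 * ennreal (1 / \<theta> ^ N)"
      by (subst ennreal_mult[symmetric]) (use \<theta> in auto)
    then show ?thesis by (simp only: mult.assoc)
  qed
  finally show ?thesis .
qed

section \<open>An integrable polynomial majorant and integrals of derivatives\<close>

definition tail_weight :: "'a::euclidean_space \<Rightarrow> real" where
  "tail_weight x = 1 / (1 + norm x) ^ Suc DIM('a)"

lemma tail_weight_pos: "0 < tail_weight x"
  by (simp add: tail_weight_def add_pos_nonneg)

lemma tail_weight_nonneg [simp]: "0 \<le> tail_weight x"
  using tail_weight_pos[of x] by simp

text \<open>\<open>nn_integral_decay_le\<close> for the weight 1 and ratio 1/2: doubling a radius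
  multiplies volume by \<open>2 ^ DIM('a)\<close>, and one further power of decay brings the product
  to exactly 1/2.\<close>

lemma tail_weight_integrable: "integrable lborel (tail_weight :: 'a::euclidean_space \<Rightarrow> real)"
proof (rule integrableI_bounded)
  show "(tail_weight :: 'a \<Rightarrow> real) \<in> borel_measurable lborel" unfolding tail_weight_def by measurable
  have "(\<integral>\<^sup>+z. 1 * ennreal (1 / (1 + norm (z - (0::'a)) / 1) ^ Suc DIM('a)) \<partial>lborel) \<le>
      ennreal (2 / (1 / 2) ^ Suc DIM('a)) * emeasure lborel (ball (0::'a) 1)"
  proof (rule nn_integral_decay_le[where A="2 ^ DIM('a)" and w="\<lambda>_. 1" and \<theta>="1/2" and c="0::'a" and s=1])
    fix k :: nat
    have "(\<integral>\<^sup>+z. 1 * indicator (ball (0::'a) (1 / (1 / 2) ^ k)) z \<partial>lborel) = emeasure lborel (ball (0::'a) (2 ^ k))"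
      by (simp add: power_one_over)
    also have "\<dots> = ennreal ((2 ^ k) ^ DIM('a)) * emeasure lborel (ball (0::'a) 1)"
    proof -
      have "emeasure lborel (ball (0::'a) (2 ^ k)) = (\<integral>\<^sup>+x. indicator (ball (0::'a) (2 ^ k)) x \<partial>lborel)" by simp
      also have "\<dots> = ennreal (\<bar>2 ^ k\<bar> ^ DIM('a)) * (\<integral>\<^sup>+x. indicator (ball (0::'a) (2 ^ k)) (0 + (2 ^ k) *\<^sub>R x) \<partial>lborel)"
        by (rule nn_integral_lborel_affine) auto
      also have "(\<integral>\<^sup>+x. indicator (ball (0::'a) (2 ^ k)) (0 + (2 ^ k) *\<^sub>R x) \<partial>lborel) = (\<integral>\<^sup>+x. indicator (ball (0::'a) 1) x \<partial>lborel)"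
        by (intro nn_integral_cong) (auto simp: indicator_def)
      finally show ?thesis by simp
    qed
    also have "((2::real) ^ k) ^ DIM('a) = (2 ^ DIM('a)) ^ k" by (simp add: power_mult[symmetric] mult.commute)
    finally show "(\<integral>\<^sup>+z. 1 * indicator (ball (0::'a) (1 / (1 / 2) ^ k)) z \<partial>lborel) \<le>
        ennreal ((2 ^ DIM('a)) ^ k) * emeasure lborel (ball (0::'a) 1)" by simp
  qed (auto simp: power_one_over)
  also have "\<dots> < \<infinity>"
    using emeasure_bounded_finite[of "ball (0::'a) 1"] by (auto simp: ennreal_mult_less_top)
  finally show "(\<integral>\<^sup>+z. ennreal (norm (tail_weight (z::'a))) \<partial>lborel) < \<infinity>"
    by (simp add: tail_weight_def)
qed

text \<open>Since 1 + |x| is at most twice 1 + |x + e| for |e| \<le> 1, one majorant serves all the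
  difference quotients with steps up to 1.\<close>

lemma tail_weight_shift_le:
  fixes x e :: "'a::euclidean_space"
  assumes "norm e \<le> 1"
  shows "tail_weight (x + e) \<le> 2 ^ Suc DIM('a) * tail_weight x"
proof -
  have "norm x \<le> norm (x + e) + norm e" using norm_triangle_ineq4[of "x + e" e] by simp
  then have "1 + norm x \<le> 2 * (1 + norm (x + e))" using assms norm_ge_zero[of "x + e"] by argo
  then have "(1 + norm x) ^ Suc DIM('a) \<le> (2 * (1 + norm (x + e))) ^ Suc DIM('a)" by (intro power_mono) auto
  then have "(1 + norm x) ^ Suc DIM('a) \<le> 2 ^ Suc DIM('a) * (1 + norm (x + e)) ^ Suc DIM('a)"
    by (simp only: power_mult_distrib)
  moreover have "0 < (1 + norm x) ^ Suc DIM('a)" "0 < (1 + norm (x + e)) ^ Suc DIM('a)"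
    by (auto intro!: zero_less_power add_pos_nonneg simp del: power_Suc)
  ultimately show ?thesis unfolding tail_weight_def by (simp add: field_simps del: power_Suc)
qed

text \<open>Difference quotients of G integrate to 0 by translation invariance and converge
  pointwise to G'. The mean value inequality along the segment bounds them by a multiple of
  \<open>tail_weight\<close>, so the limit may be taken under the integral.\<close>

lemma integral_directional_derivative_zero:
  fixes G G' :: "'a::euclidean_space \<Rightarrow> complex"
  assumes [measurable]: "G \<in> borel_measurable borel" "G' \<in> borel_measurable borel"
    and der: "\<And>x s. ((\<lambda>s. G (x + s *\<^sub>R e)) has_vector_derivative G' (x + s *\<^sub>R e)) (at s)"
    and G: "\<And>x. cmod (G x) \<le> C * tail_weight x" and G': "\<And>x. cmod (G' x) \<le> C * tail_weight x"
    and e: "norm e \<le> 1"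
  shows "(CLINT x|lborel. G' x) = 0"
proof -
  define \<epsilon> where "\<epsilon> k = 1 / real (Suc k)" for k
  have \<epsilon>: "0 < \<epsilon> k" "\<epsilon> k \<le> 1" for k by (auto simp: \<epsilon>_def)
  have \<epsilon>lim: "\<epsilon> \<longlonglongrightarrow> 0" unfolding \<epsilon>_def using LIMSEQ_inverse_real_of_nat by (simp add: inverse_eq_divide)
  define D where "D k x = (1 / \<epsilon> k) *\<^sub>R (G (x + \<epsilon> k *\<^sub>R e) - G x)" for k x
  have C0: "0 \<le> C"
  proof -
    have "0 \<le> C * tail_weight (0::'a)" using order_trans[OF norm_ge_zero G] .
    then show ?thesis using tail_weight_pos[of "0::'a"] by (simp add: zero_le_mult_iff)
  qed
  have Gi: "integrable lborel G"
  proof (rule Bochner_Integration.integrable_bound)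
    show "integrable lborel (\<lambda>x::'a. C * tail_weight x)" by (simp add: tail_weight_integrable)
    show "AE x in lborel. norm (G x) \<le> norm (C * tail_weight x)"
      using order_trans[OF G abs_ge_self] by (intro AE_I2) simp
  qed measurable
  have D0: "(CLINT x|lborel. D k x) = 0" for k
  proof -
    have t: "integrable lborel (\<lambda>x. G (x + \<epsilon> k *\<^sub>R e))"
      using integrable_lborel_affine[OF Gi, of 1 "\<epsilon> k *\<^sub>R e"] by (simp add: add.commute)
    have "(CLINT x|lborel. G (x + \<epsilon> k *\<^sub>R e)) = (CLINT x|lborel. G x)"
      using integral_lborel_affine[of G 1 "\<epsilon> k *\<^sub>R e"] by (simp add: add.commute)
    then show ?thesis unfolding D_def using Gi t by simp
  qed
  have "(\<lambda>k. CLINT x|lborel. D k x) \<longlonglongrightarrow> (CLINT x|lborel. G' x)"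
  proof (rule integral_dominated_convergence[where w="\<lambda>x. C * (2 ^ Suc DIM('a) * tail_weight x)"])
    show "integrable lborel (\<lambda>x::'a. C * (2 ^ Suc DIM('a) * tail_weight x))" by (simp add: tail_weight_integrable)
    show "AE x in lborel. (\<lambda>k. D k x) \<longlonglongrightarrow> G' x"
    proof (rule AE_I2)
      fix x
      have "((\<lambda>s. G (x + s *\<^sub>R e)) has_vector_derivative G' x) (at 0)" using der[of x 0] by simp
      then have "((\<lambda>h. norm (G (x + h *\<^sub>R e) - G x - h *\<^sub>R G' x) / norm h) \<longlongrightarrow> 0) (at 0)"
        by (simp add: has_vector_derivative_def has_derivative_at)
      moreover have "filterlim \<epsilon> (at 0) sequentially"
        using \<epsilon>lim \<epsilon>(1) by (simp add: filterlim_at less_imp_neq[symmetric])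
      ultimately have "(\<lambda>k. norm (G (x + \<epsilon> k *\<^sub>R e) - G x - \<epsilon> k *\<^sub>R G' x) / norm (\<epsilon> k)) \<longlonglongrightarrow> 0"
        by (rule filterlim_compose)
      moreover have "norm (G (x + \<epsilon> k *\<^sub>R e) - G x - \<epsilon> k *\<^sub>R G' x) / norm (\<epsilon> k) = norm (D k x - G' x)" for k
      proof -
        have "D k x - G' x = (1 / \<epsilon> k) *\<^sub>R (G (x + \<epsilon> k *\<^sub>R e) - G x - \<epsilon> k *\<^sub>R G' x)"
          using \<epsilon>(1)[of k] by (simp add: D_def scaleR_diff_right)
        then show ?thesis using \<epsilon>(1)[of k] by simp
      qed
      ultimately show "(\<lambda>k. D k x) \<longlonglongrightarrow> G' x"
        using LIM_zero_cancel tendsto_norm_zero_iff by force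
    qed
    show "AE x in lborel. norm (D k x) \<le> C * (2 ^ Suc DIM('a) * tail_weight x)" for k
    proof (rule AE_I2)
      fix x
      have "norm (G (x + \<epsilon> k *\<^sub>R e) - G (x + 0 *\<^sub>R e)) \<le> (C * (2 ^ Suc DIM('a) * tail_weight x)) * norm (\<epsilon> k - 0)"
      proof (rule differentiable_bound[where S="{0..1}" and f="\<lambda>s. G (x + s *\<^sub>R e)" and f'="\<lambda>s h. h *\<^sub>R G' (x + s *\<^sub>R e)"])
        fix s :: real assume s: "s \<in> {0..1}"
        show "((\<lambda>s. G (x + s *\<^sub>R e)) has_derivative (\<lambda>h. h *\<^sub>R G' (x + s *\<^sub>R e))) (at s within {0..1})"
          using der[of x s] by (auto simp: has_vector_derivative_def intro: has_derivative_at_withinI)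
        have "norm (s *\<^sub>R e) \<le> 1" using s e by (simp add: mult_le_one)
        then have "cmod (G' (x + s *\<^sub>R e)) \<le> C * (2 ^ Suc DIM('a) * tail_weight x)"
          using G'[of "x + s *\<^sub>R e"] mult_left_mono[OF tail_weight_shift_le C0] order_trans by blast
        then show "onorm (\<lambda>h. h *\<^sub>R G' (x + s *\<^sub>R e)) \<le> C * (2 ^ Suc DIM('a) * tail_weight x)"
          by (intro onorm_le) (simp add: mult.commute[of "\<bar>_\<bar>"] mult_right_mono)
      qed (use \<epsilon>[of k] in auto)
      then have "(1 / \<epsilon> k) * norm (G (x + \<epsilon> k *\<^sub>R e) - G x) \<le>
          (1 / \<epsilon> k) * ((C * (2 ^ Suc DIM('a) * tail_weight x)) * \<epsilon> k)"
        using \<epsilon>[of k] by (intro mult_left_mono) auto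
      moreover have "norm (D k x) = (1 / \<epsilon> k) * norm (G (x + \<epsilon> k *\<^sub>R e) - G x)"
        unfolding D_def norm_scaleR using \<epsilon>[of k] by simp
      ultimately show "norm (D k x) \<le> C * (2 ^ Suc DIM('a) * tail_weight x)"
        using \<epsilon>(1)[of k] by simp
    qed
  qed (auto simp: D_def)
  then show ?thesis by (simp add: D0 LIMSEQ_const_iff)
qed

section \<open>Schwartz functions and the time-frequency decay of their transforms\<close>

context
  fixes \<phi> :: "real^'n \<Rightarrow> complex"
  assumes schwartz: "schwartz \<phi>"
begin

lemma schwartz_partial_differentiable: "partial_derivs is \<phi> differentiable (at x)"
  using schwartz by (simp add: schwartz_def)

lemma schwartz_partial_continuous: "continuous_on UNIV (partial_derivs is \<phi>)"
  by (intro continuous_at_imp_continuous_on ballI differentiable_imp_continuous_within schwartz_partial_differentiable)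

lemma schwartz_partial_measurable [measurable]: "partial_derivs is \<phi> \<in> borel_measurable borel"
  by (rule borel_measurable_continuous_onI[OF schwartz_partial_continuous])

text \<open>Only the monomials 1 and the k-th powers of single coordinates are used;
  \<open>power_one_plus_sum_le\<close> assembles them after bounding the Euclidean norm by the sum
  of coordinates.\<close>

lemma schwartz_partial_decay: "\<exists>C\<ge>0. \<forall>x. (1 + norm x) ^ k * cmod (partial_derivs is \<phi> x) \<le> C"
proof -
  have bound: "\<exists>C. \<forall>x. cmod ((\<Prod>i\<in>UNIV. (x $ i) ^ m i) *\<^sub>R partial_derivs is \<phi> x) \<le> C" for m :: "'n \<Rightarrow> nat"
    using schwartz by (simp add: schwartz_def)
  have "\<exists>C. \<forall>x. \<bar>x $ i\<bar> ^ k * cmod (partial_derivs is \<phi> x) \<le> C" for i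
  proof -
    obtain C where C: "\<And>x. cmod ((\<Prod>j\<in>UNIV. (x $ j) ^ (if j = i then k else 0)) *\<^sub>R partial_derivs is \<phi> x) \<le> C"
      using bound[of "\<lambda>j. if j = i then k else 0"] by blast
    have "(\<Prod>j\<in>UNIV. (x $ j) ^ (if j = i then k else 0)) = (x $ i) ^ k" for x :: "real^'n"
    proof -
      have "(\<Prod>j\<in>UNIV. (x $ j) ^ (if j = i then k else 0)) = (\<Prod>j\<in>UNIV. if j = i then (x $ j) ^ k else 1)"
        by (intro prod.cong) auto
      then show ?thesis by (simp add: prod.delta)
    qed
    then show ?thesis using C by (auto simp: power_abs)
  qed
  then obtain B where B: "\<And>i x. \<bar>x $ i\<bar> ^ k * cmod (partial_derivs is \<phi> x) \<le> B i" by metis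
  obtain B0 where B0: "\<And>x. cmod ((\<Prod>j\<in>UNIV. (x $ j) ^ 0) *\<^sub>R partial_derivs is \<phi> x) \<le> B0"
    using bound[of "\<lambda>_. 0"] by blast
  define c where "c = (real CARD('n) + 1) ^ k"
  have c: "0 \<le> c" by (simp add: c_def)
  have le: "(1 + norm x) ^ k * cmod (partial_derivs is \<phi> x) \<le> c * (B0 + (\<Sum>i\<in>UNIV. B i))" for x
  proof -
    have "(1 + norm x) ^ k \<le> (1 + (\<Sum>i\<in>UNIV. \<bar>x $ i\<bar>)) ^ k"
      by (intro power_mono add_left_mono norm_le_l1_cart) auto
    also have "\<dots> \<le> c * (1 + (\<Sum>i\<in>UNIV. \<bar>x $ i\<bar> ^ k))"
      unfolding c_def by (rule power_one_plus_sum_le) auto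
    finally have "(1 + norm x) ^ k * cmod (partial_derivs is \<phi> x) \<le>
        (c * (1 + (\<Sum>i\<in>UNIV. \<bar>x $ i\<bar> ^ k))) * cmod (partial_derivs is \<phi> x)"
      by (rule mult_right_mono) simp
    also have "\<dots> = c * (cmod (partial_derivs is \<phi> x) + (\<Sum>i\<in>UNIV. \<bar>x $ i\<bar> ^ k * cmod (partial_derivs is \<phi> x)))"
      by (simp add: distrib_left distrib_right sum_distrib_right sum_distrib_left mult.assoc)
    also have "\<dots> \<le> c * (B0 + (\<Sum>i\<in>UNIV. B i))"
      using B0[of x] B by (intro mult_left_mono add_mono sum_mono c) auto
    finally show ?thesis .
  qed
  moreover have "0 \<le> c * (B0 + (\<Sum>i\<in>UNIV. B i))"
    using order_trans[OF _ le[of 0]] by simp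
  ultimately show ?thesis by blast
qed

lemma schwartz_partial_tail_weight: "\<exists>C\<ge>0. \<forall>x. cmod (partial_derivs is \<phi> x) \<le> C * tail_weight x"
proof -
  obtain C where C: "0 \<le> C" "\<And>x. (1 + norm x) ^ Suc DIM(real^'n) * cmod (partial_derivs is \<phi> x) \<le> C"
    using schwartz_partial_decay by blast
  have "cmod (partial_derivs is \<phi> x) \<le> C * tail_weight x" for x
  proof -
    have "0 < (1 + norm x) ^ Suc DIM(real^'n)" by (intro zero_less_power add_pos_nonneg) auto
    then show ?thesis using C(2)[of x] unfolding tail_weight_def by (simp add: field_simps del: power_Suc)
  qed
  then show ?thesis using C by blast
qed

lemma schwartz_partial_bounded: "\<exists>C. \<forall>x. cmod (partial_derivs is \<phi> x) \<le> C"
  using schwartz_partial_decay[of 0] by auto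

lemma schwartz_partial_square_integrable: "integrable lborel (\<lambda>x. (cmod (partial_derivs is \<phi> x))\<^sup>2)"
proof -
  obtain C where C: "0 \<le> C" "\<And>x. cmod (partial_derivs is \<phi> x) \<le> C * tail_weight x" using schwartz_partial_tail_weight by blast
  obtain M where M: "\<And>x. cmod (partial_derivs is \<phi> x) \<le> M" using schwartz_partial_bounded by blast
  show ?thesis
  proof (rule Bochner_Integration.integrable_bound)
    show "integrable lborel (\<lambda>x::real^'n. C * tail_weight x * M)" by (simp add: tail_weight_integrable)
    show "AE x in lborel. norm ((cmod (partial_derivs is \<phi> x))\<^sup>2) \<le> norm (C * tail_weight x * M)"
    proof (rule AE_I2)
      fix x
      have "cmod (partial_derivs is \<phi> x) * cmod (partial_derivs is \<phi> x) \<le> (C * tail_weight x) * M"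
        using C M tail_weight_pos[of x] by (intro mult_mono) (auto simp: less_imp_le)
      then show "norm ((cmod (partial_derivs is \<phi> x))\<^sup>2) \<le> norm (C * tail_weight x * M)"
        by (simp add: power2_eq_square)
    qed
  qed measurable
qed

lemma schwartz_partial_line_derivative:
  "((\<lambda>s. partial_derivs is \<phi> (x + s *\<^sub>R axis i 1)) has_vector_derivative
     partial_derivs (i # is) \<phi> (x + s *\<^sub>R axis i 1)) (at s)"
proof -
  let ?f = "partial_derivs is \<phi>" and ?y = "x + s *\<^sub>R axis i 1"
  have d: "(?f has_derivative frechet_derivative ?f (at ?y)) (at ?y)"
    using schwartz_partial_differentiable frechet_derivative_works by blast
  then have lin: "linear (frechet_derivative ?f (at ?y))" by (rule has_derivative_linear)
  have "((\<lambda>s. x + s *\<^sub>R axis i 1) has_derivative (\<lambda>h. h *\<^sub>R axis i (1::real))) (at s)"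
    by (auto intro!: derivative_eq_intros)
  from has_derivative_compose[OF this d] show ?thesis
    by (simp add: has_vector_derivative_def linear_scale[OF lin])
qed

text \<open>The i-th derivative of the integrand has integral 0, and its three product-rule terms
  are the three transforms. Arbitrary derivative lists on both arguments are allowed so that the
  identity can be iterated.\<close>

lemma schwartz_stft_integration_by_parts:
  "\<i> * complex_of_real (snd z $ i) * stft (partial_derivs is \<phi>) (partial_derivs js \<phi>) z =
    stft (partial_derivs (i # is) \<phi>) (partial_derivs js \<phi>) z +
    stft (partial_derivs is \<phi>) (partial_derivs (i # js) \<phi>) z"
proof -
  let ?f = "partial_derivs is \<phi>" and ?g = "partial_derivs js \<phi>"
  let ?f' = "partial_derivs (i # is) \<phi>" and ?g' = "partial_derivs (i # js) \<phi>"
  let ?e = "axis i (1::real)"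
  obtain x \<omega> where z: "z = (x, \<omega>)" by (cases z)
  have [measurable]: "?f' \<in> borel_measurable borel" "?g' \<in> borel_measurable borel"
    by (rule schwartz_partial_measurable)+
  define G where "G t = ?f t * cnj (?g (t - x)) * cis (- (\<omega> \<bullet> t))" for t
  define G1 where "G1 t = ?f' t * cnj (?g (t - x)) * cis (- (\<omega> \<bullet> t))" for t
  define G2 where "G2 t = ?f t * cnj (?g' (t - x)) * cis (- (\<omega> \<bullet> t))" for t
  define G' where "G' t = G1 t + G2 t - \<i> * complex_of_real (\<omega> $ i) * G t" for t
  have [measurable]: "G \<in> borel_measurable borel" "G1 \<in> borel_measurable borel" "G2 \<in> borel_measurable borel"
    "G' \<in> borel_measurable borel"
    unfolding G_def G1_def G2_def G'_def by measurable
  obtain C1 where C1: "0 \<le> C1" "\<And>x. cmod (?f x) \<le> C1 * tail_weight x" using schwartz_partial_tail_weight by blast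
  obtain C2 where C2: "0 \<le> C2" "\<And>x. cmod (?f' x) \<le> C2 * tail_weight x" using schwartz_partial_tail_weight by blast
  obtain M1 where M1: "\<And>x. cmod (?g x) \<le> M1" using schwartz_partial_bounded by blast
  obtain M2 where M2: "\<And>x. cmod (?g' x) \<le> M2" using schwartz_partial_bounded by blast
  have M0: "0 \<le> M1" "0 \<le> M2" using order_trans[OF norm_ge_zero M1] order_trans[OF norm_ge_zero M2] by blast+
  have prod_le: "cmod (a * cnj b * cis r) \<le> (C * j) * M" if "cmod a \<le> C * j" "cmod b \<le> M" "0 \<le> C * j"
    for a b r C j M
    using mult_mono[OF that(1,2,3)] by (simp add: norm_mult)
  have j0: "0 \<le> tail_weight (t::real^'n)" for t using tail_weight_pos[of t] by simp
  have bG: "cmod (G t) \<le> C1 * tail_weight t * M1" for t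
    unfolding G_def using C1 M1 j0 by (intro prod_le) auto
  have bG1: "cmod (G1 t) \<le> C2 * tail_weight t * M1" for t
    unfolding G1_def using C2 M1 j0 by (intro prod_le) auto
  have bG2: "cmod (G2 t) \<le> C1 * tail_weight t * M2" for t
    unfolding G2_def using C1 M2 j0 by (intro prod_le) auto
  define C where "C = C1 * M1 + C2 * M1 + C1 * M2 + \<bar>\<omega> $ i\<bar> * (C1 * M1)"
  have "(CLINT t|lborel. G' t) = 0"
  proof (rule integral_directional_derivative_zero[where G=G and C=C and e="?e"])
    fix t s
    let ?y = "t + s *\<^sub>R ?e"
    have 1: "((\<lambda>s. ?f (t + s *\<^sub>R ?e)) has_vector_derivative ?f' ?y) (at s)"
      by (rule schwartz_partial_line_derivative)
    have 2: "((\<lambda>s. cnj (?g (t + s *\<^sub>R ?e - x))) has_vector_derivative cnj (?g' (?y - x))) (at s)"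
      using has_vector_derivative_cnj[OF schwartz_partial_line_derivative[of js "t - x" i s]]
      by (simp add: algebra_simps)
    have 3: "((\<lambda>s. cis (- (\<omega> \<bullet> (t + s *\<^sub>R ?e)))) has_vector_derivative (- \<i> * (\<omega> $ i)) * cis (- (\<omega> \<bullet> ?y))) (at s)"
    proof -
      have "((\<lambda>s. - (\<omega> \<bullet> (t + s *\<^sub>R ?e))) has_real_derivative - (\<omega> $ i)) (at s)"
        by (auto intro!: derivative_eq_intros simp: inner_axis inner_add_right)
      then have "((\<lambda>s. cis (- (\<omega> \<bullet> (t + s *\<^sub>R ?e)))) has_derivative
          (\<lambda>h. ((- (\<omega> $ i)) * h) *\<^sub>R (\<i> * cis (- (\<omega> \<bullet> ?y))))) (at s)"
        unfolding has_field_derivative_def by (rule has_derivative_cis)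
      then show ?thesis by (simp add: has_vector_derivative_def scaleR_conv_of_real mult_ac)
    qed
    have "((\<lambda>s. G (t + s *\<^sub>R ?e)) has_vector_derivative
        (?f ?y * cnj (?g (?y - x))) * ((- \<i> * (\<omega> $ i)) * cis (- (\<omega> \<bullet> ?y))) +
        (?f ?y * cnj (?g' (?y - x)) + ?f' ?y * cnj (?g (?y - x))) * cis (- (\<omega> \<bullet> ?y))) (at s)"
      unfolding G_def by (intro has_vector_derivative_mult 1 2 3)
    moreover have "(?f ?y * cnj (?g (?y - x))) * ((- \<i> * (\<omega> $ i)) * cis (- (\<omega> \<bullet> ?y))) +
        (?f ?y * cnj (?g' (?y - x)) + ?f' ?y * cnj (?g (?y - x))) * cis (- (\<omega> \<bullet> ?y)) = G' ?y"
    proof -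
      have "A * ((- \<i> * w) * c) + (B + D) * c = D * c + B * c - \<i> * w * (A * c)" for A B D c w :: complex
        by (simp add: algebra_simps)
      then show ?thesis unfolding G'_def G1_def G2_def G_def .
    qed
    ultimately show "((\<lambda>s. G (t + s *\<^sub>R ?e)) has_vector_derivative G' ?y) (at s)" by simp
  next
    fix t :: "real^'n"
    have nn: "0 \<le> C1 * M1" "0 \<le> C2 * M1" "0 \<le> C1 * M2" using C1(1) C2(1) M0 by auto
    have "C1 * tail_weight t * M1 = (C1 * M1) * tail_weight t" by simp
    also have "\<dots> \<le> C * tail_weight t" using nn j0 by (intro mult_right_mono) (auto simp: C_def)
    finally show "cmod (G t) \<le> C * tail_weight t" using bG[of t] by simp
    have "cmod (G' t) \<le> cmod (G1 t) + cmod (G2 t) + \<bar>\<omega> $ i\<bar> * cmod (G t)"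
      unfolding G'_def
      by (intro order_trans[OF norm_triangle_ineq4] add_mono norm_triangle_ineq) (simp add: norm_mult)
    also have "\<dots> \<le> C2 * tail_weight t * M1 + C1 * tail_weight t * M2 + \<bar>\<omega> $ i\<bar> * (C1 * tail_weight t * M1)"
      by (intro add_mono mult_left_mono bG bG1 bG2) auto
    also have "\<dots> = (C2 * M1 + C1 * M2 + \<bar>\<omega> $ i\<bar> * (C1 * M1)) * tail_weight t" by (simp add: algebra_simps)
    also have "\<dots> \<le> C * tail_weight t" using nn j0 by (intro mult_right_mono) (auto simp: C_def)
    finally show "cmod (G' t) \<le> C * tail_weight t" .
  qed (simp_all add: norm_axis_1)
  moreover have "integrable lborel G" "integrable lborel G1" "integrable lborel G2"
    unfolding G_def G1_def G2_def
    by (intro integrable_mult_cis stft_integrable schwartz_partial_measurable schwartz_partial_square_integrable)+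
  ultimately have "(CLINT t|lborel. G1 t) + (CLINT t|lborel. G2 t) - \<i> * complex_of_real (\<omega> $ i) * (CLINT t|lborel. G t) = 0"
    unfolding G'_def by simp
  then show ?thesis unfolding z stft_def G_def G1_def G2_def by simp
qed

text \<open>Each power of the frequency is paid for by one integration by parts, hence the induction
  over k for all derivative lists at once. In the base case 1 + |x| \<le> (1 + |t|) (1 + |t - x|)
  distributes the weight in x over the two functions.\<close>

lemma schwartz_stft_decay_aux:
  "\<exists>C\<ge>0. \<forall>x \<omega>. \<bar>\<omega> $ i\<bar> ^ k * ((1 + norm x) ^ N * cmod (stft (partial_derivs is \<phi>) (partial_derivs js \<phi>) (x, \<omega>))) \<le> C"
proof (induction k arbitrary: "is" js)
  case 0
  let ?f = "partial_derivs is \<phi>" and ?g = "partial_derivs js \<phi>"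
  \<comment> \<open>The surplus of DIM + 1 powers leaves \<open>tail_weight\<close> as an integrable
    majorant in t after N powers are spent on x.\<close>
  obtain C1 where C1: "0 \<le> C1" "\<And>x. (1 + norm x) ^ (N + Suc DIM(real^'n)) * cmod (?f x) \<le> C1"
    using schwartz_partial_decay by blast
  obtain C2 where C2: "0 \<le> C2" "\<And>x. (1 + norm x) ^ N * cmod (?g x) \<le> C2"
    using schwartz_partial_decay by blast
  have "(1 + norm x) ^ N * cmod (stft ?f ?g (x, \<omega>)) \<le> C1 * C2 * (LINT t|lborel. tail_weight (t::real^'n))" for x \<omega>
  proof -
    let ?h = "\<lambda>t. ?f t * cnj (?g (t - x)) * cis (- (\<omega> \<bullet> t))"
    have hi: "integrable lborel ?h"
      by (intro integrable_mult_cis stft_integrable schwartz_partial_measurable schwartz_partial_square_integrable)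
    have pt: "(1 + norm x) ^ N * cmod (?h t) \<le> C1 * C2 * tail_weight t" for t
    proof -
      have "norm x \<le> norm t + norm (t - x)" using norm_triangle_ineq4[of t "t - x"] by simp
      moreover have "0 \<le> norm t * norm (t - x)" by simp
      moreover have "(1 + norm t) * (1 + norm (t - x)) = 1 + (norm t + norm (t - x)) + norm t * norm (t - x)"
        by (simp add: algebra_simps)
      ultimately have "1 + norm x \<le> (1 + norm t) * (1 + norm (t - x))" by argo
      then have "(1 + norm x) ^ N \<le> ((1 + norm t) * (1 + norm (t - x))) ^ N" by (intro power_mono) auto
      then have "(1 + norm x) ^ N * cmod (?h t) \<le> ((1 + norm t) * (1 + norm (t - x))) ^ N * cmod (?h t)"
        by (intro mult_right_mono) auto
      also have "\<dots> = ((1 + norm t) ^ N * cmod (?f t)) * ((1 + norm (t - x)) ^ N * cmod (?g (t - x)))"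
        by (simp add: norm_mult power_mult_distrib)
      also have "\<dots> \<le> (C1 * tail_weight t) * C2"
      proof (rule mult_mono)
        show "(1 + norm (t - x)) ^ N * cmod (?g (t - x)) \<le> C2" by (rule C2)
        have "0 < (1 + norm t) ^ Suc DIM(real^'n)" by (intro zero_less_power add_pos_nonneg) auto
        then show "(1 + norm t) ^ N * cmod (?f t) \<le> C1 * tail_weight t"
          using C1(2)[of t, unfolded power_add[of _ N "Suc DIM(real^'n)"]] unfolding tail_weight_def
          by (simp add: field_simps del: power_Suc)
      qed (use C1 tail_weight_pos[of t] in \<open>auto simp: less_imp_le\<close>)
      finally show ?thesis by (simp only: mult_ac)
    qed
    have "(1 + norm x) ^ N * cmod (stft ?f ?g (x, \<omega>)) \<le> (1 + norm x) ^ N * (LINT t|lborel. cmod (?h t))"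
      unfolding stft_def fst_conv snd_conv by (intro mult_left_mono integral_norm_bound) auto
    also have "\<dots> = (LINT t|lborel. (1 + norm x) ^ N * cmod (?h t))" by simp
    also have "\<dots> \<le> (LINT t|lborel. C1 * C2 * tail_weight (t::real^'n))"
      using hi by (intro integral_mono pt integrable_mult_right integrable_norm) (auto simp: tail_weight_integrable)
    finally show ?thesis by simp
  qed
  moreover have "0 \<le> C1 * C2 * (LINT t|lborel. tail_weight (t::real^'n))"
    using C1 C2 by (intro mult_nonneg_nonneg integral_nonneg_AE AE_I2) auto
  ultimately show ?case by (intro exI[of _ "C1 * C2 * (LINT t|lborel. tail_weight (t::real^'n))"]) simp
next
  case (Suc k)
  obtain A where A: "0 \<le> A" "\<And>x \<omega>. \<bar>\<omega> $ i\<bar> ^ k * ((1 + norm x) ^ N * cmod (stft (partial_derivs (i # is) \<phi>) (partial_derivs js \<phi>) (x, \<omega>))) \<le> A"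
    using Suc.IH[of "i # is" js] by blast
  obtain B where B: "0 \<le> B" "\<And>x \<omega>. \<bar>\<omega> $ i\<bar> ^ k * ((1 + norm x) ^ N * cmod (stft (partial_derivs is \<phi>) (partial_derivs (i # js) \<phi>) (x, \<omega>))) \<le> B"
    using Suc.IH[of "is" "i # js"] by blast
  have "\<bar>\<omega> $ i\<bar> ^ Suc k * ((1 + norm x) ^ N * cmod (stft (partial_derivs is \<phi>) (partial_derivs js \<phi>) (x, \<omega>))) \<le> A + B" for x \<omega>
  proof -
    let ?c = "\<bar>\<omega> $ i\<bar> ^ k * (1 + norm x) ^ N"
    have "\<bar>\<omega> $ i\<bar> * cmod (stft (partial_derivs is \<phi>) (partial_derivs js \<phi>) (x, \<omega>)) \<le>
      cmod (stft (partial_derivs (i # is) \<phi>) (partial_derivs js \<phi>) (x, \<omega>)) +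
      cmod (stft (partial_derivs is \<phi>) (partial_derivs (i # js) \<phi>) (x, \<omega>))"
      using norm_triangle_ineq schwartz_stft_integration_by_parts[of "(x, \<omega>)" i "is" js]
      by (metis abs_1 norm_ii norm_mult norm_of_real mult_1 snd_conv)
    then have "?c * (\<bar>\<omega> $ i\<bar> * cmod (stft (partial_derivs is \<phi>) (partial_derivs js \<phi>) (x, \<omega>))) \<le>
      ?c * (cmod (stft (partial_derivs (i # is) \<phi>) (partial_derivs js \<phi>) (x, \<omega>)) +
      cmod (stft (partial_derivs is \<phi>) (partial_derivs (i # js) \<phi>) (x, \<omega>)))"
      by (rule mult_left_mono) simp
    also have "\<dots> \<le> A + B"
      using add_mono[OF A(2)[of \<omega> x] B(2)[of \<omega> x]] by (simp only: distrib_left mult.assoc)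
    finally show ?thesis by (simp only: power_Suc mult_ac)
  qed
  then show ?case using A(1) B(1) by (intro exI[of _ "A + B"]) auto
qed

text \<open>1 + |z| is at most 1 + |x| times 1 plus the sum of the frequency coordinates, so joint
  decay follows from the mixed bounds of \<open>schwartz_stft_decay_aux\<close> with exponents 0 and
  N.\<close>

lemma schwartz_stft_decay: "\<exists>C\<ge>0. \<forall>z. (1 + norm z) ^ N * cmod (stft \<phi> \<phi> z) \<le> C"
proof -
  have "\<exists>C\<ge>0. \<forall>x \<omega>. \<bar>\<omega> $ i\<bar> ^ N * ((1 + norm x) ^ N * cmod (stft \<phi> \<phi> (x, \<omega>))) \<le> C" for i :: 'n
    using schwartz_stft_decay_aux[of i N N "[]" "[]"] by simp
  then obtain B where B: "\<And>i::'n. 0 \<le> B i" "\<And>i x \<omega>. \<bar>\<omega> $ i\<bar> ^ N * ((1 + norm x) ^ N * cmod (stft \<phi> \<phi> (x, \<omega>))) \<le> B i"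
    by metis
  obtain B0 where B0: "0 \<le> B0" "\<And>x \<omega>. (1 + norm x) ^ N * cmod (stft \<phi> \<phi> (x, \<omega>)) \<le> B0"
    using schwartz_stft_decay_aux[of _ 0 N "[]" "[]"] by auto
  define c where "c = (real CARD('n) + 1) ^ N"
  have c: "0 \<le> c" by (simp add: c_def)
  have "(1 + norm z) ^ N * cmod (stft \<phi> \<phi> z) \<le> c * (B0 + (\<Sum>i\<in>UNIV. B i))" for z
  proof -
    obtain x \<omega> where z: "z = (x, \<omega>)" by (cases z)
    let ?S = "\<Sum>i\<in>UNIV. \<bar>\<omega> $ i\<bar>"
    have S0: "0 \<le> ?S" by (simp add: sum_nonneg)
    have "norm z \<le> norm x + ?S"
      unfolding z using norm_Pair_le[of x \<omega>] norm_le_l1_cart[of \<omega>] by simp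
    moreover have "0 \<le> norm x * ?S" using S0 by simp
    moreover have "(1 + norm x) * (1 + ?S) = 1 + (norm x + ?S) + norm x * ?S"
      by (simp only: distrib_left distrib_right mult_1 mult_1_right add_ac)
    ultimately have "1 + norm z \<le> (1 + norm x) * (1 + ?S)" by argo
    then have "(1 + norm z) ^ N \<le> ((1 + norm x) * (1 + ?S)) ^ N" by (intro power_mono) auto
    also have "\<dots> = (1 + norm x) ^ N * (1 + ?S) ^ N" by (rule power_mult_distrib)
    also have "\<dots> \<le> (1 + norm x) ^ N * (c * (1 + (\<Sum>i\<in>UNIV. \<bar>\<omega> $ i\<bar> ^ N)))"
      unfolding c_def by (intro mult_left_mono power_one_plus_sum_le) auto
    finally have "(1 + norm z) ^ N * cmod (stft \<phi> \<phi> z) \<le>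
        ((1 + norm x) ^ N * (c * (1 + (\<Sum>i\<in>UNIV. \<bar>\<omega> $ i\<bar> ^ N)))) * cmod (stft \<phi> \<phi> z)"
      by (rule mult_right_mono) simp
    also have "\<dots> = c * ((1 + norm x) ^ N * cmod (stft \<phi> \<phi> z) +
        (\<Sum>i\<in>UNIV. \<bar>\<omega> $ i\<bar> ^ N * ((1 + norm x) ^ N * cmod (stft \<phi> \<phi> z))))"
      by (simp add: distrib_left distrib_right sum_distrib_right sum_distrib_left mult_ac)
    also have "\<dots> \<le> c * (B0 + (\<Sum>i\<in>UNIV. B i))"
      unfolding z by (intro mult_left_mono add_mono sum_mono c B B0)
    finally show ?thesis .
  qed
  moreover have "0 \<le> c * (B0 + (\<Sum>i\<in>UNIV. B i))" using c B B0 by (simp add: sum_nonneg)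
  ultimately show ?thesis by blast
qed

end

section \<open>Coherent states\<close>

lemma completion_ex_borel_measurable_complex:
  fixes g :: "'a::euclidean_space \<Rightarrow> complex"
  assumes "g \<in> borel_measurable lebesgue"
  shows "\<exists>g'\<in>borel_measurable borel. AE x in lebesgue. g x = g' x"
proof -
  have "(\<lambda>x. Re (g x)) \<in> borel_measurable lebesgue" "(\<lambda>x. Im (g x)) \<in> borel_measurable lebesgue"
    using assms by measurable
  then obtain p q where [measurable]: "p \<in> borel_measurable lborel" "q \<in> borel_measurable lborel"
    and pq: "AE x in lborel. Re (g x) = p x" "AE x in lborel. Im (g x) = q x"
    using completion_ex_borel_measurable_real by metis
  have "AE x in lborel. g x = complex_of_real (p x) + \<i> * complex_of_real (q x)"
    using pq by eventually_elim (simp add: complex_eq_iff)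
  then have "AE x in lebesgue. g x = complex_of_real (p x) + \<i> * complex_of_real (q x)"
    by (rule AE_completion)
  then show ?thesis by (intro bexI[of _ "\<lambda>x. complex_of_real (p x) + \<i> * complex_of_real (q x)"]) auto
qed

lemma borel_imp_lebesgue: "f \<in> borel_measurable borel \<Longrightarrow> f \<in> borel_measurable lebesgue"
  by (simp add: measurable_completion)

lemma L2_borel_iff:
  assumes [measurable]: "g \<in> borel_measurable borel"
  shows "g \<in> L2 \<longleftrightarrow> integrable lborel (\<lambda>x. (cmod (g x))\<^sup>2)"
  using assms by (simp add: L2_def borel_imp_lebesgue integrable_completion)

lemma l2_norm_borel:
  assumes [measurable]: "g \<in> borel_measurable borel"
  shows "(l2_norm g)\<^sup>2 = (LINT x|lborel. (cmod (g x))\<^sup>2)"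
  by (simp add: l2_norm_def integral_completion)

text \<open>Substitution and Tonelli above are stated for Borel functions, so elements of
  \<open>L2\<close> are exchanged for Borel ones before they are used.\<close>

lemma L2_borel_representative:
  assumes f: "f \<in> L2"
  shows "\<exists>g. g \<in> borel_measurable borel \<and> g \<in> L2 \<and> l2_norm (f - g) = 0"
proof -
  obtain g where g: "g \<in> borel_measurable borel" and ae: "AE x in lebesgue. f x = g x"
    using completion_ex_borel_measurable_complex[OF L2_measurable[OF f]] by blast
  have ae0: "AE x in lebesgue. (f - g) x = 0" using ae by eventually_elim simp
  have "f - g \<in> borel_measurable lebesgue"
    using L2_measurable[OF f] borel_imp_lebesgue[OF g] unfolding fun_diff_def by measurable
  then have d: "f - g \<in> L2" using ae0 by (rule L2_null)
  have "f - (f - g) \<in> L2" using f d by (rule L2.V_closed)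
  then have "g \<in> L2" by simp
  moreover have "l2_norm (f - g) = 0" using l2_norm_eq_0_iff[OF d] ae0 by simp
  ultimately show ?thesis using g by blast
qed

lemma L2_inner_cong_null:
  assumes "f \<in> L2" "g \<in> L2" "l2_norm (f - g) = 0" "k \<in> L2"
  shows "l2_inner f k = l2_inner g k"
  using L2_inner_null[of "f - g" k] assms by (simp add: L2.ip_diff)

lemma l2_norm_cong_null:
  assumes "f \<in> L2" "g \<in> L2" "l2_norm (f - g) = 0"
  shows "l2_norm f = l2_norm g"
proof -
  have "l2_norm f \<le> l2_norm (f - g) + l2_norm g"
    using L2.nrm_triangle[of "f - g" g] assms by (simp add: L2_nrm)
  moreover have "l2_norm g \<le> l2_norm (g - f) + l2_norm f"
    using L2.nrm_triangle[of "g - f" f] assms by (simp add: L2_nrm)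
  ultimately show ?thesis using L2.nrm_minus_commute[OF assms(1,2)] assms(3) by (simp add: L2_nrm)
qed

text \<open>The unitary rescaling that removes h: it carries coherent states of scale h to
  time-frequency shifts of the window itself.\<close>

definition dilate :: "real \<Rightarrow> ('a::euclidean_space \<Rightarrow> complex) \<Rightarrow> 'a \<Rightarrow> complex" where
  "dilate h f = (\<lambda>t. complex_of_real (h powr (real DIM('a) / 4)) * f (sqrt h *\<^sub>R t))"

lemma dilate_measurable [measurable]:
  assumes [measurable]: "f \<in> borel_measurable borel"
  shows "dilate h f \<in> borel_measurable borel"
  unfolding dilate_def by measurable

lemma sqrt_power_powr: "0 < h \<Longrightarrow> sqrt h ^ n = h powr (real n / 2)"
  by (simp add: powr_half_sqrt[symmetric] powr_power)

lemma dilate_norm: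
  fixes f :: "'a::euclidean_space \<Rightarrow> complex"
  assumes [measurable]: "f \<in> borel_measurable borel" and h: "0 < h"
    and f2: "integrable lborel (\<lambda>x. (cmod (f x))\<^sup>2)"
  shows "integrable lborel (\<lambda>x. (cmod (dilate h f x))\<^sup>2)"
    and "(LINT x|lborel. (cmod (dilate h f x))\<^sup>2) = (LINT x|lborel. (cmod (f x))\<^sup>2)"
proof -
  have eq: "(cmod (dilate h f x))\<^sup>2 = h powr (real DIM('a) / 2) * (cmod (f (0 + sqrt h *\<^sub>R x)))\<^sup>2" for x
    using h by (simp add: dilate_def norm_mult power_mult_distrib powr_power)
  show "integrable lborel (\<lambda>x. (cmod (dilate h f x))\<^sup>2)"
    unfolding eq using h by (intro integrable_mult_right integrable_lborel_affine[OF f2]) auto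
  have "(LINT x|lborel. (cmod (f x))\<^sup>2) = (\<bar>sqrt h\<bar> ^ DIM('a)) *\<^sub>R (LINT x|lborel. (cmod (f (0 + sqrt h *\<^sub>R x)))\<^sup>2)"
    using h by (intro integral_lborel_affine) auto
  then show "(LINT x|lborel. (cmod (dilate h f x))\<^sup>2) = (LINT x|lborel. (cmod (f x))\<^sup>2)"
    unfolding eq using h by (simp add: sqrt_power_powr)
qed

text \<open>Covariance in the first argument, up to a phase. It makes the overlap of two coherent
  states a function of the difference of their centres.\<close>

lemma stft_time_frequency_shift:
  assumes [measurable]: "\<psi> \<in> borel_measurable borel" "\<eta> \<in> borel_measurable borel"
  shows "cmod (stft (time_frequency_shift w \<psi>) \<eta> z) = cmod (stft \<psi> \<eta> (z - w))"
proof -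
  let ?G = "\<lambda>t. time_frequency_shift w \<psi> t * cnj (\<eta> (t - fst z)) * cis (- (snd z \<bullet> t))"
  have "stft (time_frequency_shift w \<psi>) \<eta> z = (CLINT t|lborel. ?G (fst w + 1 *\<^sub>R t))"
    unfolding stft_def by (subst integral_lborel_affine[of ?G 1 "fst w"]) auto
  also have "\<dots> = (CLINT t|lborel. cis (- (snd (z - w) \<bullet> fst w)) * (\<psi> t * cnj (\<eta> (t - fst (z - w))) * cis (- (snd (z - w) \<bullet> t))))"
  proof (intro Bochner_Integration.integral_cong refl)
    fix t
    have 1: "cis (snd w \<bullet> (fst w + t)) * cis (- (snd z \<bullet> (fst w + t))) =
        cis (- (snd (z - w) \<bullet> fst w)) * cis (- (snd (z - w) \<bullet> t))"
      unfolding cis_mult by (intro arg_cong[where f=cis]) (simp add: inner_diff_left inner_add_right)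
    have 2: "fst w + t - fst z = t - fst (z - w)" and 3: "fst w + t - fst w = t" by simp_all
    have 4: "p * A * q * B = C * (p * q * D)" if "A * B = C * D" for p q A B C D :: complex
    proof -
      have "p * A * q * B = (A * B) * (p * q)" by (simp only: mult_ac)
      then show ?thesis by (simp only: that mult_ac)
    qed
    show "?G (fst w + 1 *\<^sub>R t) =
        cis (- (snd (z - w) \<bullet> fst w)) * (\<psi> t * cnj (\<eta> (t - fst (z - w))) * cis (- (snd (z - w) \<bullet> t)))"
      unfolding time_frequency_shift_def scaleR_one 2 3 by (rule 4[OF 1])
  qed
  also have "\<dots> = cis (- (snd (z - w) \<bullet> fst w)) * stft \<psi> \<eta> (z - w)"
    unfolding stft_def by (rule Bochner_Integration.integral_mult_right_zero)
  finally show ?thesis by (simp add: norm_mult)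
qed

lemma coherent_state_measurable:
  fixes \<phi> :: "real^'n \<Rightarrow> complex"
  assumes [measurable]: "\<phi> \<in> borel_measurable borel"
  shows "coherent_state \<phi> h z \<in> borel_measurable borel"
  unfolding coherent_state_def case_prod_beta by measurable

lemma coherent_state_eq:
  "coherent_state \<phi> h z x = complex_of_real (h powr (- real CARD('n) / 4)) *
     cis ((snd z \<bullet> x) / h) * \<phi> ((1 / sqrt h) *\<^sub>R (x - fst z))" if "0 < h"
  for \<phi> :: "real^'n \<Rightarrow> complex"
proof -
  have "h powr (- 1 / 2) = 1 / sqrt h" using that by (simp add: powr_minus_divide powr_half_sqrt)
  moreover have "exp (\<i> / complex_of_real h * complex_of_real (snd z \<bullet> x)) = cis ((snd z \<bullet> x) / h)"
    by (simp add: cis_conv_exp)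
  ultimately show ?thesis unfolding coherent_state_def case_prod_beta by simp
qed

lemma dilate_coherent_state:
  fixes \<phi> :: "real^'n \<Rightarrow> complex"
  assumes h: "0 < h"
  shows "dilate h (coherent_state \<phi> h z) = time_frequency_shift ((1 / sqrt h) *\<^sub>R z) \<phi>"
proof
  fix t
  have 1: "(1 / sqrt h) *\<^sub>R (sqrt h *\<^sub>R t - fst z) = t - (1 / sqrt h) *\<^sub>R fst z"
    using h by (simp add: scaleR_diff_right)
  have 2: "(snd z \<bullet> (sqrt h *\<^sub>R t)) / h = ((1 / sqrt h) *\<^sub>R snd z) \<bullet> t"
    using h by (simp add: field_simps) (simp flip: real_sqrt_mult_self mult.assoc)?
  have 3: "complex_of_real (h powr (real CARD('n) / 4)) * complex_of_real (h powr (- real CARD('n) / 4)) = 1"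
  proof -
    have "h powr (real CARD('n) / 4) * h powr (- real CARD('n) / 4) = 1"
      using h by (simp add: powr_minus)
    then show ?thesis by (metis of_real_1 of_real_mult)
  qed
  have 4: "A * (B * c * p) = p * c" if "A * B = 1" for A B c p :: complex
    using that by (simp add: mult.assoc[symmetric] mult.commute[of p])
  show "dilate h (coherent_state \<phi> h z) t = time_frequency_shift ((1 / sqrt h) *\<^sub>R z) \<phi> t"
    unfolding dilate_def coherent_state_eq[OF h] time_frequency_shift_def 1 2 fst_scaleR snd_scaleR
    by (rule 4) (simp only: 3 DIM_cart DIM_real mult_1_right)
qed

text \<open>Substitute x = sqrt h t: the Jacobian h^(d/2) and the normalisation h^(-d/4) combine to
  the factor h^(d/4) of \<open>dilate\<close>, and both phase space variables are divided by sqrt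
  h.\<close>

lemma l2_inner_coherent_state:
  fixes \<phi> f :: "real^'n \<Rightarrow> complex"
  assumes [measurable]: "\<phi> \<in> borel_measurable borel" "f \<in> borel_measurable borel" and h: "0 < h"
  shows "l2_inner f (coherent_state \<phi> h z) = stft (dilate h f) \<phi> ((1 / sqrt h) *\<^sub>R z)"
proof -
  note [measurable] = coherent_state_measurable
  let ?n = "real CARD('n)"
  have sq: "sqrt h ^ CARD('n) * h powr (- ?n / 4) = h powr (?n / 4)"
    using h by (simp add: sqrt_power_powr flip: powr_add)
  have "l2_inner f (coherent_state \<phi> h z) = (CLINT x|lborel. f x * cnj (coherent_state \<phi> h z x))"
    unfolding l2_inner_def by (rule integral_completion) measurable
  also have "\<dots> = (\<bar>sqrt h\<bar> ^ DIM(real^'n)) *\<^sub>R (CLINT x|lborel. f (0 + sqrt h *\<^sub>R x) * cnj (coherent_state \<phi> h z (0 + sqrt h *\<^sub>R x)))"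
    using h by (intro integral_lborel_affine) measurable
  also have "\<dots> = (CLINT x|lborel. (sqrt h ^ CARD('n)) *\<^sub>R (f (sqrt h *\<^sub>R x) * cnj (coherent_state \<phi> h z (sqrt h *\<^sub>R x))))"
    using h by simp
  also have "\<dots> = stft (dilate h f) \<phi> ((1 / sqrt h) *\<^sub>R z)"
    unfolding stft_def
  proof (intro Bochner_Integration.integral_cong refl)
    fix t
    have 1: "(1 / sqrt h) *\<^sub>R (sqrt h *\<^sub>R t - fst z) = t - (1 / sqrt h) *\<^sub>R fst z"
      using h by (simp add: scaleR_diff_right)
    have 2: "(snd z \<bullet> (sqrt h *\<^sub>R t)) / h = ((1 / sqrt h) *\<^sub>R snd z) \<bullet> t"
      using h by (simp add: field_simps) (simp flip: real_sqrt_mult_self mult.assoc)?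
    have 3: "complex_of_real (sqrt h ^ CARD('n)) * complex_of_real (h powr (- ?n / 4)) = complex_of_real (h powr (?n / 4))"
      unfolding sq[symmetric] by simp
    have 4: "S * (c * cnj (complex_of_real b * cis r * p)) = D * c * cnj p * cis (- r)"
      if "S * complex_of_real b = D" for S c b r p D
      by (simp add: cis_cnj that[symmetric])
    show "(sqrt h ^ CARD('n)) *\<^sub>R (f (sqrt h *\<^sub>R t) * cnj (coherent_state \<phi> h z (sqrt h *\<^sub>R t))) =
       dilate h f t * cnj (\<phi> (t - fst ((1 / sqrt h) *\<^sub>R z))) * cis (- (snd ((1 / sqrt h) *\<^sub>R z) \<bullet> t))"
      unfolding coherent_state_eq[OF h] 1 2 scaleR_conv_of_real[of "sqrt h ^ CARD('n)"] dilate_def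
        fst_scaleR snd_scaleR
      by (rule 4) (simp only: 3 DIM_cart DIM_real mult_1_right)
  qed
  finally show ?thesis .
qed

lemma window_measurable: "schwartz \<phi> \<Longrightarrow> \<phi> \<in> borel_measurable borel"
  using schwartz_partial_measurable[of \<phi> "[]"] by simp

lemma window_square_integrable: "schwartz \<phi> \<Longrightarrow> integrable lborel (\<lambda>x. (cmod (\<phi> x))\<^sup>2)"
  using schwartz_partial_square_integrable[of \<phi> "[]"] by simp

lemma window_norm: "schwartz \<phi> \<Longrightarrow> l2_norm \<phi> = 1 \<Longrightarrow> (LINT x|lborel. (cmod (\<phi> x))\<^sup>2) = 1"
  by (simp add: window_measurable flip: l2_norm_borel)

lemma window_bounded: "schwartz \<phi> \<Longrightarrow> \<exists>M. \<forall>x. cmod (\<phi> x) \<le> M"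
  using schwartz_partial_bounded[of \<phi> "[]"] by simp

context
  fixes \<phi> :: "real^'n \<Rightarrow> complex" and h :: real
  assumes schwartz: "schwartz \<phi>" and norm1: "l2_norm \<phi> = 1" and h: "0 < h"
begin

lemmas phi_measurable [measurable] = window_measurable[OF schwartz]

lemma coherent_state_norm:
  shows "coherent_state \<phi> h z \<in> L2" "l2_norm (coherent_state \<phi> h z) = 1"
proof -
  let ?n = "real CARD('n)"
  have eq: "(cmod (coherent_state \<phi> h z x))\<^sup>2 = h powr (- ?n / 2) * (cmod (\<phi> (- (1 / sqrt h) *\<^sub>R fst z + (1 / sqrt h) *\<^sub>R x)))\<^sup>2" for x
  proof -
    have "(h powr (- ?n / 4))\<^sup>2 = h powr (- ?n / 2)" by (simp add: power2_eq_square flip: powr_add)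
    moreover have "(1 / sqrt h) *\<^sub>R (x - fst z) = - (1 / sqrt h) *\<^sub>R fst z + (1 / sqrt h) *\<^sub>R x"
      by (simp add: scaleR_diff_right)
    ultimately show ?thesis unfolding coherent_state_eq[OF h] by (simp add: norm_mult power_mult_distrib)
  qed
  have i: "integrable lborel (\<lambda>x. (cmod (coherent_state \<phi> h z x))\<^sup>2)"
    unfolding eq using h by (intro integrable_mult_right integrable_lborel_affine[OF window_square_integrable[OF schwartz]]) auto
  then show "coherent_state \<phi> h z \<in> L2" by (simp add: L2_borel_iff coherent_state_measurable phi_measurable)
  have "(LINT x|lborel. (cmod (\<phi> x))\<^sup>2) =
      (\<bar>1 / sqrt h\<bar> ^ DIM(real^'n)) *\<^sub>R (LINT x|lborel. (cmod (\<phi> (- (1 / sqrt h) *\<^sub>R fst z + (1 / sqrt h) *\<^sub>R x)))\<^sup>2)"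
    using h by (intro integral_lborel_affine) auto
  moreover have "\<bar>1 / sqrt h\<bar> ^ DIM(real^'n) = h powr (- ?n / 2)"
    using h by (simp add: power_divide sqrt_power_powr powr_minus_divide)
  ultimately have "(LINT x|lborel. (cmod (coherent_state \<phi> h z x))\<^sup>2) = 1"
    unfolding eq by (simp add: window_norm[OF schwartz norm1])
  then have "(l2_norm (coherent_state \<phi> h z))\<^sup>2 = 1"
    by (simp add: l2_norm_borel coherent_state_measurable phi_measurable)
  then show "l2_norm (coherent_state \<phi> h z) = 1"
    by (simp add: l2_norm_def)
qed

lemma coherent_transform_measurable:
  assumes f: "f \<in> L2"
  shows "(\<lambda>z. l2_inner f (coherent_state \<phi> h z)) \<in> borel_measurable borel"
proof -
  obtain g where [measurable]: "g \<in> borel_measurable borel" and g: "g \<in> L2" "l2_norm (f - g) = 0"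
    using L2_borel_representative[OF f] by blast
  have "l2_inner f (coherent_state \<phi> h z) = stft (dilate h g) \<phi> ((1 / sqrt h) *\<^sub>R z)" for z
    using L2_inner_cong_null[OF f g coherent_state_norm(1)] by (simp add: l2_inner_coherent_state h phi_measurable)
  moreover have "(\<lambda>z. stft (dilate h g) \<phi> ((1 / sqrt h) *\<^sub>R z)) \<in> borel_measurable borel"
    by (rule measurable_compose[of _ borel borel]) measurable
  ultimately show ?thesis by simp
qed

text \<open>If all these inner products vanish, so does the whole short-time Fourier transform of a
  dilate of v, and Moyal's identity gives norm 0.\<close>

lemma coherent_states_total:
  assumes v: "v \<in> L2" and orth: "\<And>z. l2_inner (coherent_state \<phi> h z) v = 0"
  shows "l2_norm v = 0"
proof -
  obtain g where [measurable]: "g \<in> borel_measurable borel" and g: "g \<in> L2" "l2_norm (v - g) = 0"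
    using L2_borel_representative[OF v] by blast
  obtain M where M: "\<And>x. cmod (\<phi> x) \<le> M" using window_bounded[OF schwartz] by blast
  have g2: "integrable lborel (\<lambda>x. (cmod (g x))\<^sup>2)" using g(1) by (simp add: L2_borel_iff)
  have "stft (dilate h g) \<phi> z = 0" for z
  proof -
    have "stft (dilate h g) \<phi> ((1 / sqrt h) *\<^sub>R (sqrt h *\<^sub>R z)) = l2_inner v (coherent_state \<phi> h (sqrt h *\<^sub>R z))"
      using L2_inner_cong_null[OF v g coherent_state_norm(1)] by (simp only: l2_inner_coherent_state h phi_measurable \<open>g \<in> borel_measurable borel\<close>)
    also have "\<dots> = 0" using L2.ip_commute[OF coherent_state_norm(1) v] orth by simp
    finally show ?thesis using h by simp
  qed
  then have "0 = (\<integral>\<^sup>+z. ennreal ((cmod (stft (dilate h g) \<phi> z))\<^sup>2) \<partial>lborel)" by simp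
  also have "\<dots> = ennreal ((2 * pi) ^ DIM(real^'n) * (LINT x|lborel. (cmod (\<phi> x))\<^sup>2) * (LINT x|lborel. (cmod (dilate h g x))\<^sup>2))"
    using M by (intro moyal dilate_norm window_square_integrable[OF schwartz] g2 h) auto
  also have "\<dots> = ennreal ((2 * pi) ^ DIM(real^'n) * (l2_norm g)\<^sup>2)"
    by (simp add: window_norm[OF schwartz norm1] dilate_norm(2) h g2 l2_norm_borel)
  finally have "(2 * pi) ^ DIM(real^'n) * (l2_norm g)\<^sup>2 \<le> 0" by (metis ennreal_eq_0_iff)
  moreover have "0 < (2 * pi) ^ DIM(real^'n)" by simp
  ultimately have "(l2_norm g)\<^sup>2 \<le> 0" by (meson mult_pos_pos not_less)
  then show ?thesis using l2_norm_cong_null[OF v g] by simp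
qed

end

section \<open>\<open>A\<^sub>\<infinity>\<close> weights\<close>

text \<open>The weight is a Borel representative, nonnegative everywhere, and masses are extended
  nonnegative integrals, so no integrability conditions appear. The ratio \<theta> is the one at
  which a concentric ball has the proportion 1 - \<alpha> of the volume.\<close>

locale A_infty_weight =
  fixes w :: "'a::euclidean_space \<Rightarrow> real" and \<alpha> \<theta> :: real
  assumes w_measurable [measurable]: "w \<in> borel_measurable borel"
    and w_nonneg: "\<And>x. 0 \<le> w x"
    and \<alpha>: "0 < \<alpha>" "\<alpha> < 1"
    and \<theta>: "0 < \<theta>" "\<theta> < 1" "\<theta> ^ DIM('a) = 1 - \<alpha>"
    and A_infty_ineq: "\<And>c r E. 0 < r \<Longrightarrow> E \<in> sets borel \<Longrightarrow> E \<subseteq> ball c r \<Longrightarrow>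
      (1 - \<alpha>) * measure lborel (ball c r) \<le> measure lborel E \<Longrightarrow>
      ennreal \<alpha> * (\<integral>\<^sup>+x. ennreal (w x) * indicator (ball c r) x \<partial>lborel) \<le>
      (\<integral>\<^sup>+x. ennreal (w x) * indicator E x \<partial>lborel)"

lemma A_infty_borel_representative:
  fixes a :: "'a::euclidean_space \<Rightarrow> real"
  assumes a: "a \<in> A_infty \<alpha>" and \<alpha>: "0 < \<alpha>" "\<alpha> < 1"
    and \<theta>: "0 < \<theta>" "\<theta> < 1" "\<theta> ^ DIM('a) = 1 - \<alpha>"
  shows "\<exists>w. A_infty_weight w \<alpha> \<theta> \<and> (AE x in lebesgue. a x = w x) \<and>
    (\<forall>c r. (\<integral>\<^sup>+x. ennreal (w x) * indicator (ball c r) x \<partial>lborel) = ennreal (LINT x:ball c r|lebesgue. a x) \<and>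
       0 \<le> (LINT x:ball c r|lebesgue. a x))"
proof -
  have li: "\<And>K. compact K \<Longrightarrow> set_integrable lebesgue K a" and pos: "AE x in lebesgue. 0 < a x"
    and ineq: "\<And>c r E. 0 < r \<Longrightarrow> E \<in> sets lebesgue \<Longrightarrow> E \<subseteq> ball c r \<Longrightarrow>
        (1 - \<alpha>) * measure lebesgue (ball c r) \<le> measure lebesgue E \<Longrightarrow>
        \<alpha> * (LINT x:ball c r|lebesgue. a x) \<le> (LINT x:E|lebesgue. a x)"
    using a by (auto simp: A_infty_def locally_integrable_def)
  \<comment> \<open>Local integrability gives measurability only after restriction to compact sets;
    a is the pointwise limit of its restrictions to growing balls.\<close>
  have am: "a \<in> borel_measurable lebesgue"
  proof (rule borel_measurable_LIMSEQ_metric)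
    fix n :: nat
    have "set_integrable lebesgue (cball 0 (real n)) a" by (rule li) simp
    then show "(\<lambda>x. indicator (cball 0 (real n)) x *\<^sub>R a x) \<in> borel_measurable lebesgue"
      unfolding set_integrable_def by (rule borel_measurable_integrable)
  next
    fix x :: 'a
    obtain n where n: "norm x \<le> real n" using real_arch_simple by blast
    have "\<forall>\<^sub>F k in sequentially. indicator (cball 0 (real k)) x *\<^sub>R a x = a x"
      using n by (intro eventually_sequentiallyI[of n]) (auto simp: indicator_def)
    then show "(\<lambda>k. indicator (cball 0 (real k)) x *\<^sub>R a x) \<longlonglongrightarrow> a x" by (rule tendsto_eventually)
  qed
  then obtain g where g: "g \<in> borel_measurable lborel" "AE x in lborel. a x = g x"
    using completion_ex_borel_measurable_real by blast
  \<comment> \<open>Since a is positive almost everywhere, the clipping changes g only on a null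
    set.\<close>
  define w where "w x = max 0 (g x)" for x
  have w [measurable]: "w \<in> borel_measurable borel" using g(1) unfolding w_def by simp
  have w0: "0 \<le> w x" for x by (simp add: w_def)
  have ae: "AE x in lebesgue. a x = w x"
    using AE_completion[OF g(2)] pos by eventually_elim (simp add: w_def)
  have key: "(\<integral>\<^sup>+x. ennreal (w x) * indicator E x \<partial>lborel) = ennreal (LINT x:E|lebesgue. a x)"
    and nonneg: "0 \<le> (LINT x:E|lebesgue. a x)"
    if E [measurable]: "E \<in> sets borel" and sub: "E \<subseteq> ball c r" for E c r
  proof -
    have El: "E \<in> sets lebesgue" using E by simp
    have si: "set_integrable lebesgue E a"
    proof (rule set_integrable_subset[OF _ El])
      show "set_integrable lebesgue (cball c r) a" by (rule li) simp
      show "E \<subseteq> cball c r" using sub ball_subset_cball by (rule order_trans)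
    qed
    have wl: "(\<lambda>x. w x * indicator E x) \<in> borel_measurable lebesgue"
      by (intro borel_imp_lebesgue) measurable
    have ae': "AE x in lebesgue. indicator E x *\<^sub>R a x = w x * indicator E x"
      using ae by eventually_elim simp
    have m: "(\<lambda>x. indicator E x *\<^sub>R a x) \<in> borel_measurable lebesgue"
      using si unfolding set_integrable_def by (rule borel_measurable_integrable)
    have iw: "integrable lebesgue (\<lambda>x. w x * indicator E x)"
      using si integrable_cong_AE[OF m wl ae'] by (simp add: set_integrable_def)
    have eq: "(LINT x:E|lebesgue. a x) = (LINT x|lebesgue. w x * indicator E x)"
      unfolding set_lebesgue_integral_def by (rule integral_cong_AE[OF m wl ae'])
    have "(\<integral>\<^sup>+x. ennreal (w x * indicator E x) \<partial>lebesgue) = ennreal (LINT x:E|lebesgue. a x)"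
      unfolding eq using w0 by (intro nn_integral_eq_integral iw) auto
    moreover have "ennreal (w x * indicator E x) = ennreal (w x) * indicator E x" for x
      by (simp add: indicator_def)
    ultimately show "(\<integral>\<^sup>+x. ennreal (w x) * indicator E x \<partial>lborel) = ennreal (LINT x:E|lebesgue. a x)"
      by (simp add: nn_integral_completion)
    show "0 \<le> (LINT x:E|lebesgue. a x)" unfolding eq using w0 by (intro integral_nonneg_AE) auto
  qed
  have "A_infty_weight w \<alpha> \<theta>"
  proof
    fix c :: 'a and r and E :: "'a set" assume r: "0 < r" and E: "E \<in> sets borel" "E \<subseteq> ball c r"
      and m: "(1 - \<alpha>) * measure lborel (ball c r) \<le> measure lborel E"
    have "\<alpha> * (LINT x:ball c r|lebesgue. a x) \<le> (LINT x:E|lebesgue. a x)"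
      using E m by (intro ineq r) (auto simp: measure_completion)
    then have "ennreal (\<alpha> * (LINT x:ball c r|lebesgue. a x)) \<le> ennreal (LINT x:E|lebesgue. a x)"
      by (rule ennreal_leI)
    then show "ennreal \<alpha> * (\<integral>\<^sup>+x. ennreal (w x) * indicator (ball c r) x \<partial>lborel) \<le>
      (\<integral>\<^sup>+x. ennreal (w x) * indicator E x \<partial>lborel)"
      using key[OF E] key[of "ball c r" c r] nonneg[of "ball c r" c r] \<alpha> by (simp add: ennreal_mult')
  qed (use w w0 \<alpha> \<theta> in auto)
  moreover have "(\<integral>\<^sup>+x. ennreal (w x) * indicator (ball c r) x \<partial>lborel) = ennreal (LINT x:ball c r|lebesgue. a x)"
    "0 \<le> (LINT x:ball c r|lebesgue. a x)" for c r
    using key[of "ball c r" c r] nonneg[of "ball c r" c r] by simp_all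
  ultimately show ?thesis using ae by (intro exI[of _ w]) blast
qed

lemma emeasure_ball_eq: "emeasure lborel (ball (c::'a::euclidean_space) r) = ennreal (measure lborel (ball c r))"
  using emeasure_lborel_ball_finite[of c r] by (intro emeasure_eq_ennreal_measure) auto

lemma measure_ball_pos: "0 < r \<Longrightarrow> 0 < measure lborel (ball (c::'a::euclidean_space) r)"
  by (rule content_ball_pos)

context A_infty_weight
begin

definition mass :: "'a set \<Rightarrow> ennreal" where
  "mass E = (\<integral>\<^sup>+x. ennreal (w x) * indicator E x \<partial>lborel)"

text \<open>The ball shrunk by \<theta> is a set of proportion exactly 1 - \<alpha>, so it carries
  at least the fraction \<alpha> of the mass; iterate k times.\<close>

lemma mass_doubling:
  assumes r: "0 < r"
  shows "mass (ball c (r / \<theta> ^ k)) \<le> ennreal ((1 / \<alpha>) ^ k) * mass (ball c r)"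
proof (induction k)
  case 0
  then show ?case by simp
next
  case (Suc k)
  let ?s = "r / \<theta> ^ k" and ?t = "r / \<theta> ^ Suc k"
  have s: "0 < ?s" "0 < ?t" "?s = \<theta> * ?t" using r \<theta> by auto
  have "ennreal \<alpha> * mass (ball c ?t) \<le> mass (ball c ?s)"
    unfolding mass_def
  proof (rule A_infty_ineq[OF s(2)])
    have "?s \<le> ?t" using s(2) \<theta> unfolding s(3) by (intro mult_left_le_one_le) auto
    then show "ball c ?s \<subseteq> ball c ?t" by (rule subset_ball)
    have "measure lborel (ball c ?s) = (\<theta> * ?t) ^ DIM('a) * measure lborel (ball (0::'a) 1)"
      unfolding s(3)[symmetric] using s(1) by (intro content_ball_conv_unit_ball) auto
    moreover have "measure lborel (ball c ?t) = ?t ^ DIM('a) * measure lborel (ball (0::'a) 1)"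
      using s(2) by (intro content_ball_conv_unit_ball) auto
    ultimately have "measure lborel (ball c ?s) = (1 - \<alpha>) * measure lborel (ball c ?t)"
      by (simp only: power_mult_distrib \<theta>(3) mult.assoc)
    then show "(1 - \<alpha>) * measure lborel (ball c ?t) \<le> measure lborel (ball c ?s)" by simp
  qed simp
  then have "ennreal (1 / \<alpha>) * (ennreal \<alpha> * mass (ball c ?t)) \<le> ennreal (1 / \<alpha>) * mass (ball c ?s)"
    by (rule mult_left_mono) simp
  also have "ennreal (1 / \<alpha>) * (ennreal \<alpha> * mass (ball c ?t)) = mass (ball c ?t)"
    using \<alpha> by (simp add: mult.assoc[symmetric] flip: ennreal_mult)
  also have "ennreal (1 / \<alpha>) * mass (ball c ?s) \<le> ennreal (1 / \<alpha>) * (ennreal ((1 / \<alpha>) ^ k) * mass (ball c r))"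
    by (rule mult_left_mono[OF Suc.IH]) simp
  also have "\<dots> = ennreal ((1 / \<alpha>) ^ Suc k) * mass (ball c r)"
    using \<alpha> by (simp add: mult.assoc[symmetric] flip: ennreal_mult)
  finally show ?case .
qed

text \<open>Otherwise the rest of the ball would have proportion above 1 - \<alpha> and so carry at
  least \<alpha> times a mass of \<mu> times the volume. But w is below \<alpha> \<mu> / 2 there,
  which allows only half of that.\<close>

lemma superlevel_thick:
  assumes r: "0 < r" and \<mu>: "0 < \<mu>"
    and big: "ennreal (\<mu> * measure lborel (ball c r)) \<le> mass (ball c r)"
  shows "ennreal \<alpha> * emeasure lborel (ball c r) \<le> emeasure lborel ({z. \<alpha> * \<mu> / 2 \<le> w z} \<inter> ball c r)"
proof (rule ccontr)
  let ?B = "ball c r"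
  define S where "S = {z. \<alpha> * \<mu> / 2 \<le> w z}"
  have S [measurable]: "S \<in> sets borel" unfolding S_def by measurable
  define m where "m = measure lborel ?B"
  have m: "0 < m" unfolding m_def using r by (rule measure_ball_pos)
  have fin: "emeasure lborel (S \<inter> ?B) = ennreal (measure lborel (S \<inter> ?B))"
  proof (rule emeasure_eq_ennreal_measure)
    have "emeasure lborel (S \<inter> ?B) \<le> emeasure lborel ?B" by (intro emeasure_mono) auto
    also have "\<dots> < \<infinity>" by (rule emeasure_lborel_ball_finite)
    finally show "emeasure lborel (S \<inter> ?B) \<noteq> top" by simp
  qed
  assume "\<not> ?thesis"
  then have "emeasure lborel (S \<inter> ?B) < ennreal \<alpha> * emeasure lborel ?B"
    unfolding S_def not_le .
  then have "ennreal (measure lborel (S \<inter> ?B)) < ennreal \<alpha> * ennreal m"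
    by (simp only: fin emeasure_ball_eq m_def)
  then have less: "measure lborel (S \<inter> ?B) < \<alpha> * m"
    using \<alpha> m by (simp add: ennreal_less_iff flip: ennreal_mult)
  define E where "E = ?B - S"
  have E [measurable]: "E \<in> sets borel" unfolding E_def by simp
  have "measure lborel E = m - measure lborel (S \<inter> ?B)"
  proof -
    have "measure lborel (?B - (S \<inter> ?B)) = measure lborel ?B - measure lborel (S \<inter> ?B)"
      using emeasure_lborel_ball_finite[of c r] by (intro measure_Diff) auto
    moreover have "?B - (S \<inter> ?B) = E" by (auto simp: E_def)
    ultimately show ?thesis by (simp add: m_def)
  qed
  then have "(1 - \<alpha>) * m \<le> measure lborel E" using less by (simp add: left_diff_distrib)
  then have "ennreal \<alpha> * mass ?B \<le> mass E"
    unfolding mass_def m_def by (intro A_infty_ineq r E) (auto simp: E_def)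
  also have "mass E \<le> (\<integral>\<^sup>+x. ennreal (\<alpha> * \<mu> / 2) * indicator ?B x \<partial>lborel)"
    unfolding mass_def by (intro nn_integral_mono) (auto simp: E_def S_def indicator_def intro!: ennreal_leI)
  also have "\<dots> = ennreal (\<alpha> * \<mu> / 2) * ennreal m"
    by (subst nn_integral_cmult_indicator) (auto simp: emeasure_ball_eq m_def)
  finally have "ennreal \<alpha> * ennreal (\<mu> * m) \<le> ennreal (\<alpha> * \<mu> / 2) * ennreal m"
    using mult_left_mono[OF big, of "ennreal \<alpha>"] by (simp add: m_def)
  then have "\<alpha> * (\<mu> * m) \<le> \<alpha> * \<mu> / 2 * m"
    using \<alpha> \<mu> m by (simp flip: ennreal_mult)
  moreover have "0 < \<alpha> * \<mu> * m" using \<alpha> \<mu> m by simp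
  ultimately show False by (simp add: mult.assoc)
qed

text \<open>Passing from radius sqrt h to the fraction \<open>\<theta> ^ k\<close> of it keeps at
  least the fraction \<open>\<alpha> ^ k\<close> of the mass while the volume only shrinks, so the
  small balls still have average at least \<open>\<alpha> ^ k * l\<close>. This is the level given
  to \<open>superlevel_thick\<close>; the rest is rescaling by sqrt h.\<close>

lemma superlevel_thick_dilated:
  fixes l h :: real and k :: nat and z :: 'a
  assumes h: "0 < h" and l: "0 < l"
    and big: "\<And>c. ennreal (l * measure lborel (ball c (sqrt h))) \<le> mass (ball c (sqrt h))"
  defines "S \<equiv> {z. \<alpha> * (\<alpha> ^ k * l) / 2 \<le> w (sqrt h *\<^sub>R z)}"
  shows "S \<in> sets borel"
    and "ennreal \<alpha> * emeasure lborel (ball (0::'a) (\<theta> ^ k)) \<le> emeasure lborel (S \<inter> ball z (\<theta> ^ k))"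
proof -
  define T where "T = {z. \<alpha> * (\<alpha> ^ k * l) / 2 \<le> w z}"
  have T [measurable]: "T \<in> sets borel" unfolding T_def by measurable
  show S [measurable]: "S \<in> sets borel" unfolding S_def by measurable
  define \<delta> where "\<delta> = \<theta> ^ k"
  have \<delta>: "0 < \<delta>" "\<delta> \<le> 1" using \<theta> by (auto simp: \<delta>_def power_le_one)
  define r where "r = sqrt h * \<delta>"
  have r: "0 < r" "r \<le> sqrt h" using h \<delta> by (auto simp: r_def mult_left_le)
  define c where "c = sqrt h *\<^sub>R z"
  have "ennreal (\<alpha> ^ k * l * measure lborel (ball c r)) \<le> mass (ball c r)"
  proof -
    have "r / \<theta> ^ k = sqrt h" using \<theta> by (simp add: r_def \<delta>_def)
    then have "mass (ball c (sqrt h)) \<le> ennreal ((1 / \<alpha>) ^ k) * mass (ball c r)"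
      using mass_doubling[OF r(1), of c k] by simp
    then have "ennreal (\<alpha> ^ k) * mass (ball c (sqrt h)) \<le> ennreal (\<alpha> ^ k) * (ennreal ((1 / \<alpha>) ^ k) * mass (ball c r))"
      by (rule mult_left_mono) simp
    also have "\<dots> = mass (ball c r)"
      using \<alpha> by (simp add: mult.assoc[symmetric] power_one_over flip: ennreal_mult)
    finally have 1: "ennreal (\<alpha> ^ k) * mass (ball c (sqrt h)) \<le> mass (ball c r)" .
    have "measure lborel (ball c r) \<le> measure lborel (ball c (sqrt h))"
      using r emeasure_lborel_ball_finite[of c "sqrt h"]
      by (intro measure_mono_fmeasurable) (auto simp: fmeasurable_def)
    then have "ennreal (\<alpha> ^ k * l * measure lborel (ball c r)) \<le> ennreal (\<alpha> ^ k * (l * measure lborel (ball c (sqrt h))))"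
      using \<alpha> l by (intro ennreal_leI) (simp add: mult.assoc mult_left_mono)
    also have "\<dots> = ennreal (\<alpha> ^ k) * ennreal (l * measure lborel (ball c (sqrt h)))"
      using \<alpha> l by (intro ennreal_mult) auto
    also have "\<dots> \<le> ennreal (\<alpha> ^ k) * mass (ball c (sqrt h))"
      by (intro mult_left_mono big) simp
    finally show ?thesis using 1 by (rule order_trans)
  qed
  then have "ennreal \<alpha> * emeasure lborel (ball c r) \<le> emeasure lborel (T \<inter> ball c r)"
    unfolding T_def using \<alpha> l by (intro superlevel_thick r) auto
  moreover have "emeasure lborel (T \<inter> ball c r) = ennreal (sqrt h ^ DIM('a)) * emeasure lborel (S \<inter> ball z \<delta>)"
  proof -
    have "emeasure lborel (T \<inter> ball c r) = (\<integral>\<^sup>+x. indicator (T \<inter> ball c r) x \<partial>lborel)"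
      by (rule nn_integral_indicator[symmetric]) simp
    also have "\<dots> = ennreal (\<bar>sqrt h\<bar> ^ DIM('a)) * (\<integral>\<^sup>+x. indicator (T \<inter> ball c r) (0 + sqrt h *\<^sub>R x) \<partial>lborel)"
      using h by (intro nn_integral_lborel_affine borel_measurable_indicator) auto
    also have "(\<integral>\<^sup>+x. indicator (T \<inter> ball c r) (0 + sqrt h *\<^sub>R x) \<partial>lborel) = (\<integral>\<^sup>+x. indicator (S \<inter> ball z \<delta>) x \<partial>lborel)"
    proof (intro nn_integral_cong)
      fix x
      have "dist (sqrt h *\<^sub>R z) (sqrt h *\<^sub>R x) = sqrt h * dist z x"
        using h by (simp add: dist_norm flip: scaleR_diff_right)
      then have "sqrt h *\<^sub>R x \<in> ball c r \<longleftrightarrow> x \<in> ball z \<delta>" using h by (simp add: c_def r_def)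
      then show "indicator (T \<inter> ball c r) (0 + sqrt h *\<^sub>R x) = (indicator (S \<inter> ball z \<delta>) x :: ennreal)"
        by (auto simp: indicator_def S_def T_def)
    qed
    also have "\<dots> = emeasure lborel (S \<inter> ball z \<delta>)" by (rule nn_integral_indicator) simp
    finally show ?thesis using h by simp
  qed
  moreover have "emeasure lborel (ball c r) = ennreal (sqrt h ^ DIM('a)) * emeasure lborel (ball (0::'a) \<delta>)"
  proof -
    have "measure lborel (ball c r) = r ^ DIM('a) * measure lborel (ball (0::'a) 1)"
      using r by (intro content_ball_conv_unit_ball) simp
    moreover have "measure lborel (ball (0::'a) \<delta>) = \<delta> ^ DIM('a) * measure lborel (ball (0::'a) 1)"
      using \<delta> by (intro content_ball_conv_unit_ball) simp
    ultimately have "measure lborel (ball c r) = sqrt h ^ DIM('a) * measure lborel (ball (0::'a) \<delta>)"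
      by (simp add: r_def power_mult_distrib)
    then show ?thesis using h by (simp add: emeasure_ball_eq ennreal_mult)
  qed
  ultimately have "ennreal (sqrt h ^ DIM('a)) * (ennreal \<alpha> * emeasure lborel (ball (0::'a) \<delta>)) \<le>
      ennreal (sqrt h ^ DIM('a)) * emeasure lborel (S \<inter> ball z \<delta>)"
    by (simp add: mult.left_commute)
  then show "ennreal \<alpha> * emeasure lborel (ball (0::'a) (\<theta> ^ k)) \<le> emeasure lborel (S \<inter> ball z (\<theta> ^ k))"
    unfolding \<delta>_def[symmetric] using h by (subst (asm) ennreal_mult_le_mult_iff) auto
qed

end

section \<open>The anti-Wick form\<close>

text \<open>Finite energy of the coherent states puts them into the form domain; here it takes the
  place of a growth condition on the symbol.\<close>

locale antiwick_setting =
  fixes \<phi> :: "real^'n \<Rightarrow> complex" and h :: real and a w :: "(real^'n) \<times> (real^'n) \<Rightarrow> real"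
  assumes schwartz: "schwartz \<phi>" and norm1: "l2_norm \<phi> = 1" and h: "0 < h"
    and w_measurable [measurable]: "w \<in> borel_measurable borel" and w_nonneg: "\<And>z. 0 \<le> w z"
    and aw: "AE z in lebesgue. a z = w z"
    and coherent_energy_finite: "\<And>z. (\<integral>\<^sup>+v. ennreal (w v) *
      ennreal ((cmod (l2_inner (coherent_state \<phi> h z) (coherent_state \<phi> h v)))\<^sup>2) \<partial>lborel) < \<infinity>"
begin

definition transform :: "(real^'n \<Rightarrow> complex) \<Rightarrow> (real^'n) \<times> (real^'n) \<Rightarrow> complex" where
  "transform f z = l2_inner f (coherent_state \<phi> h z)"

definition energy :: "(real^'n \<Rightarrow> complex) \<Rightarrow> ennreal" where
  "energy f = (\<integral>\<^sup>+z. ennreal (w z) * ennreal ((cmod (transform f z))\<^sup>2) \<partial>lborel)"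

definition K :: real where "K = (2 * pi * h) powr (- real CARD('n))"

abbreviation D where "D \<equiv> antiwick_form_domain \<phi> a h"
abbreviation b where "b \<equiv> antiwick_form \<phi> a h"

lemma K_pos: "0 < K" using h by (simp add: K_def)

lemmas coh = coherent_state_norm[OF schwartz norm1 h]

lemma transform_measurable [measurable]: "f \<in> L2 \<Longrightarrow> transform f \<in> borel_measurable borel"
  unfolding transform_def[abs_def] by (rule coherent_transform_measurable[OF schwartz norm1 h])

lemma transform_add: "f \<in> L2 \<Longrightarrow> g \<in> L2 \<Longrightarrow> transform (f + g) z = transform f z + transform g z"
  by (simp add: transform_def L2.ip_add coh)

lemma transform_diff: "f \<in> L2 \<Longrightarrow> g \<in> L2 \<Longrightarrow> transform (f - g) z = transform f z - transform g z"
  by (simp add: transform_def L2.ip_diff coh)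

lemma transform_scale: "f \<in> L2 \<Longrightarrow> transform (fscale c f) z = c * transform f z"
  by (simp add: transform_def L2.ip_scale coh)

lemma quadratic_form_eq: "antiwick_quadratic_form \<phi> a h f = ennreal K * energy f"
proof -
  have "AE z in lebesgue. ennreal (a z * (cmod (transform f z))\<^sup>2) = ennreal (w z) * ennreal ((cmod (transform f z))\<^sup>2)"
    using aw by eventually_elim (simp add: w_nonneg ennreal_mult)
  then have "(\<integral>\<^sup>+z. ennreal (a z * (cmod (transform f z))\<^sup>2) \<partial>lebesgue) =
      (\<integral>\<^sup>+z. ennreal (w z) * ennreal ((cmod (transform f z))\<^sup>2) \<partial>lebesgue)"
    by (rule nn_integral_cong_AE)
  then show ?thesis
    by (simp add: antiwick_quadratic_form_def energy_def K_def transform_def nn_integral_completion)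
qed

lemma D_iff_energy: "f \<in> D \<longleftrightarrow> f \<in> L2 \<and> energy f < \<infinity>"
  using K_pos by (auto simp: antiwick_form_domain_def quadratic_form_eq ennreal_mult_less_top)

lemma D_iff: "f \<in> D \<longleftrightarrow> f \<in> L2 \<and> integrable lborel (\<lambda>z. w z * (cmod (transform f z))\<^sup>2)"
proof (cases "f \<in> L2")
  case True
  note [measurable] = transform_measurable[OF True]
  have "energy f = (\<integral>\<^sup>+z. ennreal (norm (w z * (cmod (transform f z))\<^sup>2)) \<partial>lborel)"
    unfolding energy_def by (intro nn_integral_cong) (simp add: w_nonneg ennreal_mult)
  then show ?thesis using True by (simp add: D_iff_energy integrable_iff_bounded)
qed (simp add: D_iff_energy)

lemma D_L2: "f \<in> D \<Longrightarrow> f \<in> L2" and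
  D_integrable: "f \<in> D \<Longrightarrow> integrable lborel (\<lambda>z. w z * (cmod (transform f z))\<^sup>2)"
  by (simp_all add: D_iff)

lemma energy_eq: "f \<in> D \<Longrightarrow> energy f = ennreal (LINT z|lborel. w z * (cmod (transform f z))\<^sup>2)"
  unfolding energy_def
  by (subst nn_integral_eq_integral[symmetric, OF D_integrable]) (auto simp: w_nonneg ennreal_mult intro!: nn_integral_cong)

lemma form_eq:
  assumes f: "f \<in> L2" and g: "g \<in> L2"
  shows "b f g = K * (CLINT z|lborel. complex_of_real (w z) * (transform f z * cnj (transform g z)))"
proof -
  note [measurable] = transform_measurable[OF f] transform_measurable[OF g]
  have am: "a \<in> borel_measurable lebesgue"
  proof (rule borel_measurable_AE)
    show "w \<in> borel_measurable lebesgue" by (rule borel_imp_lebesgue) simp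
    show "AE z in lebesgue. w z = a z" using aw by eventually_elim simp
  qed
  have fm: "transform f \<in> borel_measurable lebesgue" "transform g \<in> borel_measurable lebesgue"
    by (auto intro: borel_imp_lebesgue)
  have "(CLINT z|lebesgue. complex_of_real (a z) * transform f z * cnj (transform g z)) =
      (CLINT z|lebesgue. complex_of_real (w z) * (transform f z * cnj (transform g z)))"
  proof (rule integral_cong_AE)
    show "(\<lambda>z. complex_of_real (a z) * transform f z * cnj (transform g z)) \<in> borel_measurable lebesgue"
      using am fm by measurable
    show "(\<lambda>z. complex_of_real (w z) * (transform f z * cnj (transform g z))) \<in> borel_measurable lebesgue"
      by (intro borel_imp_lebesgue) measurable
    show "AE z in lebesgue. complex_of_real (a z) * transform f z * cnj (transform g z) =
        complex_of_real (w z) * (transform f z * cnj (transform g z))"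
      using aw by eventually_elim simp
  qed
  also have "\<dots> = (CLINT z|lborel. complex_of_real (w z) * (transform f z * cnj (transform g z)))"
    by (rule integral_completion) measurable
  finally show ?thesis by (simp add: antiwick_form_def K_def transform_def)
qed

lemma form_integrable:
  assumes f: "f \<in> D" and g: "g \<in> D"
  shows "integrable lborel (\<lambda>z. complex_of_real (w z) * (transform f z * cnj (transform g z)))"
proof (rule Bochner_Integration.integrable_bound)
  note [measurable] = transform_measurable[OF D_L2[OF f]] transform_measurable[OF D_L2[OF g]]
  show "integrable lborel (\<lambda>z. w z * (cmod (transform f z))\<^sup>2 + w z * (cmod (transform g z))\<^sup>2)"
    by (intro Bochner_Integration.integrable_add D_integrable f g)
  show "(\<lambda>z. complex_of_real (w z) * (transform f z * cnj (transform g z))) \<in> borel_measurable lborel"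
    by measurable
  show "AE z in lborel. norm (complex_of_real (w z) * (transform f z * cnj (transform g z))) \<le>
      norm (w z * (cmod (transform f z))\<^sup>2 + w z * (cmod (transform g z))\<^sup>2)"
  proof (rule AE_I2)
    fix z
    have "w z * norm (transform f z * cnj (transform g z)) \<le> w z * ((norm (transform f z))\<^sup>2 + (norm (cnj (transform g z)))\<^sup>2)"
      by (intro mult_left_mono norm_mult_le_squares w_nonneg)
    then show "norm (complex_of_real (w z) * (transform f z * cnj (transform g z))) \<le>
      norm (w z * (cmod (transform f z))\<^sup>2 + w z * (cmod (transform g z))\<^sup>2)"
      using w_nonneg[of z] by (simp add: norm_mult distrib_left)
  qed
qed

lemma form_self: "f \<in> D \<Longrightarrow> Re (b f f) = K * (LINT z|lborel. w z * (cmod (transform f z))\<^sup>2)"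
proof -
  assume f: "f \<in> D"
  have eq: "complex_of_real (w z) * (transform f z * cnj (transform f z)) = complex_of_real (w z * (cmod (transform f z))\<^sup>2)" for z
    by (simp only: of_real_mult complex_norm_square)
  have "b f f = complex_of_real (K * (LINT z|lborel. w z * (cmod (transform f z))\<^sup>2))"
    unfolding form_eq[OF D_L2[OF f] D_L2[OF f]] eq integral_complex_of_real by simp
  then show ?thesis by simp
qed

lemma form_self_energy: "f \<in> D \<Longrightarrow> ennreal (Re (b f f)) = ennreal K * energy f"
  using K_pos w_nonneg by (simp add: form_self energy_eq ennreal_mult)

lemma semi_inner_form: "semi_inner fscale D b"
proof (rule semi_inner.intro[OF vector_space_fscale], unfold_locales)
  interpret vector_space fscale by (rule vector_space_fscale)
  show "module.subspace fscale D"
  proof (rule subspaceI)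
    have "transform 0 z = 0" for z using transform_scale[of 0 0 z] by (simp add: L2_zero)
    then show "0 \<in> D" by (simp add: D_iff L2_zero)
  next
    fix f g assume f: "f \<in> D" and g: "g \<in> D"
    note [measurable] = transform_measurable[OF D_L2[OF f]] transform_measurable[OF D_L2[OF g]]
    have "integrable lborel (\<lambda>z. w z * (cmod (transform f z + transform g z))\<^sup>2)"
    proof (rule Bochner_Integration.integrable_bound)
      show "integrable lborel (\<lambda>z. 2 * (w z * (cmod (transform f z))\<^sup>2) + 2 * (w z * (cmod (transform g z))\<^sup>2))"
        by (intro Bochner_Integration.integrable_add integrable_mult_right D_integrable f g)
      show "AE z in lborel. norm (w z * (cmod (transform f z + transform g z))\<^sup>2) \<le>
        norm (2 * (w z * (cmod (transform f z))\<^sup>2) + 2 * (w z * (cmod (transform g z))\<^sup>2))"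
      proof (rule AE_I2)
        fix z
        have "w z * (cmod (transform f z + transform g z))\<^sup>2 \<le> w z * (2 * (cmod (transform f z))\<^sup>2 + 2 * (cmod (transform g z))\<^sup>2)"
          by (intro mult_left_mono norm_add_square_le w_nonneg)
        then show "norm (w z * (cmod (transform f z + transform g z))\<^sup>2) \<le>
          norm (2 * (w z * (cmod (transform f z))\<^sup>2) + 2 * (w z * (cmod (transform g z))\<^sup>2))"
          using w_nonneg[of z] by (simp add: algebra_simps)
      qed
    qed measurable
    then show "f + g \<in> D" using f g by (simp add: D_iff transform_add L2_add)
  next
    fix c f assume f: "f \<in> D"
    have "integrable lborel (\<lambda>z. (cmod c)\<^sup>2 * (w z * (cmod (transform f z))\<^sup>2))"
      by (intro integrable_mult_right D_integrable f)
    then show "fscale c f \<in> D"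
      using f by (simp add: D_iff transform_scale L2_fscale norm_mult power_mult_distrib mult.left_commute)
  qed
next
  fix f g k assume f: "f \<in> D" and g: "g \<in> D" and k: "k \<in> D"
  have "complex_of_real (w z) * (transform (f + g) z * cnj (transform k z)) =
      complex_of_real (w z) * (transform f z * cnj (transform k z)) +
      complex_of_real (w z) * (transform g z * cnj (transform k z))" for z
    using f g by (simp add: transform_add D_L2 algebra_simps)
  then show "b (f + g) k = b f k + b g k"
    using f g k by (simp add: form_eq D_L2 L2_add Bochner_Integration.integral_add form_integrable distrib_left)
next
  fix c f k assume f: "f \<in> D" and k: "k \<in> D"
  have eq: "complex_of_real (w z) * (transform (fscale c f) z * cnj (transform k z)) =
      c * (complex_of_real (w z) * (transform f z * cnj (transform k z)))" for z
    using f by (simp add: transform_scale D_L2)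
  have "b (fscale c f) k = K * (c * (CLINT z|lborel. complex_of_real (w z) * (transform f z * cnj (transform k z))))"
    unfolding form_eq[OF L2_fscale[OF D_L2[OF f]] D_L2[OF k]] eq by simp
  then show "b (fscale c f) k = c * b f k"
    using f k by (simp add: form_eq D_L2)
next
  fix f g assume f: "f \<in> D" and g: "g \<in> D"
  show "b g f = cnj (b f g)"
    using f g by (simp add: form_eq D_L2 mult.commute mult.left_commute flip: Bochner_Integration.integral_cnj)
next
  fix f assume "f \<in> D"
  then show "0 \<le> Re (b f f)" using K_pos w_nonneg by (simp add: form_self)
qed

lemma semi_inner_form_plus: "semi_inner fscale D (\<lambda>f g. b f g + l2_inner f g)"
proof -
  interpret b: semi_inner fscale D b by (rule semi_inner_form)
  show ?thesis
  proof unfold_locales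
    show "L2.subspace D" by (rule b.sub)
  next
    fix f g assume "f \<in> D" "g \<in> D"
    then show "b g f + l2_inner g f = cnj (b f g + l2_inner f g)"
      using b.ip_commute[of f g] L2.ip_commute[of f g] by (simp add: D_L2)
  next
    fix f assume "f \<in> D"
    then show "0 \<le> Re (b f f + l2_inner f f)"
      using b.ip_self_nonneg[of f] L2.ip_self_nonneg[of f] by (simp add: D_L2)
  qed (auto simp: b.ip_simps L2.ip_simps D_L2 distrib_left)
qed

text \<open>Closedness is Fatou's lemma, since convergence in \<open>L\<^sup>2\<close> implies pointwise convergence of the
  transforms.\<close>

lemma energy_fatou:
  assumes s: "\<And>n. s n \<in> L2" and u: "u \<in> L2" and g: "g \<in> L2"
    and lim: "(\<lambda>n::nat. l2_norm (s n - u)) \<longlonglongrightarrow> 0"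
    and bound: "\<And>n. n \<ge> N \<Longrightarrow> energy (s n - g) \<le> e"
  shows "energy (u - g) \<le> e"
proof -
  note [measurable] = transform_measurable[OF s] transform_measurable[OF u] transform_measurable[OF g]
    transform_measurable[OF L2.V_closed(3)[OF s g]]
  have "energy (u - g) = (\<integral>\<^sup>+z. liminf (\<lambda>n. ennreal (w z) * ennreal ((cmod (transform (s n - g) z))\<^sup>2)) \<partial>lborel)"
    unfolding energy_def
  proof (rule nn_integral_cong)
    fix z
    have "(\<lambda>n. transform (s n) z) \<longlonglongrightarrow> transform u z"
      unfolding transform_def using lim s u coh by (intro L2.ip_tendsto) (auto simp: L2_nrm)
    then have "(\<lambda>n. ennreal (w z * (cmod (transform (s n) z - transform g z))\<^sup>2)) \<longlonglongrightarrow>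
        ennreal (w z * (cmod (transform u z - transform g z))\<^sup>2)"
      by (intro tendsto_intros)
    then have "(\<lambda>n. ennreal (w z) * ennreal ((cmod (transform (s n - g) z))\<^sup>2)) \<longlonglongrightarrow>
        ennreal (w z) * ennreal ((cmod (transform (u - g) z))\<^sup>2)"
      using s u g by (simp add: transform_diff ennreal_mult w_nonneg)
    then show "ennreal (w z) * ennreal ((cmod (transform (u - g) z))\<^sup>2) =
        liminf (\<lambda>n. ennreal (w z) * ennreal ((cmod (transform (s n - g) z))\<^sup>2))"
      by (intro lim_imp_Liminf[symmetric]) auto
  qed
  also have "\<dots> \<le> liminf (\<lambda>n. energy (s n - g))"
    unfolding energy_def by (intro nn_integral_liminf) measurable
  also have "\<dots> \<le> liminf (\<lambda>n. e)"
    using bound by (intro Liminf_mono eventually_sequentiallyI[of N])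
  also have "\<dots> = e" by (simp add: Liminf_const)
  finally show ?thesis .
qed

lemma semi_hilbert_form_plus: "semi_hilbert fscale D (\<lambda>f g. b f g + l2_inner f g)"
proof -
  interpret b: semi_inner fscale D b by (rule semi_inner_form)
  interpret b1: semi_inner fscale D "\<lambda>f g. b f g + l2_inner f g" by (rule semi_inner_form_plus)
  have sq1: "b1.sq f = Re (b f f) + (l2_norm f)\<^sup>2" for f
    by (simp add: b1.sq_def l2_inner_self l2_norm_def)
  show ?thesis
  proof unfold_locales
    fix s :: "nat \<Rightarrow> _" assume s: "\<And>n. s n \<in> D"
      and cauchy: "\<And>e. 0 < e \<Longrightarrow> \<exists>N. \<forall>m\<ge>N. \<forall>n\<ge>N. b1.nrm (s m - s n) < e"
    have sL: "s n \<in> L2" for n using s D_L2 by auto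
    have dD: "s m - s n \<in> D" for m n using s by (intro b.V_closed)
    have le: "l2_norm (s m - s n) \<le> b1.nrm (s m - s n)" "Re (b (s m - s n) (s m - s n)) \<le> (b1.nrm (s m - s n))\<^sup>2" for m n
    proof -
      have "(l2_norm (s m - s n))\<^sup>2 \<le> (b1.nrm (s m - s n))\<^sup>2"
        using b.ip_self_nonneg[OF dD] by (simp add: b1.nrm_power2 dD sq1)
      then show "l2_norm (s m - s n) \<le> b1.nrm (s m - s n)"
        using b1.nrm_nonneg[OF dD] by (rule power2_le_imp_le)
      show "Re (b (s m - s n) (s m - s n)) \<le> (b1.nrm (s m - s n))\<^sup>2"
        by (simp add: b1.nrm_power2 dD sq1)
    qed
    have "\<exists>N. \<forall>m\<ge>N. \<forall>n\<ge>N. L2.nrm (s m - s n) < e" if e: "0 < e" for e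
    proof -
      obtain N where "\<forall>m\<ge>N. \<forall>n\<ge>N. b1.nrm (s m - s n) < e" using cauchy[OF e] by blast
      then show ?thesis
        unfolding L2_nrm by (intro exI[of _ N] allI impI le_less_trans[OF le(1)]) blast
    qed
    then obtain u where u: "u \<in> L2" "(\<lambda>n. L2.nrm (s n - u)) \<longlonglongrightarrow> 0" using L2.complete[of s] sL by blast
    have ulim: "(\<lambda>n. l2_norm (s n - u)) \<longlonglongrightarrow> 0" using u(2) by (simp add: L2_nrm)
    \<comment> \<open>Apply \<open>energy_fatou\<close> to s m - s n as m grows. The tolerance
      appears as a square root because \<open>nrm\<close> is one, and divided by K because
      \<open>energy\<close> omits the prefactor.\<close>
    have tail: "\<exists>N. \<forall>n\<ge>N. u - s n \<in> D \<and> Re (b (u - s n) (u - s n)) \<le> e" if e: "0 < e" for e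
    proof -
      obtain N where N: "\<And>m n. m \<ge> N \<Longrightarrow> n \<ge> N \<Longrightarrow> b1.nrm (s m - s n) < sqrt e" using cauchy[of "sqrt e"] e by auto
      have "u - s n \<in> D \<and> Re (b (u - s n) (u - s n)) \<le> e" if n: "n \<ge> N" for n
      proof -
        have "energy (s m - s n) \<le> ennreal (e / K)" if "m \<ge> N" for m
        proof -
          have "(b1.nrm (s m - s n))\<^sup>2 \<le> (sqrt e)\<^sup>2"
            using N[OF that n] b1.nrm_nonneg[OF dD] by (intro power_mono) auto
          then have "Re (b (s m - s n) (s m - s n)) \<le> e" using le(2)[of m n] e by simp
          then have "(LINT z|lborel. w z * (cmod (transform (s m - s n) z))\<^sup>2) \<le> e / K"
            using K_pos by (simp add: form_self dD field_simps)
          then show ?thesis by (simp add: energy_eq dD ennreal_leI)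
        qed
        then have en: "energy (u - s n) \<le> ennreal (e / K)" by (rule energy_fatou[OF sL u(1) sL ulim])
        have uD: "u - s n \<in> D"
          using en u(1) sL by (auto simp: D_iff_energy le_less_trans)
        have "ennreal (Re (b (u - s n) (u - s n))) \<le> ennreal K * ennreal (e / K)"
          unfolding form_self_energy[OF uD] by (intro mult_left_mono en) simp
        also have "\<dots> = ennreal e" using K_pos e by (simp flip: ennreal_mult)
        finally show ?thesis using uD e by simp
      qed
      then show ?thesis by blast
    qed
    obtain N where "u - s N \<in> D" using tail[of 1] by auto
    then have "(u - s N) + s N \<in> D" using s by (rule b.V_closed(2))
    then have uD: "u \<in> D" by simp
    have "(\<lambda>n. Re (b (s n - u) (s n - u))) \<longlonglongrightarrow> 0"
    proof (rule LIMSEQ_I)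
      fix e :: real assume e: "0 < e"
      obtain N where N: "\<And>n. n \<ge> N \<Longrightarrow> Re (b (u - s n) (u - s n)) \<le> e / 2" using tail[of "e / 2"] e by auto
      have "norm (Re (b (s n - u) (s n - u)) - 0) < e" if "n \<ge> N" for n
      proof -
        have "b.nrm (s n - u) = b.nrm (u - s n)" by (intro b.nrm_minus_commute s uD)
        then have "Re (b (s n - u) (s n - u)) = Re (b (u - s n) (u - s n))" by (simp add: b.nrm_def b.sq_def)
        moreover have "0 \<le> Re (b (s n - u) (s n - u))" using s uD by (intro b.ip_self_nonneg) auto
        ultimately show ?thesis using N[OF that] e by simp
      qed
      then show "\<exists>N. \<forall>n\<ge>N. norm (Re (b (s n - u) (s n - u)) - 0) < e" by blast
    qed
    then have "(\<lambda>n. sqrt (Re (b (s n - u) (s n - u)) + (l2_norm (s n - u))\<^sup>2)) \<longlonglongrightarrow> sqrt (0 + 0\<^sup>2)"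
      by (intro tendsto_intros ulim)
    then show "\<exists>u\<in>D. (\<lambda>n. b1.nrm (s n - u)) \<longlonglongrightarrow> 0"
      using uD by (intro bexI[of _ u]) (simp_all add: b1.nrm_def sq1)
  qed
qed

lemma coherent_state_in_D: "coherent_state \<phi> h z \<in> D"
  using coherent_energy_finite[of z] coh(1) by (simp add: D_iff_energy energy_def transform_def)

text \<open>Density comes from the linear span of the coherent states, which lies in the form domain
  and has only null vectors orthogonal to it.\<close>

lemma l2_form_antiwick: "l2_form D b"
proof -
  interpret b: semi_inner fscale D b by (rule semi_inner_form)
  interpret b1: semi_hilbert fscale D "\<lambda>f g. b f g + l2_inner f g" by (rule semi_hilbert_form_plus)
  show ?thesis
  proof
    show "D \<subseteq> L2" using D_L2 by auto
  next
    fix f :: "real^'n \<Rightarrow> complex" assume f: "f \<in> L2" "l2_norm f = 0"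
    have t: "transform f z = 0" for z unfolding transform_def by (intro L2_inner_null f coh)
    show fD: "f \<in> D" using f by (simp add: D_iff t)
    show "b f f = 0" using f by (simp add: form_eq t)
  next
    fix f :: "real^'n \<Rightarrow> complex" and e :: real assume f: "f \<in> L2" and e: "0 < e"
    let ?W = "L2.span (range (coherent_state \<phi> h))"
    have WD: "?W \<subseteq> D" using coherent_state_in_D b.sub by (intro L2.span_minimal) auto
    have "\<exists>s. (\<forall>n. s n \<in> ?W) \<and> (\<lambda>n::nat. L2.nrm (s n - f)) \<longlonglongrightarrow> 0"
    proof (rule L2.dense_if_orthogonal_null[OF L2.subspace_span _ _ f])
      show "?W \<subseteq> L2" using WD D_L2 by blast
      fix v :: "real^'n \<Rightarrow> complex" assume v: "v \<in> L2" and orth: "\<And>u. u \<in> ?W \<Longrightarrow> l2_inner u v = 0"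
      have "l2_norm v = 0"
        by (rule coherent_states_total[OF schwartz norm1 h v], rule orth) (intro L2.span_base rangeI)
      then show "L2.nrm v = 0" by (simp add: L2_nrm)
    qed
    then obtain s where s: "\<And>n. s n \<in> ?W" "(\<lambda>n::nat. L2.nrm (s n - f)) \<longlonglongrightarrow> 0" by blast
    have "\<forall>\<^sub>F n in sequentially. L2.nrm (s n - f) < e" using s(2) e by (rule order_tendstoD)
    then obtain n where n: "L2.nrm (s n - f) < e" by (auto simp: eventually_sequentially)
    have "s n \<in> D" using s(1) WD by blast
    then show "\<exists>g\<in>D. l2_norm (f - g) < e"
      using n L2.nrm_minus_commute[OF D_L2 f] by (intro bexI[of _ "s n"]) (simp_all add: L2_nrm)
  qed
qed

lemma antiwick_operator_eq: "antiwick_operator \<phi> a h = l2_form.op_graph D b"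
  unfolding antiwick_operator_def by (rule l2_form.op_graph_unique[OF l2_form_antiwick])

text \<open>The lower bound is asked of all of \<open>L2\<close> in the extended reals: outside the
  form domain the energy is infinite, so no case distinction is left to the user.\<close>

lemma spectrum_antiwick_ge:
  assumes low: "\<And>f. f \<in> L2 \<Longrightarrow> ennreal (c * (l2_norm f)\<^sup>2) \<le> ennreal K * energy f"
    and z: "z \<in> spectrum (antiwick_operator \<phi> a h)"
  shows "c \<le> Re z"
proof (rule l2_form.spectrum_above[OF l2_form_antiwick])
  fix f assume f: "f \<in> D"
  have "0 \<le> Re (b f f)" using f by (rule semi_inner.ip_self_nonneg[OF semi_inner_form])
  moreover have "ennreal (c * (l2_norm f)\<^sup>2) \<le> ennreal (Re (b f f))"
    using low[OF D_L2[OF f]] by (simp add: form_self_energy f)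
  ultimately show "c * (l2_norm f)\<^sup>2 \<le> Re (b f f)" by simp
qed (use z in \<open>simp add: antiwick_operator_eq\<close>)

lemma spectrum_antiwick_le:
  assumes up: "ennreal K * energy (coherent_state \<phi> h z) \<le> ennreal c" and c: "0 \<le> c"
  shows "\<exists>\<zeta>\<in>spectrum (antiwick_operator \<phi> a h). Re \<zeta> \<le> c"
proof -
  obtain \<zeta> where "\<zeta> \<in> spectrum (antiwick_operator \<phi> a h)"
    "Re \<zeta> \<le> Re (b (coherent_state \<phi> h z) (coherent_state \<phi> h z)) / (l2_norm (coherent_state \<phi> h z))\<^sup>2"
    using l2_form.spectrum_below_rayleigh[OF l2_form_antiwick coherent_state_in_D, of z] coh(2)[of z]
    by (auto simp: antiwick_operator_eq)
  moreover have "ennreal (Re (b (coherent_state \<phi> h z) (coherent_state \<phi> h z))) \<le> ennreal c"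
    using up by (simp add: form_self_energy coherent_state_in_D)
  ultimately show ?thesis using c coh(2)[of z] by (intro bexI[of _ \<zeta>]) auto
qed

end

section \<open>Energy estimates\<close>

text \<open>The overlap of two coherent states is the transform of the window by itself at the
  rescaled difference of centres. Its decay of order N beats the growth 1 / \<alpha> of the mass per
  factor 1 / \<theta> in radius, so the ball of radius sqrt h around z controls the whole
  integral.\<close>

lemma coherent_energy_le:
  fixes \<phi> :: "real^'n \<Rightarrow> complex" and w :: "(real^'n) \<times> (real^'n) \<Rightarrow> real"
  assumes w: "A_infty_weight w \<alpha> \<theta>" and schwartz: "schwartz \<phi>" and norm1: "l2_norm \<phi> = 1" and h: "0 < h"
    and decay: "\<And>z. (1 + norm z) ^ N * cmod (stft \<phi> \<phi> z) \<le> C" and C: "0 \<le> C"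
    and N: "\<theta> ^ N * (1 / \<alpha>) \<le> 1 / 2"
  shows "(\<integral>\<^sup>+v. ennreal (w v) * ennreal ((cmod (l2_inner (coherent_state \<phi> h z) (coherent_state \<phi> h v)))\<^sup>2) \<partial>lborel)
    \<le> ennreal (C\<^sup>2 * (2 / \<theta> ^ N)) * A_infty_weight.mass w (ball z (sqrt h))"
proof -
  interpret A_infty_weight w \<alpha> \<theta> by (rule w)
  note [measurable] = window_measurable[OF schwartz]
  have pt: "ennreal ((cmod (l2_inner (coherent_state \<phi> h z) (coherent_state \<phi> h v)))\<^sup>2) \<le>
      ennreal (C\<^sup>2) * ennreal (1 / (1 + norm (v - z) / sqrt h) ^ N)" for v
  proof -
    define u where "u = (1 / sqrt h) *\<^sub>R (v - z)"
    have "l2_inner (coherent_state \<phi> h z) (coherent_state \<phi> h v) =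
        stft (time_frequency_shift ((1 / sqrt h) *\<^sub>R z) \<phi>) \<phi> ((1 / sqrt h) *\<^sub>R v)"
      by (subst l2_inner_coherent_state)
        (simp_all add: h coherent_state_measurable dilate_coherent_state window_measurable[OF schwartz])
    then have "cmod (l2_inner (coherent_state \<phi> h z) (coherent_state \<phi> h v)) = cmod (stft \<phi> \<phi> u)"
      by (simp add: stft_time_frequency_shift window_measurable[OF schwartz] u_def scaleR_diff_right)
    moreover have "norm u = norm (v - z) / sqrt h" using h by (simp add: u_def)
    moreover have "(cmod (stft \<phi> \<phi> u))\<^sup>2 \<le> C\<^sup>2 * (1 / (1 + norm u) ^ N)"
    proof -
      \<comment> \<open>Only one of the two powers of q \<ge> 1 is kept, to match the form of the
        decay in \<open>nn_integral_decay_le\<close>.\<close>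
      define q where "q = (1 + norm u) ^ N"
      have q: "1 \<le> q" by (simp add: q_def one_le_power)
      have "(q * cmod (stft \<phi> \<phi> u))\<^sup>2 \<le> C\<^sup>2"
        using decay[of u] q by (intro power_mono) (auto simp: q_def)
      moreover have "q * (cmod (stft \<phi> \<phi> u))\<^sup>2 \<le> q\<^sup>2 * (cmod (stft \<phi> \<phi> u))\<^sup>2"
        using q by (intro mult_right_mono) (auto simp: power2_eq_square)
      ultimately have "q * (cmod (stft \<phi> \<phi> u))\<^sup>2 \<le> C\<^sup>2" by (simp add: power_mult_distrib)
      then show ?thesis using q by (simp add: q_def[symmetric] field_simps)
    qed
    ultimately show ?thesis using C h by (simp add: ennreal_leI flip: ennreal_mult)
  qed
  have "(\<integral>\<^sup>+v. ennreal (w v) * ennreal ((cmod (l2_inner (coherent_state \<phi> h z) (coherent_state \<phi> h v)))\<^sup>2) \<partial>lborel) \<le>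
      (\<integral>\<^sup>+v. ennreal (C\<^sup>2) * (ennreal (w v) * ennreal (1 / (1 + norm (v - z) / sqrt h) ^ N)) \<partial>lborel)"
  proof (rule nn_integral_mono)
    fix v
    show "ennreal (w v) * ennreal ((cmod (l2_inner (coherent_state \<phi> h z) (coherent_state \<phi> h v)))\<^sup>2) \<le>
        ennreal (C\<^sup>2) * (ennreal (w v) * ennreal (1 / (1 + norm (v - z) / sqrt h) ^ N))"
      using mult_left_mono[OF pt[of v], of "ennreal (w v)"] by (simp add: mult.left_commute)
  qed
  also have "\<dots> = ennreal (C\<^sup>2) * (\<integral>\<^sup>+v. ennreal (w v) * ennreal (1 / (1 + norm (v - z) / sqrt h) ^ N) \<partial>lborel)"
    by (rule nn_integral_cmult) measurable
  also have "\<dots> \<le> ennreal (C\<^sup>2) * (ennreal (2 / \<theta> ^ N) * mass (ball z (sqrt h)))"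
  proof (intro mult_left_mono nn_integral_decay_le)
    show "\<theta> ^ N * (1 / \<alpha>) \<le> 1 / 2" by (rule N)
    show "(\<integral>\<^sup>+x. ennreal (w x) * indicator (ball z (sqrt h / \<theta> ^ k)) x \<partial>lborel) \<le>
        ennreal ((1 / \<alpha>) ^ k) * mass (ball z (sqrt h))" for k
      using mass_doubling[of "sqrt h" z k] h by (simp add: mass_def)
  qed (use \<theta> h \<alpha> in auto)
  also have "\<dots> = ennreal (C\<^sup>2 * (2 / \<theta> ^ N)) * mass (ball z (sqrt h))"
  proof -
    have "ennreal (C\<^sup>2 * (2 / \<theta> ^ N)) = ennreal (C\<^sup>2) * ennreal (2 / \<theta> ^ N)"
      by (rule ennreal_mult) (use \<theta> in auto)
    then show ?thesis by (simp only: mult.assoc)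
  qed
  finally show ?thesis .
qed

text \<open>On the thick superlevel set the rescaled weight is at least c, and
  \<open>stft_thick_set\<close> gives that set a fixed share of the energy of the dilated function.
  Returning to scale h in the 2d-dimensional phase space contributes h^d.\<close>

lemma transform_energy_ge:
  fixes \<phi> f :: "real^'n \<Rightarrow> complex" and w :: "(real^'n) \<times> (real^'n) \<Rightarrow> real"
  assumes w: "A_infty_weight w \<alpha> \<theta>" and schwartz: "schwartz \<phi>" and norm1: "l2_norm \<phi> = 1" and h: "0 < h"
    and shift: "\<And>v. norm v < \<theta> ^ k \<Longrightarrow> integrable lborel (\<lambda>s. (cmod (time_frequency_shift v \<phi> s - \<phi> s))\<^sup>2) \<and>
        (LINT s|lborel. (cmod (time_frequency_shift v \<phi> s - \<phi> s))\<^sup>2) < \<alpha> / 4"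
    and l: "0 < l" and big: "\<And>c. ennreal (l * measure lborel (ball c (sqrt h))) \<le> A_infty_weight.mass w (ball c (sqrt h))"
    and f: "f \<in> L2"
  shows "ennreal (h ^ CARD('n) * ((\<alpha> * (\<alpha> ^ k * l) / 2) * (\<alpha> / 4 * (2 * pi) ^ CARD('n) * (l2_norm f)\<^sup>2))) \<le>
    (\<integral>\<^sup>+z. ennreal (w z) * ennreal ((cmod (l2_inner f (coherent_state \<phi> h z)))\<^sup>2) \<partial>lborel)"
proof -
  interpret A_infty_weight w \<alpha> \<theta> by (rule w)
  note [measurable] = window_measurable[OF schwartz]
  note coh = coherent_state_norm[OF schwartz norm1 h]
  obtain M where M: "\<And>x. cmod (\<phi> x) \<le> M" using window_bounded[OF schwartz] by blast
  obtain g where gm [measurable]: "g \<in> borel_measurable borel" and g: "g \<in> L2" "l2_norm (f - g) = 0"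
    using L2_borel_representative[OF f] by blast
  have g2: "integrable lborel (\<lambda>x. (cmod (g x))\<^sup>2)" using g(1) by (simp add: L2_borel_iff)
  have eq: "l2_inner f (coherent_state \<phi> h z) = stft (dilate h g) \<phi> ((1 / sqrt h) *\<^sub>R z)" for z
    using L2_inner_cong_null[OF f g coh(1)] by (simp add: l2_inner_coherent_state h window_measurable[OF schwartz] gm)
  define S where "S = {z. \<alpha> * (\<alpha> ^ k * l) / 2 \<le> w (sqrt h *\<^sub>R z)}"
  note S = superlevel_thick_dilated[OF h l big, of k, folded S_def]
  have Sm [measurable]: "S \<in> sets borel" by (rule S)
  have wm [measurable]: "(\<lambda>z. w (sqrt h *\<^sub>R z)) \<in> borel_measurable borel"
    by (rule measurable_compose[OF _ w_measurable]) measurable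
  have sm [measurable]: "(\<lambda>z. stft (dilate h g) \<phi> ((1 / sqrt h) *\<^sub>R z)) \<in> borel_measurable borel"
    by (rule measurable_compose[of _ borel borel]) measurable
  define c where "c = \<alpha> * (\<alpha> ^ k * l) / 2"
  have c: "0 \<le> c" using \<alpha> l by (simp add: c_def)
  have thick: "ennreal (\<alpha> / 4 * (2 * pi) ^ CARD('n) * (l2_norm f)\<^sup>2) \<le>
      (\<integral>\<^sup>+z. indicator S z * ennreal ((cmod (stft (dilate h g) \<phi> z))\<^sup>2) \<partial>lborel)"
  proof -
    have "(LINT x|lborel. (cmod (dilate h g x))\<^sup>2) = (l2_norm f)\<^sup>2"
      using l2_norm_cong_null[OF f g] by (simp add: dilate_norm(2) h g2 l2_norm_borel)
    moreover have "ennreal (\<alpha> / 4 * (2 * pi) ^ DIM(real^'n) * (LINT x|lborel. (cmod (dilate h g x))\<^sup>2)) \<le>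
      (\<integral>\<^sup>+z. indicator S z * ennreal ((cmod (stft (dilate h g) \<phi> z))\<^sup>2) \<partial>lborel)"
      using \<theta> by (intro stft_thick_set[where \<delta>="\<theta> ^ k" and M=M] dilate_norm window_square_integrable[OF schwartz]
          window_norm[OF schwartz norm1] g2 h M Sm \<alpha>(1) shift S(2)) auto
    ultimately show ?thesis by simp
  qed
  define Y where "Y = \<alpha> / 4 * (2 * pi) ^ CARD('n) * (l2_norm f)\<^sup>2"
  have Y: "0 \<le> Y" using \<alpha> by (simp add: Y_def)
  have "ennreal (h ^ CARD('n) * (c * Y)) = ennreal (h ^ CARD('n)) * (ennreal c * ennreal Y)"
    using h c Y by (simp add: ennreal_mult)
  also have "\<dots> \<le> ennreal (h ^ CARD('n)) * (ennreal c * (\<integral>\<^sup>+z. indicator S z * ennreal ((cmod (stft (dilate h g) \<phi> z))\<^sup>2) \<partial>lborel))"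
    unfolding Y_def by (intro mult_left_mono thick) auto
  also have "\<dots> = ennreal (h ^ CARD('n)) * (\<integral>\<^sup>+z. ennreal c * (indicator S z * ennreal ((cmod (stft (dilate h g) \<phi> z))\<^sup>2)) \<partial>lborel)"
    by (subst nn_integral_cmult) auto
  also have "\<dots> \<le> ennreal (h ^ CARD('n)) * (\<integral>\<^sup>+z. ennreal (w (sqrt h *\<^sub>R z)) * ennreal ((cmod (stft (dilate h g) \<phi> z))\<^sup>2) \<partial>lborel)"
  proof (intro mult_left_mono nn_integral_mono)
    fix z
    show "ennreal c * (indicator S z * ennreal ((cmod (stft (dilate h g) \<phi> z))\<^sup>2)) \<le>
        ennreal (w (sqrt h *\<^sub>R z)) * ennreal ((cmod (stft (dilate h g) \<phi> z))\<^sup>2)"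
      by (cases "z \<in> S") (auto simp: S_def c_def intro!: mult_right_mono ennreal_leI)
  qed simp
  also have "\<dots> = (\<integral>\<^sup>+z. ennreal (w z) * ennreal ((cmod (stft (dilate h g) \<phi> ((1 / sqrt h) *\<^sub>R z)))\<^sup>2) \<partial>lborel)"
  proof -
    have "(\<integral>\<^sup>+z. ennreal (w z) * ennreal ((cmod (stft (dilate h g) \<phi> ((1 / sqrt h) *\<^sub>R z)))\<^sup>2) \<partial>lborel) =
        ennreal (\<bar>sqrt h\<bar> ^ DIM((real^'n) \<times> (real^'n))) * (\<integral>\<^sup>+z. ennreal (w (0 + sqrt h *\<^sub>R z)) *
          ennreal ((cmod (stft (dilate h g) \<phi> ((1 / sqrt h) *\<^sub>R (0 + sqrt h *\<^sub>R z))))\<^sup>2) \<partial>lborel)"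
      using h by (intro nn_integral_lborel_affine) auto
    moreover have "\<bar>sqrt h\<bar> ^ DIM((real^'n) \<times> (real^'n)) = h ^ CARD('n)"
      using h by (simp add: power_add flip: power_mult_distrib)
    ultimately show ?thesis using h by simp
  qed
  finally show ?thesis by (simp only: eq c_def Y_def)
qed

theorem theorem5p1:
  fixes \<phi> :: "real^'n \<Rightarrow> complex" and \<alpha> :: real
  assumes "schwartz \<phi>" and "l2_norm \<phi> = 1" and "0 < \<alpha>" and "\<alpha> < 1"
  shows "\<exists>C::real. C > 0 \<and>
    (\<forall>a\<in>A_infty \<alpha>. \<forall>h>0.
       ereal (inverse C * min_ball_average a h)
         \<le> (INF z\<in>spectrum (antiwick_operator \<phi> a h). ereal (Re z)) \<and>
       (INF z\<in>spectrum (antiwick_operator \<phi> a h). ereal (Re z))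
         \<le> ereal (C * min_ball_average a h))"
proof -
  note schwartz = assms(1) and norm1 = assms(2) and \<alpha> = assms(3,4)
  define d where "d = CARD('n)"
  define \<theta> where "\<theta> = (1 - \<alpha>) powr (1 / real DIM((real^'n) \<times> (real^'n)))"
  have \<theta>: "0 < \<theta>" "\<theta> < 1" "\<theta> ^ DIM((real^'n) \<times> (real^'n)) = 1 - \<alpha>"
  proof -
    show "0 < \<theta>" using \<alpha> by (simp add: \<theta>_def)
    show "\<theta> < 1"
      unfolding \<theta>_def using \<alpha> powr_less_mono2[of "1 / real DIM((real^'n) \<times> (real^'n))" "1 - \<alpha>" 1] by simp
    show "\<theta> ^ DIM((real^'n) \<times> (real^'n)) = 1 - \<alpha>" unfolding \<theta>_def using \<alpha> by (simp add: powr_power)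
  qed
  obtain \<delta> where \<delta>: "0 < \<delta>" and shift: "\<And>v. norm v < \<delta> \<Longrightarrow>
      integrable lborel (\<lambda>s. (cmod (time_frequency_shift v \<phi> s - \<phi> s))\<^sup>2) \<and>
      (LINT s|lborel. (cmod (time_frequency_shift v \<phi> s - \<phi> s))\<^sup>2) < \<alpha> / 4"
    using time_frequency_shift_continuous[OF window_measurable[OF schwartz] window_square_integrable[OF schwartz], of "\<alpha> / 4"] \<alpha>
    by auto
  \<comment> \<open>The thickness scale must be a power of \<theta>, because mass is compared
    between radii along these powers.\<close>
  obtain k where k: "\<theta> ^ k < \<delta>" using real_arch_pow_inv[OF \<delta> \<theta>(2)] by blast
  obtain N where "\<theta> ^ N < \<alpha> / 2" using real_arch_pow_inv[of "\<alpha> / 2" \<theta>] \<alpha> \<theta> by auto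
  then have N: "\<theta> ^ N * (1 / \<alpha>) \<le> 1 / 2" using \<alpha> by (simp add: field_simps)
  obtain M where M: "0 \<le> M" "\<And>z. (1 + norm z) ^ N * cmod (stft \<phi> \<phi> z) \<le> M"
    using schwartz_stft_decay[OF schwartz] by blast
  define \<beta> where "\<beta> = measure lborel (ball (0 :: (real^'n) \<times> (real^'n)) 1)"
  have \<beta>: "0 < \<beta>" unfolding \<beta>_def by (rule measure_ball_pos) simp
  \<comment> \<open>The level \<alpha> \<alpha>^k l / 2 times the energy share \<alpha> / 4 is l /
    c1; the powers of 2 \<pi> and h cancel against K.\<close>
  define c1 where "c1 = 8 / (\<alpha> * \<alpha> * \<alpha> ^ k)"
  \<comment> \<open>The constant of \<open>coherent_energy_le\<close> times \<beta>, which converts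
    averages to masses. The powers of h cancel and K leaves the power of 2 \<pi>.\<close>
  define c2 where "c2 = 1 / (2 * pi) ^ d * (M\<^sup>2 * (2 / \<theta> ^ N) * \<beta>)"
  define C where "C = max c1 c2"
  have c1: "0 < c1" using \<alpha> by (simp add: c1_def)
  have C: "0 < C" "c1 \<le> C" "c2 \<le> C" using c1 by (auto simp: C_def)
  have main: "ereal (inverse C * min_ball_average a h) \<le> (INF z\<in>spectrum (antiwick_operator \<phi> a h). ereal (Re z)) \<and>
      (INF z\<in>spectrum (antiwick_operator \<phi> a h). ereal (Re z)) \<le> ereal (C * min_ball_average a h)"
    if a: "a \<in> A_infty \<alpha>" and h: "0 < h" for a :: "(real^'n) \<times> (real^'n) \<Rightarrow> real" and h
  proof -
    obtain w where W: "A_infty_weight w \<alpha> \<theta>" and aw: "AE z in lebesgue. a z = w z"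
      and ball_int: "\<And>c r. (\<integral>\<^sup>+x. ennreal (w x) * indicator (ball c r) x \<partial>lborel) = ennreal (LINT x:ball c r|lebesgue. a x)"
      and ball_nonneg: "\<And>c r. 0 \<le> (LINT x:ball c r|lebesgue. a x)"
      using A_infty_borel_representative[OF a \<alpha> \<theta>] by blast
    interpret W: A_infty_weight w \<alpha> \<theta> by (rule W)
    define avg where "avg c = (LINT z:ball c (sqrt h)|lebesgue. a z) / measure lebesgue (ball c (sqrt h))" for c
    define l where "l = min_ball_average a h"
    have l: "l = (INF c. avg c)" by (simp add: l_def min_ball_average_def avg_def)
    have meas: "measure lborel (ball c (sqrt h)) = h ^ d * \<beta>" for c :: "(real^'n) \<times> (real^'n)"
    proof -
      have "measure lborel (ball c (sqrt h)) = sqrt h ^ DIM((real^'n) \<times> (real^'n)) * \<beta>"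
        unfolding \<beta>_def using h by (intro content_ball_conv_unit_ball) simp
      also have "sqrt h ^ DIM((real^'n) \<times> (real^'n)) = h ^ d"
        using h by (simp add: d_def power_add flip: power_mult_distrib)
      finally show ?thesis .
    qed
    have vol: "0 < h ^ d * \<beta>" using h \<beta> by simp
    have avg_int: "(LINT z:ball c (sqrt h)|lebesgue. a z) = avg c * (h ^ d * \<beta>)" for c
      using h \<beta> by (simp add: avg_def measure_completion meas)
    have avg0: "0 \<le> avg c" for c unfolding avg_def by (intro divide_nonneg_nonneg ball_nonneg) simp
    have mass: "W.mass (ball c (sqrt h)) = ennreal (avg c * (h ^ d * \<beta>))" for c
      unfolding W.mass_def ball_int avg_int ..
    have l0: "0 \<le> l" unfolding l by (rule cINF_greatest) (auto simp: avg0)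
    have lle: "l \<le> avg c" for c unfolding l by (rule cINF_lower) (auto intro!: bdd_belowI[of _ 0] simp: avg0)
    have energy: "(\<integral>\<^sup>+v. ennreal (w v) *
        ennreal ((cmod (l2_inner (coherent_state \<phi> h z) (coherent_state \<phi> h v)))\<^sup>2) \<partial>lborel) \<le>
        ennreal (M\<^sup>2 * (2 / \<theta> ^ N)) * W.mass (ball z (sqrt h))" for z
      by (rule coherent_energy_le[OF W schwartz norm1 h M(2) M(1) N])
    interpret S: antiwick_setting \<phi> h a w
    proof
      fix z
      have "ennreal (M\<^sup>2 * (2 / \<theta> ^ N)) * W.mass (ball z (sqrt h)) < \<infinity>"
        unfolding mass by (simp add: ennreal_mult_less_top)
      then show "(\<integral>\<^sup>+v. ennreal (w v) *
        ennreal ((cmod (l2_inner (coherent_state \<phi> h z) (coherent_state \<phi> h v)))\<^sup>2) \<partial>lborel) < \<infinity>"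
        by (rule le_less_trans[OF energy])
    qed (use schwartz norm1 h aw W.w_nonneg in auto)
    have K: "S.K = 1 / ((2 * pi) ^ d * h ^ d)"
      using h by (simp add: S.K_def d_def powr_minus_divide powr_realpow power_mult_distrib)
    have low: "inverse C * l \<le> Re z" if "z \<in> spectrum (antiwick_operator \<phi> a h)" for z
    proof (rule S.spectrum_antiwick_ge[OF _ that])
      fix f :: "real^'n \<Rightarrow> complex" assume f: "f \<in> L2"
      show "ennreal (inverse C * l * (l2_norm f)\<^sup>2) \<le> ennreal S.K * S.energy f"
      \<comment> \<open>A vanishing infimum makes the bound trivial, while the superlevel argument
        needs a positive threshold.\<close>
      proof (cases "l = 0")
        case True
        then show ?thesis by simp
      next
        case False
        then have lpos: "0 < l" using l0 by simp
        define X where "X = h ^ d * ((\<alpha> * (\<alpha> ^ k * l) / 2) * (\<alpha> / 4 * (2 * pi) ^ d * (l2_norm f)\<^sup>2))"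
        have "ennreal X \<le> S.energy f"
          unfolding X_def d_def S.energy_def S.transform_def
        proof (rule transform_energy_ge[OF W schwartz norm1 h _ lpos _ f])
          show "integrable lborel (\<lambda>s. (cmod (time_frequency_shift v \<phi> s - \<phi> s))\<^sup>2) \<and>
            (LINT s|lborel. (cmod (time_frequency_shift v \<phi> s - \<phi> s))\<^sup>2) < \<alpha> / 4" if "norm v < \<theta> ^ k" for v
            using that k by (intro shift) simp
          show "ennreal (l * measure lborel (ball c (sqrt h))) \<le> W.mass (ball c (sqrt h))" for c
            unfolding meas mass using vol by (intro ennreal_leI mult_right_mono lle) simp
        qed
        then have "ennreal S.K * ennreal X \<le> ennreal S.K * S.energy f" by (rule mult_left_mono) simp
        moreover have "inverse C * l * (l2_norm f)\<^sup>2 \<le> S.K * X"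
        proof -
          have "S.K * X = inverse c1 * l * (l2_norm f)\<^sup>2"
            unfolding K X_def c1_def using h \<alpha> by (simp add: field_simps del: power_mult_distrib)
          moreover have "inverse C \<le> inverse c1" using C c1 by (intro le_imp_inverse_le)
          ultimately show ?thesis using l0 by (simp add: mult_right_mono)
        qed
        moreover have "ennreal (S.K * X) = ennreal S.K * ennreal X"
          using S.K_pos by (intro ennreal_mult') simp
        ultimately show ?thesis using ennreal_leI[of "inverse C * l * (l2_norm f)\<^sup>2" "S.K * X"] by simp
      qed
    qed
    define I where "I = (INF z\<in>spectrum (antiwick_operator \<phi> a h). ereal (Re z))"
    have I_ge: "ereal (inverse C * l) \<le> I"
      unfolding I_def using low by (intro INF_greatest) simp
    have I_le: "I \<le> ereal (C * avg z)" for z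
    proof -
      have "ennreal S.K * S.energy (coherent_state \<phi> h z) \<le> ennreal S.K * (ennreal (M\<^sup>2 * (2 / \<theta> ^ N)) * ennreal (avg z * (h ^ d * \<beta>)))"
        using energy[of z] unfolding mass S.energy_def S.transform_def by (rule mult_left_mono) simp
      also have "\<dots> = ennreal (S.K * ((M\<^sup>2 * (2 / \<theta> ^ N)) * (avg z * (h ^ d * \<beta>))))"
      proof -
        have gen: "ennreal A * (ennreal B * ennreal E) = ennreal (A * (B * E))" if "0 \<le> A" "0 \<le> B" "0 \<le> E" for A B E
          using that by (simp add: ennreal_mult)
        show ?thesis by (rule gen) (use S.K_pos \<theta> avg0[of z] vol in auto)
      qed
      also have "S.K * ((M\<^sup>2 * (2 / \<theta> ^ N)) * (avg z * (h ^ d * \<beta>))) = c2 * avg z"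
        unfolding K c2_def using h by (simp add: field_simps del: power_mult_distrib)
      also have "ennreal (c2 * avg z) \<le> ennreal (C * avg z)"
        using C avg0[of z] by (intro ennreal_leI mult_right_mono)
      finally obtain \<zeta> where \<zeta>: "\<zeta> \<in> spectrum (antiwick_operator \<phi> a h)" "Re \<zeta> \<le> C * avg z"
        using S.spectrum_antiwick_le[of z "C * avg z"] C avg0[of z] by auto
      have "I \<le> ereal (Re \<zeta>)" unfolding I_def using \<zeta>(1) by (rule INF_lower)
      also have "\<dots> \<le> ereal (C * avg z)" using \<zeta>(2) by simp
      finally show ?thesis .
    qed
    \<comment> \<open>\<open>I_ge\<close> excludes minus infinity; \<open>I_le\<close> excludes plus
      infinity, the value for an empty spectrum.\<close>
    obtain r where r: "I = ereal r"
      using I_ge I_le[of 0] by (cases I) auto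
    \<comment> \<open>The upper bound holds for every centre with the same C, so after division by C
      the infimum over centres can be taken.\<close>
    have "r / C \<le> l" unfolding l
    proof (rule cINF_greatest)
      show "r / C \<le> avg z" for z using I_le[of z] C(1) by (simp add: r field_simps)
    qed simp
    then have "I \<le> ereal (C * l)" using C(1) by (simp add: r field_simps)
    then show ?thesis using I_ge by (simp add: I_def l_def)
  qed
  then show ?thesis using C(1) by blast
qed

end
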